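(* Let $\Delta$ be a complete simplicial fan in a lattice $N$ of rank $n$, let $1\le k\le n$, and let $x\in H_T^{2k}(\Delta)_{\mathbb{Q}}$. Then $$\bar{x}=\sum_{J\in\Sigma^{(k)}}\mu(x,J)\,\bar{x}_J\qquad\text{in } \mathrm{Rat}(G_{n-k+1}(N_{\mathbb{Q}}))_0\otimes_{\mathbb{Q}}H^{2k}(\Delta)_{\mathbb{Q}}.$$
   Context: Let $N$ be a lattice (free abelian group) of rank $n$, $M=\mathrm{Hom}(N,\mathbb{Z})$, with pairing $\langle\ ,\ \rangle$; subscripts $\mathbb{Q},\mathbb{R}$ denote tensoring with $\mathbb{Q},\mathbb{R}$. Fan. For a simplicial fan $\Delta$ of rational cones in $N_{\mathbb{R}}$, let $\Sigma^{(1)}$ be its set of rays and $\Sigma$ the simplicial complex on the vertex set $\Sigma^{(1)}$ whose simplices $J$ are the sets of rays that are the edges of a cone $C(J)$ of $\Delta$ (the empty set is included). $\Sigma^{(k)}$ is the set of $J\in\Sigma$ with $|J|=k$. For $i\in\Sigma^{(1)}$, $v_i$ is the primitive vector of $N$ generating the ray $i$. For $J\in\Sigma$: $N_{J,\mathcal V}$ is the sublattice generated by $\{v_j\}_{j\in J}$, $N_J$ is the minimal primitive (saturated) sublattice of $N$ containing it, and $\{u_j^J\}_{j\in J}$ is the basis of $N_{J,\mathcal V}^*$ dual to $\{v_j\}_{j\in J}$. For $I\in\Sigma^{(n)}$, the $u_i^I$ are regarded as elements of $M_{\mathbb{Q}}$. Cohomology. $H_T^*(pt)$ is the symmetric algebra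 of $M$, with $M=H_T^2(pt)$ in degree 2. $H_T^*(\Delta)$ is the Stanley–Reisner ring $\mathbb{Z}[x_i\mid i\in\Sigma^{(1)}]/(\prod_{i\in K}x_i\mid K\notin\Sigma)$ with $\deg x_i=2$, an $H_T^*(pt)$-algebra via $u\mapsto\sum_{i}\langle u,v_i\rangle x_i$ for $u\in M$. Put $x_J=\prod_{j\in J}x_j$. $H^*(\Delta)_{\mathbb{Q}}$ is the quotient of $H_T^*(\Delta)_{\mathbb{Q}}$ by the ideal generated by the image of the positive-degree part $H_T^+(pt)_{\mathbb{Q}}$, and $\bar{x}$ denotes the image of $x$ in $H^*(\Delta)_{\mathbb{Q}}$. For $I\in\Sigma^{(n)}$, $\iota_I^*:H_T^*(\Delta)_{\mathbb{Q}}\to H_T^*(pt)_{\mathbb{Q}}$ is the ring homomorphism with $\iota_I^*(x_i)=u_i^I$ for $i\in I$ and $\iota_I^*(x_i)=0$ for $i\notin I$. The functions $\mu(x,J)$. For $J\in\Sigma^{(k)}$ let $M_J\subset M$ be the annihilator of $N_J$, choose an orientation of $M_J$, and put $\omega_J=u_1\wedge\cdots\wedge u_{n-k}\in\bigwedge^{n-k}M$ for an oriented basis $u_1,\dots,u_{n-k}$ of $M_J$. Define $f^J(x_i)=\iota_I^*(x_i)\wedge\omega_J\in\bigwedge^{n-k+1}M_{\mathbb{Q}}$, where $I\in\Sigma^{(n)}$ is any simplex containing $J$ (the result is independent of $I$), and extend $f^J$ to a ring homomorphism $f^J:H_T^*(\Delta)_{\mathbb{Q}}\to S^*(\bigwedge^{n-k+1}M_{\mathbb{Q}})$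 to the symmetric algebra. For $x\in H_T^{2k}(\Delta)_{\mathbb{Q}}$, the quotient $f^J(x)/f^J(x_J)$ is homogeneous of degree $0$, independent of the orientation chosen, and is viewed as a rational function of degree $0$ on $\mathbb{P}(\bigwedge^{n-k+1}N_{\mathbb{Q}})$. Let $G_{n-k+1}(N_{\mathbb{Q}})$ be the Grassmannian of $(n-k+1)$-planes in $N_{\mathbb{Q}}$, $\mathrm{Rat}(G_{n-k+1}(N_{\mathbb{Q}}))_0$ its field of rational functions (of degree $0$), and $\nu:G_{n-k+1}(N_{\mathbb{Q}})\to\mathbb{P}(\bigwedge^{n-k+1}N_{\mathbb{Q}})$ the Plücker embedding. Then $\mu(x,J)=\nu^*\big(f^J(x)/f^J(x_J)\big)\in\mathrm{Rat}(G_{n-k+1}(N_{\mathbb{Q}}))_0$. *)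

theory Defs
  imports
    "HOL-Analysis.Analysis"
    "HOL-Combinatorics.Permutations"
    "HOL-Library.Poly_Mapping"
    "HOL-Algebra.Free_Abelian_Groups"
    "HOL-Algebra.Module"
    "HOL-Algebra.QuotRing"
begin

text \<open>
  Conventions. The lattice \<open>N\<close> of rank \<open>n = CARD('n)\<close> is \<open>int ^ 'n\<close>, with
  \<open>N\<^sub>\<rat> = rat ^ 'n\<close> and \<open>N\<^sub>\<real> = real ^ 'n\<close>; its dual \<open>M\<close> is also \<open>int ^ 'n\<close>
  (coordinates in the dual basis) and \<open>M\<^sub>\<rat> = rat ^ 'n\<close>. The linear order on \<open>'n\<close> only serves
  to order the basis vectors when writing down exterior powers.
  Generators of graded rings of cohomological degree 2 are given polynomial degree 1, so the part
  of degree \<open>2k\<close> consists of homogeneous polynomials of degree \<open>k\<close>.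
\<close>

definition pairing :: "'a::comm_ring_1 ^ 'n \<Rightarrow> 'a ^ 'n \<Rightarrow> 'a" where
  "pairing u v = (\<Sum>a\<in>UNIV. u $ a * v $ a)"

definition real_vec :: "int ^ 'n \<Rightarrow> real ^ 'n" where
  "real_vec v = (\<chi> a. of_int (v $ a))"

definition rat_vec :: "int ^ 'n \<Rightarrow> rat ^ 'n" where
  "rat_vec v = (\<chi> a. of_int (v $ a))"


section \<open>Polynomial rings\<close>

type_synonym 'v qpoly = "('v \<Rightarrow>\<^sub>0 nat) \<Rightarrow>\<^sub>0 rat"

definition cst :: "rat \<Rightarrow> 'v qpoly" where
  "cst c = Poly_Mapping.single 0 c"

definition var :: "'v \<Rightarrow> 'v qpoly" where
  "var i = Poly_Mapping.single (Poly_Mapping.single i 1) 1"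

definition homogeneous :: "nat \<Rightarrow> 'v qpoly \<Rightarrow> bool" where
  "homogeneous d p \<longleftrightarrow>
     (\<forall>m\<in>Poly_Mapping.keys p. (\<Sum>i\<in>Poly_Mapping.keys m. Poly_Mapping.lookup m i) = d)"

definition polys :: "'v set \<Rightarrow> 'v qpoly set" where
  "polys V = {p. \<forall>m\<in>Poly_Mapping.keys p. Poly_Mapping.keys m \<subseteq> V}"

definition poly_ring :: "'v set \<Rightarrow> 'v qpoly ring" where
  "poly_ring V = \<lparr>carrier = polys V, mult = (*), one = 1, zero = 0, add = (+)\<rparr>"

text \<open>
  The homomorphism that is \<open>c\<close> on coefficients and maps the variable \<open>i\<close> to \<open>h i\<close>:
  substitution of polynomials for \<open>c = cst\<close>, evaluation at a rational point for \<open>c = id\<close>.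
\<close>
definition aeval :: "(rat \<Rightarrow> 'r::comm_ring_1) \<Rightarrow> ('v \<Rightarrow> 'r) \<Rightarrow> 'v qpoly \<Rightarrow> 'r" where
  "aeval c h p = (\<Sum>m\<in>Poly_Mapping.keys p. c (Poly_Mapping.lookup p m) *
     (\<Prod>i\<in>Poly_Mapping.keys m. h i ^ Poly_Mapping.lookup m i))"


section \<open>Complete simplicial fans\<close>

definition simplicial_rational_cone :: "(real ^ 'n) set \<Rightarrow> bool" where
  "simplicial_rational_cone C \<longleftrightarrow>
     (\<exists>B :: (int ^ 'n) set. independent (real_vec ` B) \<and> C = convex_cone hull (real_vec ` B))"

definition simplicial_fan :: "(real ^ 'n) set set \<Rightarrow> bool" where
  "simplicial_fan \<Delta> \<longleftrightarrow>
     finite \<Delta> \<and> \<Delta> \<noteq> {} \<and>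
     (\<forall>C\<in>\<Delta>. simplicial_rational_cone C) \<and>
     (\<forall>C\<in>\<Delta>. \<forall>F. F face_of C \<and> F \<noteq> {} \<longrightarrow> F \<in> \<Delta>) \<and>
     (\<forall>C\<in>\<Delta>. \<forall>D\<in>\<Delta>. (C \<inter> D) face_of C \<and> (C \<inter> D) face_of D)"

definition complete_simplicial_fan :: "(real ^ 'n) set set \<Rightarrow> bool" where
  "complete_simplicial_fan \<Delta> \<longleftrightarrow> simplicial_fan \<Delta> \<and> \<Union>\<Delta> = UNIV"

definition rays :: "(real ^ 'n) set set \<Rightarrow> (real ^ 'n) set set" where
  "rays \<Delta> = {\<rho>\<in>\<Delta>. aff_dim \<rho> = 1}"

definition edges :: "(real ^ 'n) set set \<Rightarrow> (real ^ 'n) set \<Rightarrow> (real ^ 'n) set set" where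
  "edges \<Delta> C = {\<rho>\<in>rays \<Delta>. \<rho> face_of C}"

text \<open>The simplicial complex \<open>\<Sigma>\<close> of the fan, and \<open>\<Sigma>\<^sup>(\<^sup>k\<^sup>)\<close>.\<close>

definition simplices :: "(real ^ 'n) set set \<Rightarrow> (real ^ 'n) set set set" where
  "simplices \<Delta> = edges \<Delta> ` \<Delta>"

definition simplices_of_card :: "(real ^ 'n) set set \<Rightarrow> nat \<Rightarrow> (real ^ 'n) set set set" where
  "simplices_of_card \<Delta> k = {J\<in>simplices \<Delta>. card J = k}"

definition primitive_vector :: "int ^ 'n \<Rightarrow> bool" where
  "primitive_vector v \<longleftrightarrow> v \<noteq> 0 \<and> (\<forall>c w. v = c *s w \<longrightarrow> \<bar>c\<bar> = 1)"

definition ray_vec :: "(real ^ 'n) set \<Rightarrow> int ^ 'n" where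
  "ray_vec \<rho> = (THE v. primitive_vector v \<and> real_vec v \<in> \<rho>)"

definition primitive_sublattice :: "(int ^ 'n) set \<Rightarrow> bool" where
  "primitive_sublattice L \<longleftrightarrow>
     0 \<in> L \<and> (\<forall>v\<in>L. \<forall>w\<in>L. v - w \<in> L) \<and> (\<forall>c w. c \<noteq> 0 \<and> c *s w \<in> L \<longrightarrow> w \<in> L)"

definition N_of :: "(real ^ 'n) set set \<Rightarrow> (int ^ 'n) set" where
  "N_of J = \<Inter>{L. primitive_sublattice L \<and> ray_vec ` J \<subseteq> L}"

definition M_of :: "(real ^ 'n) set set \<Rightarrow> (int ^ 'n) set" where
  "M_of J = {u. \<forall>w\<in>N_of J. pairing u w = 0}"

definition lattice_basis :: "(int ^ 'n) list \<Rightarrow> (int ^ 'n) set \<Rightarrow> bool" where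
  "lattice_basis us L \<longleftrightarrow>
     L = {\<Sum>i<length us. c i *s us ! i | c. True} \<and>
     (\<forall>c. (\<Sum>i<length us. c i *s us ! i) = 0 \<longrightarrow> (\<forall>i<length us. c i = 0))"

text \<open>The choice of an oriented basis of \<open>M\<^sub>J\<close>; it matters only up to the sign of \<open>\<omega>\<^sub>J\<close>.\<close>
definition M_basis :: "(real ^ 'n) set set \<Rightarrow> (int ^ 'n) list" where
  "M_basis J = (SOME us. lattice_basis us (M_of J))"


section \<open>Cohomology rings\<close>

definition mono_of :: "(real ^ 'n) set set \<Rightarrow> (real ^ 'n) set qpoly" where
  "mono_of J = (\<Prod>\<rho>\<in>J. var \<rho>)"

definition SR_ideal :: "(real ^ 'n) set set \<Rightarrow> (real ^ 'n) set qpoly set" where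
  "SR_ideal \<Delta> = Idl\<^bsub>poly_ring (rays \<Delta>)\<^esub> {mono_of K | K. K \<subseteq> rays \<Delta> \<and> K \<notin> simplices \<Delta>}"

text \<open>\<open>H\<^sub>T\<^sup>*(\<Delta>)\<^sub>\<rat>\<close>, written as the Stanley--Reisner ring with rational coefficients.\<close>
definition HT :: "(real ^ 'n) set set \<Rightarrow> (real ^ 'n) set qpoly set ring" where
  "HT \<Delta> = poly_ring (rays \<Delta>) Quot SR_ideal \<Delta>"

definition HT_class ::
    "(real ^ 'n) set set \<Rightarrow> (real ^ 'n) set qpoly \<Rightarrow> (real ^ 'n) set qpoly set" where
  "HT_class \<Delta> p = SR_ideal \<Delta> +>\<^bsub>poly_ring (rays \<Delta>)\<^esub> p"

definition HT_deg :: "(real ^ 'n) set set \<Rightarrow> nat \<Rightarrow> (real ^ 'n) set qpoly set set" where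
  "HT_deg \<Delta> k = HT_class \<Delta> ` {p\<in>polys (rays \<Delta>). homogeneous k p}"

text \<open>
  The structure map of \<open>H\<^sub>T\<^sup>*(\<Delta>)\<^sub>\<rat>\<close> over \<open>H\<^sub>T\<^sup>*(pt)\<^sub>\<rat>\<close>, the latter being the polynomial ring on
  the standard basis of \<open>M\<close>, whose element with index \<open>a\<close> pairs with \<open>v \<in> N\<close> to \<open>v $ a\<close>.
\<close>
definition structure_map ::
    "(real ^ 'n) set set \<Rightarrow> 'n qpoly \<Rightarrow> (real ^ 'n) set qpoly set" where
  "structure_map \<Delta> p = HT_class \<Delta>
     (aeval cst (\<lambda>a. \<Sum>\<rho>\<in>rays \<Delta>. cst (of_int (ray_vec \<rho> $ a)) * var \<rho>) p)"

definition HT_pt_positive :: "'n qpoly set" where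
  "HT_pt_positive = {p. Poly_Mapping.lookup p 0 = 0}"

definition H_ideal :: "(real ^ 'n) set set \<Rightarrow> (real ^ 'n) set qpoly set set" where
  "H_ideal \<Delta> = Idl\<^bsub>HT \<Delta>\<^esub> (structure_map \<Delta> ` HT_pt_positive)"

text \<open>\<open>H\<^sup>*(\<Delta>)\<^sub>\<rat>\<close> and the projection \<open>x \<mapsto> x\<close>-bar onto it.\<close>

definition coh_ring :: "(real ^ 'n) set set \<Rightarrow> (real ^ 'n) set qpoly set set ring" where
  "coh_ring \<Delta> = HT \<Delta> Quot H_ideal \<Delta>"

definition bar ::
    "(real ^ 'n) set set \<Rightarrow> (real ^ 'n) set qpoly set \<Rightarrow> (real ^ 'n) set qpoly set set" where
  "bar \<Delta> x = H_ideal \<Delta> +>\<^bsub>HT \<Delta>\<^esub> x"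

text \<open>
  \<open>H\<^sup>2\<^sup>k(\<Delta>)\<^sub>\<rat>\<close> as a vector space over \<open>\<rat>\<close>. Only the additive structure and the scalar
  multiplication are meaningful; \<open>mult\<close> and \<open>one\<close> are there because \<open>module\<close> extends \<open>ring\<close>.
\<close>
definition H_deg ::
    "(real ^ 'n) set set \<Rightarrow> nat \<Rightarrow> (rat, (real ^ 'n) set qpoly set set) module" where
  "H_deg \<Delta> k = \<lparr>carrier = bar \<Delta> ` HT_deg \<Delta> k, mult = mult (coh_ring \<Delta>), one = one (coh_ring \<Delta>),
     zero = zero (coh_ring \<Delta>), add = add (coh_ring \<Delta>),
     smult = (\<lambda>c z. bar \<Delta> (HT_class \<Delta> (cst c)) \<otimes>\<^bsub>coh_ring \<Delta>\<^esub> z)\<rparr>"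


section \<open>Exterior powers, the Grassmannian and its function field\<close>

text \<open>
  Coordinates of \<open>w\<^sub>1 \<and> \<dots> \<and> w\<^sub>m\<close> with respect to the basis \<open>e\<^sub>K\<close> (the wedge of the standard basis
  vectors with index in \<open>K\<close>, in increasing order), \<open>K\<close> ranging over the subsets of \<open>'n\<close> with \<open>m\<close>
  elements. In other words, the \<open>m \<times> m\<close> minors. It is used both in
  \<open>\<And>\<^sup>m M\<^sub>\<rat>\<close> and in \<open>\<And>\<^sup>m N\<^sub>\<rat>\<close>, whose bases are dual to each other.
\<close>
definition wedge :: "(rat ^ 'n::{finite,linorder}) list \<Rightarrow> 'n set \<Rightarrow> rat" where
  "wedge ws K = (if card K = length ws
     then \<Sum>\<pi> | \<pi> permutes {..<length ws}. of_int (sign \<pi>) *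
            (\<Prod>i<length ws. (ws ! i) $ (sorted_list_of_set K ! \<pi> i))
     else 0)"

text \<open>\<open>S\<^sup>*(\<And>\<^sup>m M\<^sub>\<rat>)\<close> is the polynomial ring on the basis vectors \<open>e\<^sub>K\<close> with \<open>card K = m\<close>.\<close>
definition plucker_polys :: "nat \<Rightarrow> 'n::finite set qpoly set" where
  "plucker_polys m = polys {K. card K = m}"

definition linear_form :: "nat \<Rightarrow> ('n::finite set \<Rightarrow> rat) \<Rightarrow> 'n set qpoly" where
  "linear_form m \<eta> = (\<Sum>K | card K = m. cst (\<eta> K) * var K)"

definition grassmannian :: "nat \<Rightarrow> (rat ^ 'n) set set" where
  "grassmannian m = {E. vec.subspace E \<and> vec.dim E = m}"

text \<open>
  The point of \<open>\<P>(\<And>\<^sup>m N\<^sub>\<rat>)\<close> that the Pluecker embedding assigns to \<open>E\<close>, as the set of all its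
  representatives in \<open>\<And>\<^sup>m N\<^sub>\<rat> - {0}\<close> (a change of basis of \<open>E\<close> multiplies \<open>wedge ws\<close> by the
  determinant, so for \<open>m \<ge> 1\<close> these are all the nonzero multiples of one vector).
\<close>
definition plucker :: "(rat ^ 'n::{finite,linorder}) set \<Rightarrow> ('n set \<Rightarrow> rat) set" where
  "plucker E = {wedge ws | ws. distinct ws \<and> vec.independent (set ws) \<and> vec.span (set ws) = E}"

definition vanishes_on_G :: "nat \<Rightarrow> 'n::{finite,linorder} set qpoly \<Rightarrow> bool" where
  "vanishes_on_G m P \<longleftrightarrow> (\<forall>E\<in>grassmannian m. \<forall>\<xi>\<in>plucker E. aeval id \<xi> P = 0)"

text \<open>
  The field \<open>Rat(G\<^sub>m(N\<^sub>\<rat>))\<^sub>0\<close>: fractions \<open>P / Q\<close> of forms of equal degree on \<open>\<And>\<^sup>m N\<^sub>\<rat>\<close> with \<open>Q\<close>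
  not vanishing identically on the Grassmannian, two fractions being identified when they agree on
  it. In other words, the degree 0 part of the homogeneous localization at the zero ideal of the
  homogeneous coordinate ring. The class of \<open>P / Q\<close> is the pullback of \<open>P / Q\<close> along \<open>\<nu>\<close>.
\<close>
definition fractions :: "nat \<Rightarrow> ('n::{finite,linorder} set qpoly \<times> 'n set qpoly) set" where
  "fractions m = {(P, Q). P \<in> plucker_polys m \<and> Q \<in> plucker_polys m \<and>
     (\<exists>d. homogeneous d P \<and> homogeneous d Q) \<and> \<not> vanishes_on_G m Q}"

definition fraction_rel ::
    "nat \<Rightarrow> (('n::{finite,linorder} set qpoly \<times> 'n set qpoly) \<times>
             ('n set qpoly \<times> 'n set qpoly)) set" where
  "fraction_rel m = {((P, Q), (P', Q')). (P, Q) \<in> fractions m \<and> (P', Q') \<in> fractions m \<and>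
     vanishes_on_G m (P * Q' - P' * Q)}"

definition pullback ::
    "nat \<Rightarrow> 'n::{finite,linorder} set qpoly \<Rightarrow> 'n set qpoly
      \<Rightarrow> ('n set qpoly \<times> 'n set qpoly) set" where
  "pullback m P Q = fraction_rel m `` {(P, Q)}"

definition Rat_G ::
    "nat \<Rightarrow> (rat, ('n::{finite,linorder} set qpoly \<times> 'n set qpoly) set) module" where
  "Rat_G m = \<lparr>carrier = fractions m // fraction_rel m,
     mult = (\<lambda>X Y. \<Union>(P, Q)\<in>X. \<Union>(P', Q')\<in>Y. pullback m (P * P') (Q * Q')),
     one = pullback m 1 1,
     zero = pullback m 0 1,
     add = (\<lambda>X Y. \<Union>(P, Q)\<in>X. \<Union>(P', Q')\<in>Y. pullback m (P * Q' + P' * Q) (Q * Q')),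
     smult = (\<lambda>c X. \<Union>(P, Q)\<in>X. pullback m (cst c * P) Q)\<rparr>"


section \<open>The functions \<open>\<mu>(x, J)\<close>\<close>

text \<open>For \<open>card I = n\<close>, the vector \<open>u\<^sub>i\<^sup>I \<in> M\<^sub>\<rat>\<close> of the basis dual to the \<open>v\<^sub>j\<close> with \<open>j \<in> I\<close>.\<close>
definition dual_vec :: "(real ^ 'n) set set \<Rightarrow> (real ^ 'n) set \<Rightarrow> rat ^ 'n" where
  "dual_vec I i = (THE u. \<forall>j\<in>I. pairing u (rat_vec (ray_vec j)) = (if j = i then 1 else 0))"

text \<open>The value of \<open>\<iota>\<^sub>I\<^sup>*\<close> on the generator \<open>x\<^sub>i\<close>.\<close>
definition iota :: "(real ^ 'n) set set \<Rightarrow> (real ^ 'n) set \<Rightarrow> rat ^ 'n" where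
  "iota I i = (if i \<in> I then dual_vec I i else 0)"

definition top_simplex :: "(real ^ 'n) set set \<Rightarrow> (real ^ 'n) set set \<Rightarrow> (real ^ 'n) set set" where
  "top_simplex \<Delta> J = (SOME I. I \<in> simplices_of_card \<Delta> CARD('n) \<and> J \<subseteq> I)"

text \<open>\<open>f\<^sup>J(x\<^sub>i) = \<iota>\<^sub>I\<^sup>*(x\<^sub>i) \<and> \<omega>\<^sub>J\<close> as a linear form on \<open>\<And>\<^sup>n\<^sup>-\<^sup>k\<^sup>+\<^sup>1 N\<^sub>\<rat>\<close>.\<close>
definition f_gen ::
    "(real ^ 'n::{finite,linorder}) set set \<Rightarrow> (real ^ 'n::{finite,linorder}) set set
      \<Rightarrow> (real ^ 'n::{finite,linorder}) set \<Rightarrow> 'n set qpoly" where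
  "f_gen \<Delta> J i = linear_form (CARD('n) - card J + 1)
     (wedge (iota (top_simplex \<Delta> J) i # map rat_vec (M_basis J)))"

text \<open>
  The homomorphism \<open>f\<^sup>J\<close> on \<open>H\<^sub>T\<^sup>*(\<Delta>)\<^sub>\<rat>\<close>: elements of the quotient ring are cosets, on which the
  substitution homomorphism is constant.
\<close>
definition f_hom ::
    "(real ^ 'n::{finite,linorder}) set set \<Rightarrow> (real ^ 'n::{finite,linorder}) set set
      \<Rightarrow> (real ^ 'n::{finite,linorder}) set qpoly set \<Rightarrow> 'n set qpoly" where
  "f_hom \<Delta> J x = the_elem (aeval cst (f_gen \<Delta> J) ` x)"

definition x_of :: "(real ^ 'n) set set \<Rightarrow> (real ^ 'n) set set \<Rightarrow> (real ^ 'n) set qpoly set" where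
  "x_of \<Delta> J = HT_class \<Delta> (mono_of J)"

definition mu ::
    "(real ^ 'n::{finite,linorder}) set set \<Rightarrow> (real ^ 'n::{finite,linorder}) set qpoly set
      \<Rightarrow> (real ^ 'n::{finite,linorder}) set set \<Rightarrow> ('n set qpoly \<times> 'n set qpoly) set" where
  "mu \<Delta> x J = pullback (CARD('n) - card J + 1) (f_hom \<Delta> J x) (f_hom \<Delta> J (x_of \<Delta> J))"


section \<open>Tensor products\<close>

text \<open>
  The tensor product of two modules over the ring of all scalars of type \<open>'r\<close>, as the free abelian
  group on pairs modulo the bilinearity relations. As a group of HOL-Algebra it is written
  multiplicatively, so \<open>finprod\<close> in it is the sum of tensors.
\<close>
definition tensor_relations ::
    "('r, 'a) module \<Rightarrow> ('r, 'b) module \<Rightarrow> (('a \<times> 'b) \<Rightarrow>\<^sub>0 int) set" where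
  "tensor_relations A B =
     {frag_of (a \<oplus>\<^bsub>A\<^esub> a', b) - frag_of (a, b) - frag_of (a', b) | a a' b.
        a \<in> carrier A \<and> a' \<in> carrier A \<and> b \<in> carrier B} \<union>
     {frag_of (a, b \<oplus>\<^bsub>B\<^esub> b') - frag_of (a, b) - frag_of (a, b') | a b b'.
        a \<in> carrier A \<and> b \<in> carrier B \<and> b' \<in> carrier B} \<union>
     {frag_of (c \<odot>\<^bsub>A\<^esub> a, b) - frag_of (a, c \<odot>\<^bsub>B\<^esub> b) | c a b.
        a \<in> carrier A \<and> b \<in> carrier B}"

definition tensor_kernel ::
    "('r, 'a) module \<Rightarrow> ('r, 'b) module \<Rightarrow> (('a \<times> 'b) \<Rightarrow>\<^sub>0 int) set" where
  "tensor_kernel A B =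
     generate (free_Abelian_group (carrier A \<times> carrier B)) (tensor_relations A B)"

definition tensor_product ::
    "('r, 'a) module \<Rightarrow> ('r, 'b) module \<Rightarrow> (('a \<times> 'b) \<Rightarrow>\<^sub>0 int) set monoid" where
  "tensor_product A B = free_Abelian_group (carrier A \<times> carrier B) Mod tensor_kernel A B"

definition tensor ::
    "('r, 'a) module \<Rightarrow> ('r, 'b) module \<Rightarrow> 'a \<Rightarrow> 'b \<Rightarrow> (('a \<times> 'b) \<Rightarrow>\<^sub>0 int) set" where
  "tensor A B a b =
     tensor_kernel A B #>\<^bsub>free_Abelian_group (carrier A \<times> carrier B)\<^esub> frag_of (a, b)"

end

theory Submission
  imports Defs
begin

text \<open>
  The proof evaluates everything at one plane \<open>E\<close> in \<open>N\<^sub>\<rat>\<close> of dimension \<open>n - k + 1\<close>. Let \<open>E\<close> be spanned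
  by \<open>w\<^sub>0, \<dots>, w\<^sub>r\<close>. By the Cauchy--Binet formula the value of the linear form \<open>u \<and> \<omega>\<^sub>J\<close> at the
  Pluecker coordinates of \<open>E\<close> is the Gram determinant of \<open>u\<close> and a basis of \<open>M\<^sub>J\<close> against the \<open>w\<^sub>s\<close>
  (\<open>contraction\<close>). Hence it is zero if \<open>u\<close> annihilates \<open>J\<close> and also if \<open>u\<close> annihilates \<open>E\<close>. The first
  fact gives \<open>f\<^sup>J(x\<^sub>i) = 0\<close> for \<open>i \<notin> J\<close>; the second says that at \<open>E\<close> every \<open>f\<^sup>J\<close> kills the image
  \<open>\<Sum>\<^sub>i \<langle>u, v\<^sub>i\<rangle> x\<^sub>i\<close> of a functional \<open>u\<close> that vanishes on \<open>E\<close> (\<open>sum_weight\<close>).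

  Suppose that no \<open>f\<^sup>J(x\<^sub>J)\<close> with \<open>|J| = k\<close> vanishes at \<open>E\<close>, and replace each \<open>\<mu>(x, J)\<close> by its value at
  \<open>E\<close>. Then the formula holds in \<open>H\<^sup>2\<^sup>k(\<Delta>)\<^sub>\<rat>\<close> itself. It is enough to consider monomials, by descending
  induction on the size of the support \<open>K\<close> (\<open>expands_monomial\<close>). If \<open>K\<close> is not a simplex, both sides are
  zero; if the monomial is \<open>x\<^sub>K\<close>, then \<open>\<mu>(x\<^sub>K, J)\<close> is \<open>1\<close> for \<open>J = K\<close> and \<open>0\<close> otherwise. In the remaining
  case \<open>|K| < k\<close> and some \<open>x\<^sub>i\<close> is repeated. As the fan is complete, \<open>K\<close> is a proper subset of some
  \<open>J \<in> \<Sigma>\<^sup>(\<^sup>k\<^sup>)\<close>, and the nonvanishing of \<open>f\<^sup>J(x\<^sub>J)\<close> puts \<open>E\<close> and the span of \<open>K\<close> in general position.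
  So there is a functional \<open>u\<close>, zero on \<open>E\<close>, with \<open>\<langle>u, v\<^sub>i\<rangle> = 1\<close> and \<open>\<langle>u, v\<^sub>j\<rangle> = 0\<close> for the other
  \<open>j \<in> K\<close>. Its image in \<open>H\<^sup>*(\<Delta>)\<^sub>\<rat>\<close> is zero, and multiplying it by the rest of the monomial expresses the
  monomial by monomials with larger support, on both sides in the same way.

  To return to the tensor product, bring all \<open>\<mu>(x, J)\<close> to a common denominator \<open>D\<close>, which does not
  vanish identically because the rational points of the Grassmannian are irreducible
  (\<open>common_nonzero_frame\<close>). A sum of tensors \<open>(P\<^sub>i / D) \<otimes> q\<^sub>i\<close> is zero as soon as \<open>\<Sum>\<^sub>i P\<^sub>i(E) q\<^sub>i = 0\<close> for
  all \<open>E\<close> with \<open>D(E) \<noteq> 0\<close>: this is clear if the \<open>q\<^sub>i\<close> are independent over \<open>\<rat>\<close>, and a rational relation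
  between them removes one term (\<open>tensor_relation_from_points\<close>).
\<close>

section \<open>Polynomial rings and evaluation\<close>

abbreviation mdeg :: "('v \<Rightarrow>\<^sub>0 nat) \<Rightarrow> nat" where
  "mdeg m \<equiv> \<Sum>i\<in>Poly_Mapping.keys m. Poly_Mapping.lookup m i"

abbreviation meval :: "('v \<Rightarrow> 'r::comm_ring_1) \<Rightarrow> ('v \<Rightarrow>\<^sub>0 nat) \<Rightarrow> 'r" where
  "meval h m \<equiv> \<Prod>i\<in>Poly_Mapping.keys m. h i ^ Poly_Mapping.lookup m i"

lemma keys_add_nat: "Poly_Mapping.keys (m + m' :: 'v \<Rightarrow>\<^sub>0 nat) = Poly_Mapping.keys m \<union> Poly_Mapping.keys m'"
  by (auto simp: in_keys_iff lookup_add)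

lemma mdeg_superset:
  "finite A \<Longrightarrow> Poly_Mapping.keys m \<subseteq> A \<Longrightarrow> mdeg m = (\<Sum>i\<in>A. Poly_Mapping.lookup m i)"
  by (rule sum.mono_neutral_left) (auto simp: in_keys_iff)

lemma meval_superset:
  "finite A \<Longrightarrow> Poly_Mapping.keys m \<subseteq> A \<Longrightarrow> meval h m = (\<Prod>i\<in>A. h i ^ Poly_Mapping.lookup m i)"
  by (rule prod.mono_neutral_left) (auto simp: in_keys_iff)

lemma mdeg_add: "mdeg (m + m') = mdeg m + mdeg m'"
  using mdeg_superset[of "Poly_Mapping.keys m \<union> Poly_Mapping.keys m'" m]
    mdeg_superset[of "Poly_Mapping.keys m \<union> Poly_Mapping.keys m'" m']
  by (simp add: keys_add_nat lookup_add sum.distrib)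

lemma meval_add: "meval h (m + m') = meval h m * meval h m'"
  using meval_superset[of "Poly_Mapping.keys m \<union> Poly_Mapping.keys m'" m h]
    meval_superset[of "Poly_Mapping.keys m \<union> Poly_Mapping.keys m'" m' h]
  by (simp add: keys_add_nat lookup_add power_add prod.distrib)

lemma qpoly_sum_monomials:
  "(p :: 'v qpoly) = (\<Sum>m\<in>Poly_Mapping.keys p. Poly_Mapping.single m (Poly_Mapping.lookup p m))"
proof (rule poly_mapping_eqI)
  fix k
  show "Poly_Mapping.lookup p k =
    Poly_Mapping.lookup (\<Sum>m\<in>Poly_Mapping.keys p. Poly_Mapping.single m (Poly_Mapping.lookup p m)) k"
    by (simp add: lookup_sum lookup_single when_def sum.delta in_keys_iff)
qed

lemma qpoly_induct [case_names zero single add]: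
  fixes p :: "'v qpoly"
  assumes "P 0" and "\<And>m c. P (Poly_Mapping.single m c)" and "\<And>p q. P p \<Longrightarrow> P q \<Longrightarrow> P (p + q)"
  shows "P p"
proof -
  have "P (\<Sum>m\<in>A. Poly_Mapping.single m (Poly_Mapping.lookup p m))" if "finite A" for A
    using that by induction (auto intro: assms)
  then show ?thesis by (subst qpoly_sum_monomials) simp
qed

lemma cst_simps:
  "cst 0 = 0" "cst 1 = 1" "cst (a + b) = cst a + cst b" "cst (a * b) = cst a * cst b"
  "cst (a - b) = cst a - cst b" "cst (- a) = - cst a"
  by (simp_all add: cst_def single_add single_diff single_uminus mult_single)

lemma cst_sum: "cst (sum f A) = (\<Sum>a\<in>A. cst (f a))"
  by (induction A rule: infinite_finite_induct) (auto simp: cst_simps)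

lemma cst_mult_single: "cst c * Poly_Mapping.single m d = Poly_Mapping.single m (c * d)"
  by (simp add: cst_def mult_single)

text \<open>Everything about substitution of polynomials (\<open>c = cst\<close>) and evaluation at a rational point
  (\<open>c = id\<close>) follows from \<open>c\<close> being a ring homomorphism.\<close>
locale coefficient_map =
  fixes c :: "rat \<Rightarrow> 'r::comm_ring_1"
  assumes c0: "c 0 = 0" and c1: "c 1 = 1" and c_add: "\<And>a b. c (a + b) = c a + c b"
    and c_mult: "\<And>a b. c (a * b) = c a * c b"
begin

lemma aeval_superset:
  assumes "finite A" "Poly_Mapping.keys p \<subseteq> A"
  shows "aeval c h p = (\<Sum>m\<in>A. c (Poly_Mapping.lookup p m) * meval h m)"
  unfolding aeval_def using assms
  by (intro sum.mono_neutral_left) (auto simp: in_keys_iff c0)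

lemma aeval_0 [simp]: "aeval c h 0 = 0"
  by (simp add: aeval_def)

lemma aeval_add: "aeval c h (p + q) = aeval c h p + aeval c h q"
proof -
  let ?A = "Poly_Mapping.keys p \<union> Poly_Mapping.keys q"
  have "Poly_Mapping.keys (p + q) \<subseteq> ?A" by (rule keys_add)
  then show ?thesis
    using aeval_superset[of ?A "p + q" h] aeval_superset[of ?A p h] aeval_superset[of ?A q h]
    by (simp add: lookup_add c_add distrib_right sum.distrib)
qed

lemma aeval_single: "aeval c h (Poly_Mapping.single m a) = c a * meval h m"
  using aeval_superset[of "{m}" "Poly_Mapping.single m a" h] by simp

lemma aeval_mult: "aeval c h (p * q) = aeval c h p * aeval c h q"
proof (induction p rule: qpoly_induct)
  case (single m a)
  show ?case
  proof (induction q rule: qpoly_induct)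
    case (single m' b)
    show ?case by (simp only: mult_single aeval_single c_mult meval_add mult_ac)
  qed (auto simp: aeval_add distrib_left)
qed (auto simp: aeval_add distrib_right)

lemma aeval_cst: "aeval c h (cst a) = c a"
  by (simp add: cst_def aeval_single)

lemma aeval_1 [simp]: "aeval c h 1 = 1"
  using aeval_cst[of h 1] by (simp add: cst_simps c1)

lemma aeval_var: "aeval c h (var i) = h i"
  by (simp add: var_def aeval_single c1)

lemma aeval_uminus: "aeval c h (- p) = - aeval c h p"
  using aeval_add[of h p "- p"] by (simp add: eq_neg_iff_add_eq_0 add.commute)

lemma aeval_diff: "aeval c h (p - q) = aeval c h p - aeval c h q"
  using aeval_add[of h p "- q"] by (simp add: aeval_uminus)

lemma aeval_sum: "aeval c h (sum f A) = (\<Sum>a\<in>A. aeval c h (f a))"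
  by (induction A rule: infinite_finite_induct) (auto simp: aeval_add)

lemma aeval_prod: "aeval c h (prod f A) = (\<Prod>a\<in>A. aeval c h (f a))"
  by (induction A rule: infinite_finite_induct) (auto simp: aeval_mult)

lemma aeval_power: "aeval c h (p ^ d) = aeval c h p ^ d"
  by (induction d) (auto simp: aeval_mult)

end

interpretation cst: coefficient_map cst
  by standard (auto simp: cst_simps)

interpretation idq: coefficient_map "id :: rat \<Rightarrow> rat"
  by standard auto

lemma aeval_compose: "aeval id \<xi> (aeval cst h p) = aeval id (\<lambda>i. aeval id \<xi> (h i)) p"
proof (induction p rule: qpoly_induct)
  case (single m a)
  show ?case
    unfolding cst.aeval_single idq.aeval_single idq.aeval_mult idq.aeval_cst idq.aeval_prod
        idq.aeval_power ..
qed (simp_all only: cst.aeval_add idq.aeval_add cst.aeval_0 idq.aeval_0)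

lemma polys_0: "0 \<in> polys V" and polys_1: "1 \<in> polys V" and polys_cst: "cst a \<in> polys V"
  by (auto simp: polys_def cst_def)

lemma polys_var: "i \<in> V \<Longrightarrow> var i \<in> polys V"
  by (auto simp: polys_def var_def)

lemma polys_add: "p \<in> polys V \<Longrightarrow> q \<in> polys V \<Longrightarrow> p + q \<in> polys V"
  unfolding polys_def using keys_add[of p q] by blast

lemma polys_uminus: "p \<in> polys V \<Longrightarrow> - p \<in> polys V"
  by (auto simp: polys_def in_keys_iff)

lemma polys_diff: "p \<in> polys V \<Longrightarrow> q \<in> polys V \<Longrightarrow> p - q \<in> polys V"
  using polys_add[of p V "- q"] by (simp add: polys_uminus)

lemma polys_mult:
  assumes "p \<in> polys V" "q \<in> polys V"
  shows "p * q \<in> polys V"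
proof -
  have "Poly_Mapping.keys m \<subseteq> V" if "m \<in> Poly_Mapping.keys (p * q)" for m
  proof -
    obtain a b where "m = a + b" "a \<in> Poly_Mapping.keys p" "b \<in> Poly_Mapping.keys q"
      using keys_mult[of p q] \<open>m \<in> Poly_Mapping.keys (p * q)\<close> by blast
    with assms show ?thesis by (auto simp: polys_def keys_add_nat)
  qed
  then show ?thesis by (auto simp: polys_def)
qed

lemma polys_sum: "(\<And>a. a \<in> A \<Longrightarrow> f a \<in> polys V) \<Longrightarrow> sum f A \<in> polys V"
  by (induction A rule: infinite_finite_induct) (auto simp: polys_0 polys_add)

lemma polys_prod: "(\<And>a. a \<in> A \<Longrightarrow> f a \<in> polys V) \<Longrightarrow> prod f A \<in> polys V"
  by (induction A rule: infinite_finite_induct) (auto simp: polys_1 polys_mult)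

lemma polys_power: "p \<in> polys V \<Longrightarrow> p ^ d \<in> polys V"
  by (induction d) (auto simp: polys_1 polys_mult)

lemma polys_single: "Poly_Mapping.keys m \<subseteq> V \<Longrightarrow> Poly_Mapping.single m a \<in> polys V"
  by (auto simp: polys_def)

lemmas polys_intros = polys_0 polys_1 polys_cst polys_var polys_add polys_uminus polys_diff
  polys_mult polys_sum polys_prod polys_power

lemma homogeneous_0: "homogeneous d 0"
  by (simp add: homogeneous_def)

lemma homogeneous_cst: "homogeneous 0 (cst a)"
  by (simp add: homogeneous_def cst_def)

lemma homogeneous_1: "homogeneous 0 1"
  using homogeneous_cst[of 1] by (simp add: cst_simps)

lemma homogeneous_var: "homogeneous 1 (var i)"
  by (simp add: homogeneous_def var_def)

lemma homogeneous_add: "homogeneous d p \<Longrightarrow> homogeneous d q \<Longrightarrow> homogeneous d (p + q)"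
  unfolding homogeneous_def using keys_add[of p q] by blast

lemma homogeneous_uminus: "homogeneous d p \<Longrightarrow> homogeneous d (- p)"
  by (auto simp: homogeneous_def in_keys_iff)

lemma homogeneous_mult:
  assumes "homogeneous d p" "homogeneous e q"
  shows "homogeneous (d + e) (p * q)"
  unfolding homogeneous_def
proof
  fix m assume "m \<in> Poly_Mapping.keys (p * q)"
  then obtain a b where "m = a + b" "a \<in> Poly_Mapping.keys p" "b \<in> Poly_Mapping.keys q"
    using keys_mult[of p q] by blast
  with assms show "mdeg m = d + e" by (simp only: mdeg_add) (auto simp: homogeneous_def)
qed

lemma homogeneous_cst_mult: "homogeneous d p \<Longrightarrow> homogeneous d (cst a * p)"
  using homogeneous_mult[OF homogeneous_cst] by fastforce

lemma homogeneous_sum: "(\<And>a. a \<in> A \<Longrightarrow> homogeneous d (f a)) \<Longrightarrow> homogeneous d (sum f A)"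
  by (induction A rule: infinite_finite_induct) (auto simp: homogeneous_0 homogeneous_add)

lemma homogeneous_prod:
  "(\<And>a. a \<in> A \<Longrightarrow> homogeneous (d a) (f a)) \<Longrightarrow> homogeneous (sum d A) (prod f A)"
  by (induction A rule: infinite_finite_induct) (auto simp: homogeneous_1 homogeneous_mult)

lemma homogeneous_power: "homogeneous d p \<Longrightarrow> homogeneous (e * d) (p ^ e)"
  by (induction e) (auto simp: homogeneous_1 homogeneous_mult)

lemma aeval_polys:
  assumes "\<And>i. h i \<in> polys V"
  shows "aeval cst h p \<in> polys V"
  unfolding aeval_def using assms by (intro polys_intros)

lemma homogeneous_aeval:
  assumes "\<And>i. homogeneous 1 (h i)" and "homogeneous d p"
  shows "homogeneous d (aeval cst h p)"
  unfolding aeval_def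
proof (intro homogeneous_sum homogeneous_cst_mult)
  fix m assume m: "m \<in> Poly_Mapping.keys p"
  have "homogeneous (\<Sum>i\<in>Poly_Mapping.keys m. Poly_Mapping.lookup m i) (meval h m)"
    using homogeneous_power[OF assms(1)] by (intro homogeneous_prod) fastforce
  with m assms(2) show "homogeneous d (meval h m)" by (simp add: homogeneous_def)
qed

section \<open>Determinants and the Cauchy--Binet formula\<close>

text \<open>Matrices are indexed by natural numbers because their size \<open>n - k + 1\<close> depends on \<open>k\<close>.\<close>
definition det_fun :: "nat \<Rightarrow> (nat \<Rightarrow> nat \<Rightarrow> rat) \<Rightarrow> rat" where
  "det_fun m G = (\<Sum>\<sigma> | \<sigma> permutes {..<m}. of_int (sign \<sigma>) * (\<Prod>i<m. G i (\<sigma> i)))"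

lemma det_fun_cong:
  assumes "\<And>i j. i < m \<Longrightarrow> j < m \<Longrightarrow> G i j = H i j"
  shows "det_fun m G = det_fun m H"
proof -
  have "(\<Prod>i<m. G i (\<sigma> i)) = (\<Prod>i<m. H i (\<sigma> i))" if "\<sigma> permutes {..<m}" for \<sigma>
    using that permutes_in_image[OF that] by (intro prod.cong) (auto intro!: assms)
  then show ?thesis unfolding det_fun_def by (intro sum.cong) auto
qed

lemma det_fun_permute_columns:
  assumes "\<pi> permutes {..<m}"
  shows "det_fun m (\<lambda>i j. G i (\<pi> j)) = of_int (sign \<pi>) * det_fun m G"
proof -
  have sgn: "sign \<sigma> = sign \<pi> * sign (\<pi> \<circ> \<sigma>)" if "\<sigma> permutes {..<m}" for \<sigma>
  proof -
    have "sign (\<pi> \<circ> \<sigma>) = sign \<pi> * sign \<sigma>"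
      using assms that by (intro sign_compose permutes_imp_permutation[of "{..<m}"]) auto
    then show ?thesis by (simp add: sign_def)
  qed
  have "det_fun m (\<lambda>i j. G i (\<pi> j)) = (\<Sum>\<sigma> | \<sigma> permutes {..<m}.
      of_int (sign \<pi>) * (of_int (sign (\<pi> \<circ> \<sigma>)) * (\<Prod>i<m. G i ((\<pi> \<circ> \<sigma>) i))))"
    unfolding det_fun_def
    by (intro sum.cong refl) (simp add: mult.assoc[symmetric] sgn[symmetric] flip: of_int_mult)
  also have "\<dots> = of_int (sign \<pi>) * det_fun m G"
    unfolding det_fun_def sum_distrib_left[symmetric]
    using setum_permutations_compose_left[OF assms,
        of "\<lambda>\<sigma>. of_int (sign \<sigma>) * (\<Prod>i<m. G i (\<sigma> i))"] by simp
  finally show ?thesis .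
qed

lemma det_fun_repeated_column:
  assumes "a < m" "b < m" "a \<noteq> b" and eq: "\<And>i. i < m \<Longrightarrow> G i a = G i b"
  shows "det_fun m G = 0"
proof -
  let ?t = "Transposition.transpose a b"
  have t: "?t permutes {..<m}" using assms by (intro permutes_swap_id) auto
  have "det_fun m (\<lambda>i j. G i (?t j)) = det_fun m G"
    by (intro det_fun_cong) (auto simp: Transposition.transpose_def eq)
  moreover have "sign ?t = -1" using assms by (simp add: sign_swap_id)
  ultimately show ?thesis using det_fun_permute_columns[OF t, of G] by simp
qed

lemma det_fun_transpose: "det_fun m (\<lambda>i j. G j i) = det_fun m G"
proof -
  have "(\<Prod>i<m. G (inv_into UNIV \<sigma> i) i) = (\<Prod>i<m. G i (\<sigma> i))" if "\<sigma> permutes {..<m}" for \<sigma>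
    using prod.permute[OF that, of "\<lambda>i. G (inv_into UNIV \<sigma> i) i"] permutes_inverses[OF that]
    by (simp add: o_def)
  moreover have "sign (inv_into UNIV \<sigma>) = sign \<sigma>" if "\<sigma> permutes {..<m}" for \<sigma>
    using that by (intro sign_inverse permutes_imp_permutation[of "{..<m}"]) auto
  ultimately show ?thesis
    unfolding det_fun_def by (subst sum_permutations_inverse) (auto intro!: sum.cong)
qed

lemma det_fun_row_linear:
  assumes "t < m"
  shows "det_fun m (\<lambda>i j. if i = t then \<Sum>s\<in>S. c s * F s j else G i j) =
    (\<Sum>s\<in>S. c s * det_fun m (\<lambda>i j. if i = t then F s j else G i j))"
proof -
  have *: "(\<Prod>i<m. if i = t then f i else G i (\<sigma> i)) = f t * (\<Prod>i\<in>{..<m} - {t}. G i (\<sigma> i))"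
    for f \<sigma>
    using assms by (subst prod.remove[of _ t]) (auto intro!: arg_cong2[where f = "(*)"] prod.cong)
  have "det_fun m (\<lambda>i j. if i = t then \<Sum>s\<in>S. c s * F s j else G i j) =
    (\<Sum>\<sigma> | \<sigma> permutes {..<m}. \<Sum>s\<in>S. c s * (of_int (sign \<sigma>) *
      (F s (\<sigma> t) * (\<Prod>i\<in>{..<m} - {t}. G i (\<sigma> i)))))"
    unfolding det_fun_def *
    by (simp add: sum_distrib_left sum_distrib_right mult_ac)
  also have "\<dots> = (\<Sum>s\<in>S. \<Sum>\<sigma> | \<sigma> permutes {..<m}. c s * (of_int (sign \<sigma>) *
      (F s (\<sigma> t) * (\<Prod>i\<in>{..<m} - {t}. G i (\<sigma> i)))))"
    by (rule sum.swap)
  also have "\<dots> = (\<Sum>s\<in>S. c s * det_fun m (\<lambda>i j. if i = t then F s j else G i j))"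
    unfolding det_fun_def * by (simp add: sum_distrib_left)
  finally show ?thesis .
qed

text \<open>Replacing row \<open>t\<close> by the vanishing combination of all rows multiplies the determinant by
  \<open>c t\<close>, since the other rows contribute determinants with a repeated row.\<close>
lemma det_fun_dependent_rows:
  assumes "t < m" "c t \<noteq> 0" and dep: "\<And>j. j < m \<Longrightarrow> (\<Sum>s<m. c s * G s j) = 0"
  shows "det_fun m G = 0"
proof -
  let ?R = "\<lambda>s. det_fun m (\<lambda>i j. if i = t then G s j else G i j)"
  have zero: "?R s = 0" if "s < m" "s \<noteq> t" for s
    by (subst det_fun_transpose[symmetric], rule det_fun_repeated_column[of s m t])
      (use that assms in auto)
  have "0 = det_fun m (\<lambda>i j. if i = t then \<Sum>s\<in>{}. c s * G s j else G i j)"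
    using det_fun_row_linear[OF assms(1), where S = "{}" and c = c and F = G and G = G] by simp
  also have "\<dots> = det_fun m (\<lambda>i j. if i = t then \<Sum>s<m. c s * G s j else G i j)"
    by (intro det_fun_cong) (simp add: dep)
  also have "\<dots> = (\<Sum>s<m. c s * ?R s)" by (rule det_fun_row_linear[OF assms(1)])
  also have "\<dots> = (\<Sum>s\<in>{t}. c s * ?R s)"
    using assms(1) zero by (intro sum.mono_neutral_right) auto
  also have "\<dots> = c t * ?R t" by simp
  finally have "?R t = 0" using assms(2) by simp
  have "det_fun m G = ?R t" by (intro det_fun_cong) simp
  also note \<open>?R t = 0\<close>
  finally show ?thesis .
qed

lemma det_fun_dependent_columns:
  assumes "t < m" "c t \<noteq> 0" "\<And>i. i < m \<Longrightarrow> (\<Sum>s<m. c s * G i s) = 0"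
  shows "det_fun m G = 0"
  using det_fun_transpose[of m G] by (rule trans[OF sym]) (rule det_fun_dependent_rows[OF assms])

lemma det_fun_upper_triangular:
  assumes "\<And>i j. j < i \<Longrightarrow> i < m \<Longrightarrow> G i j = 0"
  shows "det_fun m G = (\<Prod>i<m. G i i)"
proof -
  have "(\<Prod>i<m. G i (\<sigma> i)) = 0" if \<sigma>: "\<sigma> permutes {..<m}" "\<sigma> \<noteq> id" for \<sigma>
  proof -
    obtain i where "i \<in> {..<m}" "\<sigma> i < i"
      using permutes_natset_ge[OF \<sigma>(1)] \<sigma>(2) by (meson not_le)
    then show ?thesis using assms by (intro prod_zero) auto
  qed
  then have "det_fun m G = (\<Sum>\<sigma>\<in>{id}. of_int (sign \<sigma>) * (\<Prod>i<m. G i (\<sigma> i)))"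
    unfolding det_fun_def by (intro sum.mono_neutral_right) (auto simp: permutes_id finite_permutations)
  then show ?thesis by simp
qed

lemma wedge_eq_det_fun:
  "card K = length ws \<Longrightarrow>
    wedge ws K = det_fun (length ws) (\<lambda>i j. (ws ! i) $ (sorted_list_of_set K ! j))"
  by (simp add: wedge_def det_fun_def)

text \<open>Both sides are the sum of
  \<open>(\<Prod>i. us\<^sub>i $ f i) * det (ws\<^sub>i $ f j)\<close> over all maps \<open>f\<close> from positions to coordinates: expanding
  the pairings gives all maps, of which only the injective ones contribute, and an injective map is
  its image \<open>K\<close> together with a permutation.\<close>
lemma cauchy_binet:
  fixes us ws :: "(rat ^ 'n::{finite,linorder}) list"
  assumes us: "length us = m" and ws: "length ws = m"
  shows "(\<Sum>K | card K = m. wedge us K * wedge ws K) =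
    det_fun m (\<lambda>i j. pairing (us ! i) (ws ! j))"
proof -
  define T where "T f = (\<Prod>i<m. us ! i $ f i) * det_fun m (\<lambda>i j. ws ! i $ f j)" for f :: "nat \<Rightarrow> 'n"
  define F where "F = PiE {..<m} (\<lambda>_. UNIV :: 'n set)"
  have finF: "finite F" unfolding F_def by (intro finite_PiE) auto
  have T_cong: "T f = T g" if "\<And>i. i < m \<Longrightarrow> f i = g i" for f g
    unfolding T_def using that by (intro arg_cong2[where f = "(*)"] prod.cong det_fun_cong) auto
  have T_noninj: "T f = 0" if "\<not> inj_on f {..<m}" for f
  proof -
    obtain a b where "a < m" "b < m" "a \<noteq> b" "f a = f b" using \<open>\<not> inj_on f {..<m}\<close> by (auto simp: inj_on_def)
    then have "det_fun m (\<lambda>i j. ws ! i $ f j) = 0" by (intro det_fun_repeated_column[of a m b]) auto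
    then show ?thesis by (simp add: T_def)
  qed
  have "det_fun m (\<lambda>i j. pairing (us ! i) (ws ! j)) = (\<Sum>\<sigma> | \<sigma> permutes {..<m}.
      of_int (sign \<sigma>) * (\<Sum>f\<in>F. \<Prod>i<m. us ! i $ f i * ws ! \<sigma> i $ f i))"
    unfolding det_fun_def pairing_def F_def by (subst prod_sum_PiE) auto
  also have "\<dots> = (\<Sum>f\<in>F. \<Sum>\<sigma> | \<sigma> permutes {..<m}.
      of_int (sign \<sigma>) * (\<Prod>i<m. us ! i $ f i * ws ! \<sigma> i $ f i))"
    unfolding sum_distrib_left by (rule sum.swap)
  also have "\<dots> = (\<Sum>f\<in>F. (\<Prod>i<m. us ! i $ f i) * det_fun m (\<lambda>i j. ws ! j $ f i))"
    unfolding det_fun_def by (simp add: prod.distrib sum_distrib_left mult_ac)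
  also have "\<dots> = (\<Sum>f\<in>F. T f)"
    unfolding T_def by (subst det_fun_transpose) simp
  also have "\<dots> = (\<Sum>f | f \<in> F \<and> inj_on f {..<m}. T f)"
    using finF T_noninj by (intro sum.mono_neutral_right) auto
  also have "\<dots> = (\<Sum>K | card K = m. \<Sum>f | f \<in> {f. f \<in> F \<and> inj_on f {..<m}} \<and> f ` {..<m} = K. T f)"
    using finF by (intro sum.group[symmetric]) (auto simp: card_image)
  also have "\<dots> = (\<Sum>K | card K = m. wedge us K * wedge ws K)"
  proof (intro sum.cong refl)
    fix K :: "'n set" assume "K \<in> {K. card K = m}"
    then have K: "card K = m" by simp
    define e where "e = (!) (sorted_list_of_set K)"
    have e: "bij_betw e {..<m} K"
      unfolding e_def using K by (intro bij_betw_nth) auto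
    have emem: "i < m \<Longrightarrow> e i \<in> K" for i using e by (auto simp: bij_betw_def)
    have inve: "bij_betw (inv_into {..<m} e) K {..<m}" using e by (rule bij_betw_inv_into)
    have "wedge us K * wedge ws K = (\<Sum>\<pi> | \<pi> permutes {..<m}. T (\<lambda>i. e (\<pi> i)))"
    proof -
      have "wedge us K * wedge ws K = (\<Sum>\<pi> | \<pi> permutes {..<m}.
        (\<Prod>i<m. us ! i $ e (\<pi> i)) * (of_int (sign \<pi>) * det_fun m (\<lambda>i j. ws ! i $ e j)))"
        using wedge_eq_det_fun[of K ws] K us ws
        by (simp add: wedge_def[of us] e_def sum_distrib_right sum_distrib_left mult_ac)
      also have "\<dots> = (\<Sum>\<pi> | \<pi> permutes {..<m}. T (\<lambda>i. e (\<pi> i)))"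
        unfolding T_def using det_fun_permute_columns[of _ m "\<lambda>i j. ws ! i $ e j"]
        by (intro sum.cong) auto
      finally show ?thesis .
    qed
    also have "\<dots> = (\<Sum>f | f \<in> {f. f \<in> F \<and> inj_on f {..<m}} \<and> f ` {..<m} = K. T f)"
    proof (rule sum.reindex_bij_witness[of _
        "\<lambda>f i. if i < m then inv_into {..<m} e (f i) else i" "\<lambda>\<pi>. restrict (e \<circ> \<pi>) {..<m}"])
      fix \<pi> assume "\<pi> \<in> {\<pi>. \<pi> permutes {..<m}}"
      then have \<pi>: "\<pi> permutes {..<m}" by simp
      have pim: "i < m \<Longrightarrow> \<pi> i < m" for i using permutes_in_image[OF \<pi>] by auto
      show "(\<lambda>i. if i < m then inv_into {..<m} e (restrict (e \<circ> \<pi>) {..<m} i) else i) = \<pi>"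
      proof
        fix i
        show "(if i < m then inv_into {..<m} e (restrict (e \<circ> \<pi>) {..<m} i) else i) = \<pi> i"
          using e pim[of i] permutes_not_in[OF \<pi>, of i] by (cases "i < m") (auto simp: bij_betw_def)
      qed
      have "bij_betw (e \<circ> \<pi>) {..<m} K"
        using permutes_imp_bij[OF \<pi>] e by (rule bij_betw_trans)
      then show "restrict (e \<circ> \<pi>) {..<m} \<in>
          {f. f \<in> {f. f \<in> F \<and> inj_on f {..<m}} \<and> f ` {..<m} = K}"
        by (auto simp: F_def bij_betw_def inj_on_restrict_eq)
      show "T (restrict (e \<circ> \<pi>) {..<m}) = T (\<lambda>i. e (\<pi> i))" by (rule T_cong) simp
    next
      fix f assume "f \<in> {f. f \<in> {f. f \<in> F \<and> inj_on f {..<m}} \<and> f ` {..<m} = K}"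
      then have fF: "f \<in> F" and f: "bij_betw f {..<m} K" by (auto simp: bij_betw_def)
      have fm: "i < m \<Longrightarrow> f i \<in> K" for i using f by (auto simp: bij_betw_def)
      show "restrict (e \<circ> (\<lambda>i. if i < m then inv_into {..<m} e (f i) else i)) {..<m} = f"
      proof
        fix i
        show "restrict (e \<circ> (\<lambda>i. if i < m then inv_into {..<m} e (f i) else i)) {..<m} i = f i"
          using e fm[of i] fF by (cases "i < m") (auto simp: F_def bij_betw_def f_inv_into_f PiE_def extensional_def)
      qed
      have "bij_betw (inv_into {..<m} e \<circ> f) {..<m} {..<m}" using f inve by (rule bij_betw_trans)
      then have "bij_betw (\<lambda>i. if i < m then inv_into {..<m} e (f i) else i) {..<m} {..<m}"
        by (subst bij_betw_cong[where g = "inv_into {..<m} e \<circ> f"]) auto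
      then show "(\<lambda>i. if i < m then inv_into {..<m} e (f i) else i) \<in> {\<pi>. \<pi> permutes {..<m}}"
        by (intro CollectI bij_imp_permutes) auto
    qed
    finally show "(\<Sum>f | f \<in> {f. f \<in> F \<and> inj_on f {..<m}} \<and> f ` {..<m} = K. T f) =
      wedge us K * wedge ws K" by simp
  qed
  finally show ?thesis by simp
qed

section \<open>Lattices and dual bases\<close>

lemma pairing_simps:
  "pairing (u + u') v = pairing u v + pairing u' v"
  "pairing (u - u') v = pairing u v - pairing u' v"
  "pairing (c *s u) v = c * pairing u v"
  "pairing 0 v = 0" "pairing u 0 = 0"
  "pairing u (v + v') = pairing u v + pairing u v'"
  "pairing u (v - v') = pairing u v - pairing u v'"
  "pairing u (c *s v) = c * pairing u v"
  by (simp_all add: pairing_def algebra_simps sum.distrib sum_distrib_left sum_subtractf)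

lemma pairing_commute: "pairing u v = pairing v u"
  by (simp add: pairing_def mult.commute)

lemma pairing_sum_left: "pairing (sum f A) v = (\<Sum>a\<in>A. pairing (f a) v)"
  by (induction A rule: infinite_finite_induct) (auto simp: pairing_simps)

lemma pairing_sum_right: "pairing u (sum f A) = (\<Sum>a\<in>A. pairing u (f a))"
  by (induction A rule: infinite_finite_induct) (auto simp: pairing_simps)

lemma pairing_rat_vec: "pairing (rat_vec u) (rat_vec v) = of_int (pairing u v)"
  by (simp add: pairing_def rat_vec_def)

lemma rat_vec_simps:
  "rat_vec 0 = 0" "rat_vec (u + v) = rat_vec u + rat_vec v" "rat_vec (u - v) = rat_vec u - rat_vec v"
  "rat_vec (c *s u) = of_int c *s rat_vec u"
  by (simp_all add: rat_vec_def vec_eq_iff)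

lemma rat_vec_sum: "rat_vec (sum f A) = (\<Sum>a\<in>A. rat_vec (f a))"
  by (induction A rule: infinite_finite_induct) (auto simp: rat_vec_simps)

lemma rat_vec_eq_iff: "rat_vec u = rat_vec v \<longleftrightarrow> u = v"
  by (simp add: rat_vec_def vec_eq_iff)

lemma subgroup_multiple:
  fixes L :: "(int ^ 'n) set"
  assumes "0 \<in> L" and sub: "\<And>v w. v \<in> L \<Longrightarrow> w \<in> L \<Longrightarrow> v - w \<in> L" and v: "v \<in> L"
  shows "c *s v \<in> L"
proof -
  have neg: "- w \<in> L" if "w \<in> L" for w using sub[OF assms(1) that] by simp
  have add: "w + v \<in> L" if "w \<in> L" for w using sub[OF that neg[OF v]] by simp
  have nat: "of_nat k *s v \<in> L" for k :: nat
    by (induction k) (auto simp: assms(1) vector_sadd_rdistrib add add.commute[of v])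
  show ?thesis
  proof (cases "c \<ge> 0")
    case True
    then show ?thesis using nat[of "nat c"] by simp
  next
    case False
    then have "- (of_nat (nat (- c)) *s v) = c *s v" by (simp add: vec_eq_iff)
    then show ?thesis using neg[OF nat[of "nat (- c)"]] by simp
  qed
qed

text \<open>Induction on the coordinates that may be nonzero: the values of one coordinate on \<open>L\<close> form
  an ideal \<open>d\<int>\<close>; a vector with value \<open>d\<close> together with a basis of the sublattice on which
  the coordinate vanishes is a basis of \<open>L\<close>.\<close>
lemma sublattice_has_basis_supported:
  fixes L :: "(int ^ 'n) set"
  assumes "finite A" "0 \<in> L" "\<And>v w. v \<in> L \<Longrightarrow> w \<in> L \<Longrightarrow> v - w \<in> L"
    and "\<And>v a. v \<in> L \<Longrightarrow> a \<notin> A \<Longrightarrow> v $ a = 0"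
  shows "\<exists>us. lattice_basis us L"
  using assms
proof (induction A arbitrary: L rule: finite_induct)
  case empty
  then have "L = {0}" by (auto simp: vec_eq_iff)
  then have "lattice_basis [] L" by (auto simp: lattice_basis_def)
  then show ?case ..
next
  case (insert a A)
  let ?L' = "{v \<in> L. v $ a = 0}"
  have "\<exists>us. lattice_basis us ?L'"
  proof (rule insert.IH)
    show "0 \<in> ?L'" using insert.prems(1) by simp
    show "v - w \<in> ?L'" if "v \<in> ?L'" "w \<in> ?L'" for v w
      using insert.prems(2)[of v w] that by simp
    show "v $ b = 0" if "v \<in> ?L'" "b \<notin> A" for v b
      using insert.prems(3)[of v b] that by (cases "b = a") auto
  qed
  then obtain us where us: "lattice_basis us ?L'" ..
  show ?case
  proof (cases "\<forall>v\<in>L. v $ a = 0")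
    case True
    then have "?L' = L" by auto
    with us show ?thesis by auto
  next
    case False
    then obtain v0 where v0: "v0 \<in> L \<and> v0 $ a \<noteq> 0" by auto
    let ?P = "\<lambda>v. v \<in> L \<and> v $ a \<noteq> 0" and ?f = "\<lambda>v. nat \<bar>v $ a\<bar>"
    define v where "v = arg_min ?f ?P"
    have "?P v" "\<And>w. ?P w \<Longrightarrow> ?f v \<le> ?f w"
      unfolding v_def using arg_min_nat_lemma[of ?P v0 ?f] v0 by blast+
    then have v: "v \<in> L" "v $ a \<noteq> 0" and min: "\<And>w. w \<in> L \<Longrightarrow> w $ a \<noteq> 0 \<Longrightarrow> ?f v \<le> ?f w"
      by auto
    have mult: "c *s w \<in> L" if "w \<in> L" for c w
      using subgroup_multiple[of L w c] insert.prems that by blast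
    have rem: "w - (w $ a div v $ a) *s v \<in> ?L'" if "w \<in> L" for w
    proof -
      let ?w = "w - (w $ a div v $ a) *s v"
      have wL: "?w \<in> L" using insert.prems that mult[OF v(1)] by blast
      have wa: "?w $ a = w $ a mod v $ a" by (simp add: minus_div_mult_eq_mod)
      have "\<bar>w $ a mod v $ a\<bar> < \<bar>v $ a\<bar>" using v(2) by (rule abs_mod_less)
      then have "?w $ a = 0" using min[OF wL] wa by (cases "?w $ a = 0") auto
      with wL show ?thesis by simp
    qed
    have sum_Suc: "(\<Sum>i<length (v # us). c i *s (v # us) ! i) =
        c 0 *s v + (\<Sum>i<length us. c (Suc i) *s us ! i)" for c
      by (simp add: sum.lessThan_Suc_shift del: sum.lessThan_Suc)
    have us_span: "?L' = {\<Sum>i<length us. c i *s us ! i | c. True}"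
      using us unfolding lattice_basis_def by (rule conjunct1)
    have us_ind: "\<forall>i<length us. c i = 0" if "(\<Sum>i<length us. c i *s us ! i) = 0" for c
      using us that unfolding lattice_basis_def by blast
    have "lattice_basis (v # us) L"
      unfolding lattice_basis_def
    proof (intro conjI allI impI subset_antisym subsetI)
      fix w assume "w \<in> L"
      then have "w - (w $ a div v $ a) *s v \<in> {\<Sum>i<length us. c i *s us ! i | c. True}"
        using rem unfolding us_span by blast
      then obtain c where c: "w - (w $ a div v $ a) *s v = (\<Sum>i<length us. c i *s us ! i)" by blast
      have "w = (\<Sum>i<length (v # us). (case_nat (w $ a div v $ a) c) i *s (v # us) ! i)"
        unfolding sum_Suc by (simp add: c[symmetric])
      then show "w \<in> {\<Sum>i<length (v # us). c i *s (v # us) ! i | c. True}" by blast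
    next
      fix w assume "w \<in> {\<Sum>i<length (v # us). c i *s (v # us) ! i | c. True}"
      then obtain c where "w = c 0 *s v + (\<Sum>i<length us. c (Suc i) *s us ! i)"
        unfolding sum_Suc by blast
      moreover have "(\<Sum>i<length us. c (Suc i) *s us ! i) \<in> ?L'" unfolding us_span
        by (intro CollectI exI[of _ "\<lambda>i. c (Suc i)"]) simp
      ultimately have "w = c 0 *s v - (0 - (\<Sum>i<length us. c (Suc i) *s us ! i))"
        and *: "(\<Sum>i<length us. c (Suc i) *s us ! i) \<in> L" by auto
      then show "w \<in> L" using insert.prems(2)[OF mult[OF v(1)] insert.prems(2)[OF insert.prems(1) *]] by simp
    next
      fix c i assume *: "(\<Sum>i<length (v # us). c i *s (v # us) ! i) = 0" and i: "i < length (v # us)"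
      from * have eq: "c 0 *s v + (\<Sum>i<length us. c (Suc i) *s us ! i) = 0" unfolding sum_Suc .
      have "(\<Sum>i<length us. c (Suc i) *s us ! i) \<in> ?L'" unfolding us_span
        by (intro CollectI exI[of _ "\<lambda>i. c (Suc i)"]) simp
      then have "(\<Sum>i<length us. c (Suc i) *s us ! i) $ a = 0" by simp
      then have "c 0 * v $ a = 0" using arg_cong[OF eq, of "\<lambda>w. w $ a"] by simp
      then have c0: "c 0 = 0" using v(2) by simp
      then have "\<forall>i<length us. c (Suc i) = 0" using us_ind[of "\<lambda>i. c (Suc i)"] eq by simp
      with c0 i show "c i = 0" by (cases i) auto
    qed
    then show ?thesis ..
  qed
qed

lemma sublattice_has_basis:
  fixes L :: "(int ^ 'n) set"
  assumes "0 \<in> L" "\<And>v w. v \<in> L \<Longrightarrow> w \<in> L \<Longrightarrow> v - w \<in> L"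
  shows "\<exists>us. lattice_basis us L"
  using sublattice_has_basis_supported[of UNIV L] assms by simp

lemma common_denominator:
  fixes q :: "'s \<Rightarrow> rat"
  assumes "finite S"
  obtains d :: int and z :: "'s \<Rightarrow> int" where "d > 0" "\<And>s. s \<in> S \<Longrightarrow> of_int d * q s = of_int (z s)"
proof -
  have "\<exists>d::int. d > 0 \<and> (\<forall>s\<in>S. \<exists>z::int. of_int d * q s = of_int z)"
    using assms
  proof induction
    case empty
    show ?case by (intro exI[of _ 1]) auto
  next
    case (insert s S)
    then obtain d where d: "d > 0" "\<forall>s\<in>S. \<exists>z::int. of_int d * q s = of_int z" by auto
    obtain a b :: int where ab: "b > 0" "q s = of_int a / of_int b"
      using quotient_of_div[of "q s"] quotient_of_denom_pos[of "q s"] by (metis prod.exhaust)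
    show ?case
    proof (rule exI[of _ "b * d"], intro conjI ballI)
      fix t assume t: "t \<in> insert s S"
      show "\<exists>z::int. of_int (b * d) * q t = of_int z"
      proof (cases "t = s")
        case True
        then show ?thesis using ab by (intro exI[of _ "d * a"]) simp
      next
        case False
        then obtain z :: int where "of_int d * q t = of_int z" using t d by auto
        then show ?thesis by (intro exI[of _ "b * z"]) (simp add: mult.assoc)
      qed
    qed (use ab d in simp)
  qed
  then show ?thesis using that by metis
qed

text \<open>Independence of a family rather than of the set of its values, so that a vector occurring
  twice is a dependency.\<close>
definition indep_family :: "('i \<Rightarrow> rat ^ 'n) \<Rightarrow> 'i set \<Rightarrow> bool" where
  "indep_family v J \<longleftrightarrow> finite J \<and> (\<forall>c. (\<Sum>j\<in>J. c j *s v j) = 0 \<longrightarrow> (\<forall>j\<in>J. c j = 0))"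

lemma indep_familyD:
  "indep_family v J \<Longrightarrow> (\<Sum>j\<in>J. c j *s v j) = 0 \<Longrightarrow> j \<in> J \<Longrightarrow> c j = 0"
  by (auto simp: indep_family_def)

lemma indep_family_subset:
  assumes "indep_family v J" "K \<subseteq> J"
  shows "indep_family v K"
  unfolding indep_family_def
proof (intro conjI allI impI ballI)
  show "finite K" using assms finite_subset by (auto simp: indep_family_def)
  fix c j assume c: "(\<Sum>j\<in>K. c j *s v j) = 0" and j: "j \<in> K"
  have "(\<Sum>j\<in>J. (if j \<in> K then c j else 0) *s v j) = (\<Sum>j\<in>K. (if j \<in> K then c j else 0) *s v j)"
    using assms by (intro sum.mono_neutral_right) (auto simp: indep_family_def)
  also have "\<dots> = 0" using c by simp
  finally show "c j = 0" using indep_familyD[OF assms(1), of "\<lambda>j. if j \<in> K then c j else 0" j] j assms(2)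
    by auto
qed

lemma indep_family_inj_on:
  assumes "indep_family v J"
  shows "inj_on v J"
proof
  fix i j assume ij: "i \<in> J" "j \<in> J" "v i = v j"
  show "i = j"
  proof (rule ccontr)
    assume "i \<noteq> j"
    have fin: "finite J" using assms by (simp add: indep_family_def)
    have "(\<Sum>l\<in>J. (if l = i then 1 else if l = j then -1 else 0) *s v l) =
      (\<Sum>l\<in>{i, j}. (if l = i then 1 else if l = j then -1 else 0) *s v l)"
      using ij fin by (intro sum.mono_neutral_right) auto
    also have "\<dots> = 0" using \<open>i \<noteq> j\<close> ij(3) by simp
    finally show False using indep_familyD[OF assms, of "\<lambda>l. if l = i then 1 else if l = j then -1 else 0" i] ij
      by simp
  qed
qed

lemma indep_family_iff:
  "indep_family v J \<longleftrightarrow> finite J \<and> inj_on v J \<and> vec.independent (v ` J)"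
proof (cases "finite J \<and> inj_on v J")
  case True
  then have reindex: "(\<Sum>w\<in>v ` J. u w *s w) = (\<Sum>j\<in>J. u (v j) *s v j)" for u
    by (simp add: sum.reindex)
  have "(\<forall>c. (\<Sum>j\<in>J. c j *s v j) = 0 \<longrightarrow> (\<forall>j\<in>J. c j = 0)) \<longleftrightarrow>
      (\<forall>u. (\<Sum>w\<in>v ` J. u w *s w) = 0 \<longrightarrow> (\<forall>w\<in>v ` J. u w = 0))"
  proof (intro iffI allI impI)
    fix u assume "\<forall>c. (\<Sum>j\<in>J. c j *s v j) = 0 \<longrightarrow> (\<forall>j\<in>J. c j = 0)" "(\<Sum>w\<in>v ` J. u w *s w) = 0"
    then show "\<forall>w\<in>v ` J. u w = 0" unfolding reindex by (auto dest: spec[of _ "\<lambda>j. u (v j)"])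
  next
    fix c assume u: "\<forall>u. (\<Sum>w\<in>v ` J. u w *s w) = 0 \<longrightarrow> (\<forall>w\<in>v ` J. u w = 0)"
      and c: "(\<Sum>j\<in>J. c j *s v j) = 0"
    have "(\<Sum>j\<in>J. c (inv_into J v (v j)) *s v j) = (\<Sum>j\<in>J. c j *s v j)"
      using True by (intro sum.cong) auto
    with c u have "\<forall>w\<in>v ` J. c (inv_into J v w) = 0"
      using reindex[of "\<lambda>w. c (inv_into J v w)"] by (auto dest: spec[of _ "\<lambda>w. c (inv_into J v w)"])
    with True show "\<forall>j\<in>J. c j = 0" by simp
  qed
  then show ?thesis using True
    unfolding indep_family_def vec.dependent_finite[OF finite_imageI[OF conjunct1[OF True]]]
    by blast
next
  case False
  then show ?thesis using indep_family_inj_on by (auto simp: indep_family_def)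
qed

lemma exists_dual_functional:
  assumes "indep_family v J"
  shows "\<exists>u. \<forall>j\<in>J. pairing u (v j) = g j"
proof -
  have J: "inj_on v J" "vec.independent (v ` J)" using assms by (auto simp: indep_family_iff)
  \<comment> \<open>The functional is the coordinate \<open>undefined\<close>, an arbitrary one, of a linear map that sends each
    \<open>v\<^sub>j\<close> to a multiple of the corresponding unit vector.\<close>
  obtain f where f: "Vector_Spaces.linear (*s) (*s) f"
    "\<forall>x\<in>v ` J. f x = g (inv_into J v x) *s axis (undefined :: 'b) 1"
    using vec.linear_independent_extend[OF J(2), of "\<lambda>x. g (inv_into J v x) *s axis undefined 1"] by blast
  have "pairing (matrix f $ undefined) (v j) = g j" if "j \<in> J" for j
  proof -
    have "pairing (matrix f $ undefined) (v j) = (matrix f *v v j) $ undefined"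
      by (simp add: pairing_def matrix_vector_mult_def)
    also have "matrix f *v v j = f (v j)" using f(1) by (rule matrix_works)
    also have "f (v j) = g j *s axis undefined 1" using f(2) that J(1) by simp
    finally show ?thesis by (simp add: axis_def)
  qed
  then show ?thesis by blast
qed

lemma indep_family_spans:
  fixes v :: "'i \<Rightarrow> rat ^ 'n"
  assumes "indep_family v J" "card J = CARD('n)"
  shows "vec.span (v ` J) = UNIV"
proof -
  have J: "inj_on v J" "vec.independent (v ` J)" using assms by (auto simp: indep_family_iff)
  have "vec.dim (UNIV :: (rat ^ 'n) set) \<le> card (v ` J)"
    using card_image[OF J(1)] assms(2) by (simp only: vec_dim_card)
  then show ?thesis using vec.card_ge_dim_independent[OF _ J(2), of UNIV] by auto
qed

lemma pairing_separates:
  fixes v :: "'i \<Rightarrow> rat ^ 'n"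
  assumes "indep_family v J" "card J = CARD('n)" "\<And>j. j \<in> J \<Longrightarrow> pairing u (v j) = pairing u' (v j)"
  shows "u = u'"
proof -
  have "vec.subspace {w. pairing u w = pairing u' w}"
    by (auto simp: vec.subspace_def pairing_simps)
  then have "vec.span (v ` J) \<subseteq> {w. pairing u w = pairing u' w}"
    using assms(3) by (intro vec.span_minimal) auto
  then have "pairing u (axis a 1) = pairing u' (axis a 1)" for a
    using indep_family_spans[OF assms(1,2)] by auto
  then show ?thesis by (simp add: vec_eq_iff pairing_def axis_def if_distrib cong: if_cong)
qed

lemma indep_family_card_eq_dim:
  assumes "indep_family v J" "\<And>j. j \<in> J \<Longrightarrow> v j \<in> W"
    and "\<And>w. w \<in> W \<Longrightarrow> \<exists>c. w = (\<Sum>j\<in>J. c j *s v j)"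
  shows "card J = vec.dim W"
proof -
  have J: "inj_on v J" "vec.independent (v ` J)" using assms(1) by (auto simp: indep_family_iff)
  have "w \<in> vec.span (v ` J)" if w: "w \<in> W" for w
  proof -
    obtain c where "w = (\<Sum>j\<in>J. c j *s v j)" using assms(3)[OF w] ..
    then show ?thesis by (simp add: vec.span_sum vec.span_scale vec.span_base)
  qed
  then have "card (v ` J) = vec.dim W"
    using J(2) assms(2) by (intro vec.basis_card_eq_dim) auto
  then show ?thesis using card_image[OF J(1)] by simp
qed

abbreviation ray_vec_rat :: "(real ^ 'n) set \<Rightarrow> rat ^ 'n" where
  "ray_vec_rat \<rho> \<equiv> rat_vec (ray_vec \<rho>)"

text \<open>A functional vanishing on \<open>v\<^sub>j\<close>, \<open>j \<in> J\<close>, cuts out a saturated sublattice containing them, hence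
  vanishes on \<open>N\<^sub>J\<close>.\<close>
lemma M_of_iff: "u \<in> M_of J \<longleftrightarrow> (\<forall>j\<in>J. pairing u (ray_vec j) = 0)"
proof
  assume "u \<in> M_of J"
  moreover have "ray_vec j \<in> N_of J" if "j \<in> J" for j using that by (auto simp: N_of_def)
  ultimately show "\<forall>j\<in>J. pairing u (ray_vec j) = 0" by (auto simp: M_of_def)
next
  assume *: "\<forall>j\<in>J. pairing u (ray_vec j) = 0"
  have "primitive_sublattice {w. pairing u w = 0}"
    by (auto simp: primitive_sublattice_def pairing_simps)
  with * have "N_of J \<subseteq> {w. pairing u w = 0}" by (auto simp: N_of_def)
  then show "u \<in> M_of J" by (auto simp: M_of_def)
qed

lemma M_basis: "lattice_basis (M_basis J) (M_of J)"
  unfolding M_basis_def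
  by (rule someI_ex, rule sublattice_has_basis) (auto simp: M_of_iff pairing_simps)

abbreviation M_basis_rat :: "(real ^ 'n) set set \<Rightarrow> nat \<Rightarrow> rat ^ 'n" where
  "M_basis_rat J s \<equiv> rat_vec (M_basis J ! s)"

lemma M_basis_in_M_of:
  assumes "s < length (M_basis J)"
  shows "M_basis J ! s \<in> M_of J"
proof -
  have M: "M_of J = {\<Sum>i<length (M_basis J). c i *s M_basis J ! i | c. True}"
    using M_basis[of J] unfolding lattice_basis_def by (rule conjunct1)
  have "(\<Sum>i<length (M_basis J). (if i = s then 1 else 0) *s M_basis J ! i) =
      (\<Sum>i\<in>{s}. (if i = s then 1 else 0) *s M_basis J ! i)"
    using assms by (intro sum.mono_neutral_right) auto
  then have "M_basis J ! s = (\<Sum>i<length (M_basis J). (if i = s then 1 else 0) *s M_basis J ! i)" by simp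
  then show ?thesis unfolding M by (intro CollectI exI[of _ "\<lambda>i. if i = s then 1 else 0"]) simp
qed

lemma M_basis_rat_annihilates:
  "s < length (M_basis J) \<Longrightarrow> j \<in> J \<Longrightarrow> pairing (M_basis_rat J s) (ray_vec_rat j) = 0"
  using M_basis_in_M_of[of s J] by (simp add: pairing_rat_vec M_of_iff)

text \<open>A multiple of \<open>u\<close> is integral and so lies in \<open>M\<^sub>J\<close>.\<close>
lemma M_basis_rat_spans:
  assumes "\<And>j. j \<in> J \<Longrightarrow> pairing u (ray_vec_rat j) = 0"
  shows "\<exists>c. u = (\<Sum>s<length (M_basis J). c s *s M_basis_rat J s)"
proof -
  obtain d z where d: "d > 0" and z: "\<And>a. a \<in> UNIV \<Longrightarrow> of_int d * u $ a = of_int (z a)"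
    using common_denominator[of UNIV "\<lambda>a. u $ a"] by auto
  have uz: "of_int d *s u = rat_vec (\<chi> a. z a)" using z by (simp add: vec_eq_iff rat_vec_def)
  have "(\<chi> a. z a) \<in> M_of J"
    unfolding M_of_iff
  proof
    fix j assume "j \<in> J"
    then have "pairing (of_int d *s u) (ray_vec_rat j) = 0" using assms by (simp add: pairing_simps)
    then show "pairing (\<chi> a. z a) (ray_vec j) = 0" unfolding uz pairing_rat_vec by simp
  qed
  moreover have "M_of J = {\<Sum>i<length (M_basis J). c i *s M_basis J ! i | c. True}"
    using M_basis[of J] unfolding lattice_basis_def by (rule conjunct1)
  ultimately obtain c where c: "(\<chi> a. z a) = (\<Sum>i<length (M_basis J). c i *s M_basis J ! i)" by blast
  have "u = (1 / of_int d) *s (of_int d *s u)" using d by simp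
  also have "\<dots> = (1 / of_int d) *s (\<Sum>s<length (M_basis J). of_int (c s) *s M_basis_rat J s)"
    unfolding uz c by (simp add: rat_vec_sum rat_vec_simps)
  also have "\<dots> = (\<Sum>s<length (M_basis J). (of_int (c s) / of_int d) *s M_basis_rat J s)"
    by (simp add: vec.scale_sum_right)
  finally show ?thesis by (rule exI[of _ "\<lambda>s. of_int (c s) / of_int d"])
qed

lemma M_basis_rat_indep: "indep_family (M_basis_rat J) {..<length (M_basis J)}"
  unfolding indep_family_def
proof (intro conjI allI impI ballI)
  fix c t assume c: "(\<Sum>s<length (M_basis J). c s *s M_basis_rat J s) = 0"
    and t: "t \<in> {..<length (M_basis J)}"
  obtain d z where d: "d > 0" and z: "\<And>s. s \<in> {..<length (M_basis J)} \<Longrightarrow> of_int d * c s = of_int (z s)"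
    using common_denominator[of "{..<length (M_basis J)}" c] by auto
  have "rat_vec (\<Sum>s<length (M_basis J). z s *s M_basis J ! s) =
      of_int d *s (\<Sum>s<length (M_basis J). c s *s M_basis_rat J s)"
    using z by (simp add: rat_vec_sum rat_vec_simps vec.scale_sum_right)
  then have "(\<Sum>s<length (M_basis J). z s *s M_basis J ! s) = 0"
    unfolding c by (subst rat_vec_eq_iff[symmetric]) (simp add: rat_vec_simps)
  then have "z t = 0" using M_basis[of J] t unfolding lattice_basis_def by blast
  then show "c t = 0" using z[OF t] d by simp
qed simp

context
  fixes I :: "(real ^ 'n) set set"
  assumes indep: "indep_family ray_vec_rat I" and card: "card I = CARD('n)"
begin

lemma dual_vec_pairing:
  assumes "i \<in> I" "j \<in> I"
  shows "pairing (dual_vec I i) (ray_vec_rat j) = (if j = i then 1 else 0)"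
proof -
  have "\<exists>!u. \<forall>j\<in>I. pairing u (ray_vec_rat j) = (if j = i then 1 else 0)"
    using exists_dual_functional[OF indep, of "\<lambda>j. if j = i then 1 else 0"]
      pairing_separates[OF indep card] by metis
  from theI'[OF this] assms show ?thesis unfolding dual_vec_def by blast
qed

lemma dual_vec_expansion: "u = (\<Sum>i\<in>I. pairing u (ray_vec_rat i) *s dual_vec I i)"
proof (rule pairing_separates[OF indep card])
  fix j assume j: "j \<in> I"
  have fin: "finite I" using indep by (simp add: indep_family_def)
  have "pairing (\<Sum>i\<in>I. pairing u (ray_vec_rat i) *s dual_vec I i) (ray_vec_rat j) =
      (\<Sum>i\<in>I. if i = j then pairing u (ray_vec_rat j) else 0)"
    using j by (auto simp: pairing_sum_left pairing_simps dual_vec_pairing intro!: sum.cong)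
  then show "pairing u (ray_vec_rat j) =
      pairing (\<Sum>i\<in>I. pairing u (ray_vec_rat i) *s dual_vec I i) (ray_vec_rat j)"
    using j fin by simp
qed

lemma dual_vec_indep: "indep_family (dual_vec I) I"
  unfolding indep_family_def
proof (intro conjI allI impI ballI)
  show fin: "finite I" using indep by (simp add: indep_family_def)
  fix c j assume c: "(\<Sum>i\<in>I. c i *s dual_vec I i) = 0" and j: "j \<in> I"
  have "0 = pairing (\<Sum>i\<in>I. c i *s dual_vec I i) (ray_vec_rat j)" unfolding c by (simp add: pairing_simps)
  also have "\<dots> = (\<Sum>i\<in>I. if i = j then c j else 0)"
    using j by (auto simp: pairing_sum_left pairing_simps dual_vec_pairing intro!: sum.cong)
  finally show "c j = 0" using fin j by simp
qed

text \<open>The basis of \<open>M\<^sub>J\<close> and the dual vectors \<open>u\<^sub>i\<^sup>I\<close> with \<open>i \<notin> J\<close> are both bases of the annihilator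
  of \<open>J\<close> over \<open>\<rat>\<close>.\<close>
lemma length_M_basis:
  assumes "J \<subseteq> I"
  shows "length (M_basis J) = CARD('n) - card J"
proof -
  have fin: "finite I" using indep by (simp add: indep_family_def)
  let ?W = "{u. \<forall>j\<in>J. pairing u (ray_vec_rat j) = 0}"
  have "card {..<length (M_basis J)} = vec.dim ?W"
    by (rule indep_family_card_eq_dim[OF M_basis_rat_indep])
      (auto simp: M_basis_rat_annihilates intro: M_basis_rat_spans)
  moreover have "card (I - J) = vec.dim ?W"
  proof (rule indep_family_card_eq_dim[OF indep_family_subset[OF dual_vec_indep]])
    show "dual_vec I i \<in> ?W" if "i \<in> I - J" for i
      using that assms by (auto simp: dual_vec_pairing)
    fix u assume u: "u \<in> ?W"
    have "u = (\<Sum>i\<in>I. pairing u (ray_vec_rat i) *s dual_vec I i)" by (rule dual_vec_expansion)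
    also have "\<dots> = (\<Sum>i\<in>I - J. pairing u (ray_vec_rat i) *s dual_vec I i)"
      using u fin by (intro sum.mono_neutral_right) auto
    finally show "\<exists>c. u = (\<Sum>i\<in>I - J. c i *s dual_vec I i)"
      by (rule exI[of _ "\<lambda>i. pairing u (ray_vec_rat i)"])
  qed auto
  ultimately show ?thesis using assms fin card card_Diff_subset[of J I] finite_subset by auto
qed

end

section \<open>Simplicial cones and complete fans\<close>

lemma real_vec_simps:
  "real_vec 0 = 0" "real_vec (c *s v) = of_int c *\<^sub>R real_vec v"
  by (simp_all add: real_vec_def vec_eq_iff)

lemma real_vec_eq_iff: "real_vec u = real_vec v \<longleftrightarrow> u = v"
  by (simp add: real_vec_def vec_eq_iff)

text \<open>Among the vectors of which \<open>b\<close> is a positive multiple, one whose entry at a coordinate where \<open>b\<close>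
  is nonzero is smallest in absolute value is primitive.\<close>
lemma primitive_multiple:
  fixes b :: "int ^ 'n"
  assumes "b \<noteq> 0"
  obtains v c where "primitive_vector v" "c > 0" "b = c *s v"
proof -
  obtain a where a: "b $ a \<noteq> 0" using assms by (auto simp: vec_eq_iff)
  let ?P = "\<lambda>v. \<exists>c>0. b = c *s v" and ?f = "\<lambda>v :: int ^ 'n. nat \<bar>v $ a\<bar>"
  define v where "v = arg_min ?f ?P"
  have "?P b" by (intro exI[of _ 1]) simp
  then have P: "?P v" and min: "\<And>w. ?P w \<Longrightarrow> ?f v \<le> ?f w"
    unfolding v_def using arg_min_nat_lemma[of ?P b ?f] by blast+
  then obtain c where c: "c > 0" "b = c *s v" by blast
  have va: "v $ a \<noteq> 0" using a c by auto
  have "primitive_vector v"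
    unfolding primitive_vector_def
  proof (intro conjI allI impI)
    show "v \<noteq> 0" using va by auto
    fix d w assume v: "v = d *s w"
    then have d: "d \<noteq> 0" using va by auto
    have "b = (c * \<bar>d\<bar>) *s (sgn d *s w)"
      unfolding c(2) v by (simp add: vector_smult_assoc abs_mult_sgn mult.assoc)
    moreover have "c * \<bar>d\<bar> > 0" using c d by simp
    ultimately have "?f v \<le> ?f (sgn d *s w)" using min by blast
    then have "\<bar>d\<bar> * \<bar>w $ a\<bar> \<le> 1 * \<bar>w $ a\<bar>" using d by (simp add: v abs_mult abs_sgn_eq)
    moreover have "\<bar>w $ a\<bar> > 0" using va v by auto
    ultimately have "\<bar>d\<bar> \<le> 1" by (simp only: mult_le_cancel_right)
    with d show "\<bar>d\<bar> = 1" by auto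
  qed
  with c show ?thesis using that by blast
qed

text \<open>The ratio of two proportional integral vectors is a fraction \<open>q / p\<close> in lowest terms; then \<open>p\<close>
  divides one vector and \<open>q\<close> the other.\<close>
lemma primitive_vector_unique:
  assumes "primitive_vector v" "primitive_vector w" and t: "real_vec w = t *\<^sub>R real_vec v" "t \<ge> 0"
  shows "w = v"
proof -
  obtain a where a: "v $ a \<noteq> 0" using assms(1) by (auto simp: primitive_vector_def vec_eq_iff)
  have entry: "real_of_int (w $ b) = t * real_of_int (v $ b)" for b
    using arg_cong[OF t(1), of "\<lambda>x. x $ b"] by (simp add: real_vec_def)
  have cross: "v $ a * w $ b = w $ a * v $ b" for b
  proof -
    have "real_of_int (v $ a * w $ b) = real_of_int (w $ a * v $ b)" by (simp add: entry)
    then show ?thesis by (simp only: of_int_eq_iff)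
  qed
  obtain p q g where pq: "v $ a = p * g" "w $ a = q * g" "coprime p q" and g: "g \<noteq> 0"
  proof -
    have "gcd (v $ a) (w $ a) \<noteq> 0" using a by simp
    with gcd_coprime_exists[OF this] show ?thesis using that by metis
  qed
  have pq': "p * w $ b = q * v $ b" for b
  proof -
    have "g * (p * w $ b) = g * (q * v $ b)" using cross[of b] unfolding pq(1,2) by (simp add: mult_ac)
    then show ?thesis using g by simp
  qed
  have "p dvd v $ b" for b
    using coprime_dvd_mult_right_iff[OF pq(3), of "v $ b"] unfolding pq'[symmetric] by simp
  moreover have "q dvd w $ b" for b
    using coprime_dvd_mult_right_iff[of q p "w $ b"] pq(3) unfolding pq' by (simp add: coprime_commute)
  ultimately have "v = p *s (\<chi> b. v $ b div p)" "w = q *s (\<chi> b. w $ b div q)" by (auto simp: vec_eq_iff)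
  then have unit: "\<bar>p\<bar> = 1" "\<bar>q\<bar> = 1" using assms(1,2) by (auto simp: primitive_vector_def)
  have "real_of_int \<bar>p\<bar> * real_of_int \<bar>w $ a\<bar> = real_of_int \<bar>q\<bar> * real_of_int \<bar>v $ a\<bar>"
    using pq'[of a] by (simp flip: of_int_mult abs_mult)
  then have "t * \<bar>real_of_int (v $ a)\<bar> = \<bar>real_of_int (v $ a)\<bar>"
    using unit entry[of a] t(2) by (simp add: abs_mult)
  then have "t = 1" using a by simp
  with t(1) show ?thesis by (simp add: real_vec_eq_iff)
qed

lemma convex_cone_hull_finite:
  fixes G :: "'a::real_vector set"
  assumes "finite G"
  shows "convex_cone hull G = {\<Sum>g\<in>G. c g *\<^sub>R g | c. \<forall>g\<in>G. c g \<ge> 0}" (is "_ = ?S")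
proof
  show "convex_cone hull G \<subseteq> ?S"
  proof (rule hull_minimal)
    show "G \<subseteq> ?S"
    proof
      fix x assume x: "x \<in> G"
      have "(\<Sum>g\<in>G. (if g = x then 1 else 0) *\<^sub>R g) = (\<Sum>g\<in>{x}. (if g = x then 1 else 0) *\<^sub>R g)"
        using assms x by (intro sum.mono_neutral_right) auto
      then have "x = (\<Sum>g\<in>G. (if g = x then 1 else 0) *\<^sub>R g)" by simp
      then show "x \<in> ?S" by (intro CollectI exI[of _ "\<lambda>g. if g = x then 1 else 0"]) auto
    qed
    show "convex_cone ?S"
      unfolding convex_cone_iff
    proof (intro conjI ballI allI impI)
      show "0 \<in> ?S" by (intro CollectI exI[of _ "\<lambda>_. 0"]) auto
      fix x assume "x \<in> ?S"
      then obtain c where c: "x = (\<Sum>g\<in>G. c g *\<^sub>R g)" "\<forall>g\<in>G. c g \<ge> 0" by blast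
      show "r *\<^sub>R x \<in> ?S" if "r \<ge> 0" for r
        using c that by (intro CollectI exI[of _ "\<lambda>g. r * c g"]) (auto simp: scaleR_sum_right)
      fix y assume "y \<in> ?S"
      then obtain d where d: "y = (\<Sum>g\<in>G. d g *\<^sub>R g)" "\<forall>g\<in>G. d g \<ge> 0" by blast
      show "x + y \<in> ?S"
        using c d by (intro CollectI exI[of _ "\<lambda>g. c g + d g"]) (auto simp: scaleR_add_left sum.distrib)
    qed
  qed
  have "(\<Sum>g\<in>F. c g *\<^sub>R g) \<in> convex_cone hull G" if "F \<subseteq> G" "\<forall>g\<in>G. c g \<ge> 0" for c F
  proof -
    have "finite F" using that(1) assms finite_subset by blast
    then show ?thesis using that
    proof induction
      case empty
      show ?case by (simp add: convex_cone_hull_contains_0)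
    next
      case (insert x F)
      then have "c x *\<^sub>R x \<in> convex_cone hull G" by (intro convex_cone_hull_mul hull_inc) auto
      with insert show ?case by (auto intro: convex_cone_hull_add)
    qed
  qed
  then show "?S \<subseteq> convex_cone hull G" by auto
qed

lemma convex_cone_hull_single: "convex_cone hull {g :: 'a::real_vector} = {t *\<^sub>R g | t. t \<ge> 0}"
  by (subst convex_cone_hull_finite) auto

lemma convex_cone_hull_pos_scaleR:
  assumes "s > 0"
  shows "convex_cone hull {s *\<^sub>R g} = convex_cone hull {g :: 'a::real_vector}"
  unfolding convex_cone_hull_single
proof (intro subset_antisym subsetI)
  fix x assume "x \<in> {t *\<^sub>R s *\<^sub>R g | t. t \<ge> 0}"
  then obtain t where "t \<ge> 0" "x = t *\<^sub>R s *\<^sub>R g" by blast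
  then show "x \<in> {t *\<^sub>R g | t. t \<ge> 0}" using assms by (intro CollectI exI[of _ "t * s"]) simp
next
  fix x assume "x \<in> {t *\<^sub>R g | t. t \<ge> 0}"
  then obtain t where "t \<ge> 0" "x = t *\<^sub>R g" by blast
  then show "x \<in> {t *\<^sub>R s *\<^sub>R g | t. t \<ge> 0}"
    using assms by (intro CollectI exI[of _ "t / s"]) simp
qed

lemma independent_coeffs_unique:
  fixes G :: "(real ^ 'n) set"
  assumes "independent G" "(\<Sum>g\<in>G. c g *\<^sub>R g) = (\<Sum>g\<in>G. d g *\<^sub>R g)" "g \<in> G"
  shows "c g = d g"
proof -
  have fin: "finite G" using assms(1) by (rule independent_imp_finite)
  have "(\<Sum>g\<in>G. (c g - d g) *\<^sub>R g) = 0"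
    using assms(2) by (simp add: scaleR_diff_left sum_subtractf)
  then have "c g - d g = 0"
    using independentD[OF assms(1) fin subset_refl, of "\<lambda>g. c g - d g"] assms(3) by simp
  then show ?thesis by simp
qed

text \<open>A sum of nonnegative numbers with positive weights is zero only if all of them are; so a point of
  the smaller cone strictly between \<open>a\<close> and \<open>b\<close> forces the coefficients of \<open>a\<close> and \<open>b\<close> outside \<open>H\<close> to be
  zero.\<close>
lemma face_of_simplicial_cone:
  fixes G :: "(real ^ 'n) set"
  assumes ind: "independent G" and sub: "H \<subseteq> G"
  shows "convex_cone hull H face_of convex_cone hull G"
  unfolding face_of_def
proof (intro conjI ballI impI)
  have finG: "finite G" using ind by (rule independent_imp_finite)
  have finH: "finite H" using finG sub finite_subset by blast
  have H_iff: "x \<in> convex_cone hull H" if "x = (\<Sum>g\<in>G. c g *\<^sub>R g)" "\<forall>g\<in>G. c g \<ge> 0" "\<forall>g\<in>G - H. c g = 0" for x c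
  proof -
    have "(\<Sum>g\<in>G. c g *\<^sub>R g) = (\<Sum>g\<in>H. c g *\<^sub>R g)"
      using that(3) finG sub by (intro sum.mono_neutral_right) auto
    then show ?thesis using that sub unfolding convex_cone_hull_finite[OF finH] by blast
  qed
  show "convex_cone hull H \<subseteq> convex_cone hull G" using sub by (rule hull_mono)
  show "convex (convex_cone hull H)" by (rule convex_convex_cone_hull)
  fix a b x assume a: "a \<in> convex_cone hull G" and b: "b \<in> convex_cone hull G"
    and x: "x \<in> convex_cone hull H" and seg: "x \<in> open_segment a b"
  obtain ca where ca: "a = (\<Sum>g\<in>G. ca g *\<^sub>R g)" "\<forall>g\<in>G. ca g \<ge> 0"
    using a unfolding convex_cone_hull_finite[OF finG] by blast
  obtain cb where cb: "b = (\<Sum>g\<in>G. cb g *\<^sub>R g)" "\<forall>g\<in>G. cb g \<ge> 0"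
    using b unfolding convex_cone_hull_finite[OF finG] by blast
  obtain cx where cx: "x = (\<Sum>g\<in>H. cx g *\<^sub>R g)"
    using x unfolding convex_cone_hull_finite[OF finH] by blast
  obtain u where u: "0 < u" "u < 1" "x = (1 - u) *\<^sub>R a + u *\<^sub>R b"
    using seg by (auto simp: in_segment)
  have "(\<Sum>g\<in>H. cx g *\<^sub>R g) = (\<Sum>g\<in>G. (if g \<in> H then cx g else 0) *\<^sub>R g)"
    using finG sub by (intro sum.mono_neutral_cong_left) auto
  moreover have "(\<Sum>g\<in>G. ((1 - u) * ca g + u * cb g) *\<^sub>R g) = x"
    unfolding u(3) ca(1) cb(1) by (simp add: scaleR_add_left sum.distrib scaleR_sum_right)
  ultimately have eq: "(\<Sum>g\<in>G. ((1 - u) * ca g + u * cb g) *\<^sub>R g) =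
      (\<Sum>g\<in>G. (if g \<in> H then cx g else 0) *\<^sub>R g)" using cx by simp
  have "ca g = 0 \<and> cb g = 0" if g: "g \<in> G - H" for g
  proof -
    have "(1 - u) * ca g + u * cb g = 0" using independent_coeffs_unique[OF ind eq, of g] g by simp
    moreover have "(1 - u) * ca g \<ge> 0" "u * cb g \<ge> 0" using u ca cb g by auto
    ultimately show ?thesis using u by (simp add: add_nonneg_eq_0_iff)
  qed
  then show "a \<in> convex_cone hull H" "b \<in> convex_cone hull H"
    using H_iff[OF ca] H_iff[OF cb] by blast+
qed

text \<open>\<open>x + y\<close> is the midpoint of \<open>2 x\<close> and \<open>2 y\<close>.\<close>
lemma face_of_cone_summand:
  assumes "F face_of C" "convex_cone C" "convex_cone F" "x \<in> C" "y \<in> C" "x + y \<in> F"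
  shows "x \<in> F"
proof -
  have "2 *\<^sub>R x \<in> F"
  proof (cases "x = y")
    case True
    then show ?thesis using assms(6) by (simp add: scaleR_2)
  next
    case False
    then have "x + y \<in> open_segment (2 *\<^sub>R x) (2 *\<^sub>R y)"
      unfolding in_segment by (intro conjI exI[of _ "1/2"]) auto
    moreover have "2 *\<^sub>R x \<in> C" "2 *\<^sub>R y \<in> C" using assms by (auto intro: convex_cone_scaleR)
    ultimately show ?thesis using assms(1,6) by (auto simp: face_of_def)
  qed
  then have "(1/2) *\<^sub>R (2 *\<^sub>R x) \<in> F" by (rule convex_cone_scaleR[OF assms(3), rotated]) simp
  then show ?thesis by simp
qed

lemma dim_simplicial_cone:
  fixes G :: "(real ^ 'n) set"
  assumes "independent G"
  shows "dim (convex_cone hull G) = card G"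
proof -
  have "convex_cone hull G \<subseteq> span G" by (intro hull_minimal span_superset convex_cone_span)
  moreover have "G \<subseteq> convex_cone hull G" by (rule hull_subset)
  ultimately show ?thesis using assms by (intro dim_unique[of G]) auto
qed

lemma aff_dim_simplicial_cone:
  fixes G :: "(real ^ 'n) set"
  assumes "independent G"
  shows "aff_dim (convex_cone hull G) = int (card G)"
  using dim_simplicial_cone[OF assms] by (subst aff_dim_zero) (auto intro: hull_inc convex_cone_hull_contains_0)

lemma rays_inj:
  assumes "independent (G :: (real ^ 'n) set)"
  shows "inj_on (\<lambda>g. convex_cone hull {g}) G"
proof
  fix g h assume gh: "g \<in> G" "h \<in> G" "convex_cone hull {g} = convex_cone hull {h}"
  show "g = h"
  proof (rule ccontr)
    assume ne: "g \<noteq> h"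
    have "g \<in> convex_cone hull {h}" unfolding gh(3)[symmetric] by (rule hull_inc) simp
    then obtain t where t: "g = t *\<^sub>R h" unfolding convex_cone_hull_single by blast
    have "g \<in> span (G - {g})" unfolding t
      using gh(2) ne t by (intro span_scale span_base) auto
    then show False using assms gh(1) by (auto simp: dependent_def)
  qed
qed

context
  fixes \<Delta> :: "(real ^ 'n) set set"
  assumes fan: "simplicial_fan \<Delta>"
begin

lemma fan_cone:
  assumes "C \<in> \<Delta>"
  obtains G where "independent G" "C = convex_cone hull G" "G \<subseteq> range real_vec"
proof -
  have "simplicial_rational_cone C" using fan assms by (auto simp: simplicial_fan_def)
  then obtain B :: "(int ^ 'n) set" where "independent (real_vec ` B)" "C = convex_cone hull (real_vec ` B)"
    unfolding simplicial_rational_cone_def by blast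
  with that[of "real_vec ` B"] show ?thesis by blast
qed

lemma ray_generator:
  assumes "\<rho> \<in> rays \<Delta>"
  obtains b where "b \<noteq> 0" "\<rho> = convex_cone hull {real_vec b}"
proof -
  have "\<rho> \<in> \<Delta>" "aff_dim \<rho> = 1" using assms by (auto simp: rays_def)
  obtain G where G: "independent G" "\<rho> = convex_cone hull G" "G \<subseteq> range real_vec"
    by (rule fan_cone[OF \<open>\<rho> \<in> \<Delta>\<close>])
  have "card G = 1" using aff_dim_simplicial_cone[OF G(1)] \<open>aff_dim \<rho> = 1\<close> G(2) by simp
  then obtain g where g: "G = {g}" by (auto simp: card_1_singleton_iff)
  with G(3) obtain b where b: "g = real_vec b" by blast
  have "g \<noteq> 0" using G(1) g dependent_zero[of G] by auto
  then have "b \<noteq> 0" using b real_vec_simps by auto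
  with that[of b] g b G(2) show ?thesis by simp
qed

lemma ray_vec:
  assumes "\<rho> \<in> rays \<Delta>"
  shows "primitive_vector (ray_vec \<rho>)" and "\<rho> = convex_cone hull {real_vec (ray_vec \<rho>)}"
proof -
  obtain b where b: "b \<noteq> 0" "\<rho> = convex_cone hull {real_vec b}" by (rule ray_generator[OF assms])
  obtain v c where v: "primitive_vector v" "c > 0" "b = c *s v" by (rule primitive_multiple[OF b(1)])
  have "convex_cone hull {real_vec b} = convex_cone hull {real_vec v}"
    unfolding v(3) real_vec_simps using v(2) by (intro convex_cone_hull_pos_scaleR) simp
  then have \<rho>: "\<rho> = {t *\<^sub>R real_vec v | t. t \<ge> 0}" unfolding b(2) convex_cone_hull_single by simp
  have "ray_vec \<rho> = v"
    unfolding ray_vec_def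
  proof (rule the_equality)
    have "real_vec v = 1 *\<^sub>R real_vec v" by simp
    then have "real_vec v \<in> \<rho>" unfolding \<rho> using zero_le_one by blast
    then show "primitive_vector v \<and> real_vec v \<in> \<rho>" using v(1) by blast
    fix w assume "primitive_vector w \<and> real_vec w \<in> \<rho>"
    then show "w = v" using primitive_vector_unique[OF v(1), of w] unfolding \<rho> by blast
  qed
  then show "primitive_vector (ray_vec \<rho>)" "\<rho> = convex_cone hull {real_vec (ray_vec \<rho>)}"
    using v(1) \<rho> convex_cone_hull_single[of "real_vec v"] by auto
qed

text \<open>A generator \<open>r\<close> of a ray that is a face of \<open>C\<close> is a nonnegative combination of \<open>G\<close>, and every
  summand with positive coefficient lies in the face again, hence on the ray.\<close>
lemma edges_of_cone:
  assumes C: "C \<in> \<Delta>" "C = convex_cone hull G" and ind: "independent G"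
  shows "edges \<Delta> C = (\<lambda>g. convex_cone hull {g}) ` G"
proof (intro subset_antisym subsetI)
  fix \<rho> assume "\<rho> \<in> edges \<Delta> C"
  then have \<rho>: "\<rho> \<in> rays \<Delta>" "\<rho> face_of C" by (auto simp: edges_def)
  have finG: "finite G" using ind by (rule independent_imp_finite)
  obtain b where b: "b \<noteq> 0" "\<rho> = convex_cone hull {real_vec b}" by (rule ray_generator[OF \<rho>(1)])
  define r where "r = real_vec b"
  have r0: "r \<noteq> 0" unfolding r_def using b(1) real_vec_eq_iff[of b 0] by (simp add: real_vec_simps)
  have r\<rho>: "r \<in> \<rho>" unfolding b(2) r_def by (rule hull_inc) simp
  then have "r \<in> C" using \<rho>(2) by (auto simp: face_of_def)
  then obtain c where c: "r = (\<Sum>g\<in>G. c g *\<^sub>R g)" "\<forall>g\<in>G. c g \<ge> 0"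
    unfolding C(2) convex_cone_hull_finite[OF finG] by blast
  obtain g where g: "g \<in> G" "c g \<noteq> 0"
    using r0 c(1) sum.neutral[of G "\<lambda>g. c g *\<^sub>R g"] by auto
  have cg: "c g > 0" using g c(2) by (metis less_eq_real_def)
  have "c g *\<^sub>R g \<in> \<rho>"
  proof (rule face_of_cone_summand[OF \<rho>(2)])
    show "convex_cone C" "convex_cone \<rho>" unfolding C(2) b(2) by (rule convex_cone_convex_cone_hull)+
    show "c g *\<^sub>R g \<in> C" unfolding C(2) using g cg by (intro convex_cone_hull_mul hull_inc) auto
    have "(\<Sum>h\<in>G - {g}. c h *\<^sub>R h) = (\<Sum>h\<in>G. (if h = g then 0 else c h) *\<^sub>R h)"
      using finG by (intro sum.mono_neutral_cong_left) auto
    then show "(\<Sum>h\<in>G - {g}. c h *\<^sub>R h) \<in> C"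
      unfolding C(2) convex_cone_hull_finite[OF finG] using c(2)
      by (intro CollectI exI[of _ "\<lambda>h. if h = g then 0 else c h"]) auto
    show "c g *\<^sub>R g + (\<Sum>h\<in>G - {g}. c h *\<^sub>R h) \<in> \<rho>"
      using r\<rho> finG g c(1) by (simp add: sum.remove)
  qed
  then obtain t where t: "t \<ge> 0" "c g *\<^sub>R g = t *\<^sub>R r"
    unfolding b(2) r_def convex_cone_hull_single by blast
  have "g \<noteq> 0" using ind g dependent_zero by blast
  then have t0: "t > 0" using t cg by (cases "t = 0") auto
  have gr: "g = (t / c g) *\<^sub>R r"
    using arg_cong[OF t(2), of "\<lambda>x. (1 / c g) *\<^sub>R x"] cg by simp
  have "convex_cone hull {g} = convex_cone hull {r}"
    using convex_cone_hull_pos_scaleR[of "t / c g" r] t0 cg gr by simp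
  then show "\<rho> \<in> (\<lambda>g. convex_cone hull {g}) ` G" using g(1) b(2) r_def by auto
next
  fix \<rho> assume "\<rho> \<in> (\<lambda>g. convex_cone hull {g}) ` G"
  then obtain g where g: "g \<in> G" "\<rho> = convex_cone hull {g}" by blast
  have face: "\<rho> face_of C" unfolding g(2) C(2) using ind g(1) by (intro face_of_simplicial_cone) auto
  have "\<rho> \<noteq> {}" unfolding g(2) by (rule convex_cone_hull_nonempty)
  with face C(1) have "\<rho> \<in> \<Delta>" using fan by (auto simp: simplicial_fan_def)
  moreover have "independent {g}" using ind g(1) dependent_zero[of G] by auto
  then have "aff_dim \<rho> = 1" using aff_dim_simplicial_cone[of "{g}"] g(2) by simp
  ultimately show "\<rho> \<in> edges \<Delta> C" using face by (simp add: edges_def rays_def)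
qed

lemma simplex_generators:
  assumes "J \<in> simplices \<Delta>"
  obtains G where "independent G" "convex_cone hull G \<in> \<Delta>" "J = (\<lambda>g. convex_cone hull {g}) ` G"
    "G \<subseteq> range real_vec"
proof -
  obtain C where C: "C \<in> \<Delta>" "J = edges \<Delta> C" using assms by (auto simp: simplices_def)
  obtain G where G: "independent G" "C = convex_cone hull G" "G \<subseteq> range real_vec"
    by (rule fan_cone[OF C(1)])
  show ?thesis using that[OF G(1) _ _ G(3)] edges_of_cone[OF C(1) G(2,1)] C G(2) by blast
qed

lemma simplex_rays: "J \<in> simplices \<Delta> \<Longrightarrow> J \<subseteq> rays \<Delta>"
  by (auto simp: simplices_def edges_def)

lemma finite_rays: "finite (rays \<Delta>)"
  using fan by (auto simp: simplicial_fan_def rays_def)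

lemma simplices_subset:
  assumes "J \<in> simplices \<Delta>" "K \<subseteq> J"
  shows "K \<in> simplices \<Delta>"
proof -
  obtain G where G: "independent G" "convex_cone hull G \<in> \<Delta>" "J = (\<lambda>g. convex_cone hull {g}) ` G"
    by (rule simplex_generators[OF assms(1)])
  obtain H where H: "H \<subseteq> G" "K = (\<lambda>g. convex_cone hull {g}) ` H"
    using assms(2) unfolding G(3) by (auto simp: subset_image_iff)
  have "convex_cone hull H face_of convex_cone hull G" by (rule face_of_simplicial_cone[OF G(1) H(1)])
  then have HD: "convex_cone hull H \<in> \<Delta>"
    using G(2) fan convex_cone_hull_nonempty[of H] by (auto simp: simplicial_fan_def)
  have "independent H" using G(1) H(1) by (rule independent_mono)
  from edges_of_cone[OF HD refl this] H(2) HD show ?thesis unfolding simplices_def by blast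
qed

text \<open>The primitive vectors are nonzero real multiples of independent generators, and a rational
  relation between them is a real one.\<close>
lemma simplex_indep:
  assumes "J \<in> simplices \<Delta>"
  shows "indep_family ray_vec_rat J"
proof -
  obtain G where G: "independent G" "J = (\<lambda>g. convex_cone hull {g}) ` G"
    by (rule simplex_generators[OF assms])
  have finG: "finite G" using G(1) by (rule independent_imp_finite)
  let ?r = "\<lambda>g. ray_vec (convex_cone hull {g})"
  have "\<exists>t. real_vec (?r g) = t *\<^sub>R g \<and> t \<noteq> 0" if g: "g \<in> G" for g
  proof -
    have \<rho>: "convex_cone hull {g} \<in> rays \<Delta>" using simplex_rays[OF assms] G(2) g by blast
    have "real_vec (?r g) \<in> convex_cone hull {g}"
      by (subst (2) ray_vec(2)[OF \<rho>]) (rule hull_inc, simp)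
    then obtain t where t: "real_vec (?r g) = t *\<^sub>R g" unfolding convex_cone_hull_single[of g] by blast
    moreover have "real_vec (?r g) \<noteq> 0"
      using ray_vec(1)[OF \<rho>] real_vec_eq_iff[of "?r g" 0] by (simp add: real_vec_simps primitive_vector_def)
    ultimately show ?thesis by auto
  qed
  then obtain s where s: "\<And>g. g \<in> G \<Longrightarrow> real_vec (?r g) = s g *\<^sub>R g \<and> s g \<noteq> 0" by metis
  show ?thesis
    unfolding indep_family_def
  proof (intro conjI allI impI ballI)
    show "finite J" using finG G(2) by simp
    fix c j assume c: "(\<Sum>j\<in>J. c j *s ray_vec_rat j) = 0" and j: "j \<in> J"
    have "(\<Sum>j\<in>J. real_of_rat (c j) *\<^sub>R real_vec (ray_vec j)) = 0"
    proof (rule vec_eq_iff[THEN iffD2], rule allI)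
      fix a
      have "(\<Sum>j\<in>J. c j * of_int (ray_vec j $ a)) = 0"
        using arg_cong[OF c, of "\<lambda>w. w $ a"] by (simp add: rat_vec_def)
      then have "real_of_rat (\<Sum>j\<in>J. c j * of_int (ray_vec j $ a)) = 0" by simp
      then show "(\<Sum>j\<in>J. real_of_rat (c j) *\<^sub>R real_vec (ray_vec j)) $ a = 0 $ a"
        by (simp add: real_vec_def of_rat_sum of_rat_mult)
    qed
    also have "(\<Sum>j\<in>J. real_of_rat (c j) *\<^sub>R real_vec (ray_vec j)) =
        (\<Sum>g\<in>G. (real_of_rat (c (convex_cone hull {g})) * s g) *\<^sub>R g)"
      unfolding G(2) using s by (subst sum.reindex[OF rays_inj[OF G(1)]]) simp
    finally have z: "(\<Sum>g\<in>G. (real_of_rat (c (convex_cone hull {g})) * s g) *\<^sub>R g) = 0" .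
    obtain g where g: "g \<in> G" "j = convex_cone hull {g}" using j G(2) by blast
    have "real_of_rat (c (convex_cone hull {g})) * s g = 0"
      using independentD[OF G(1) finG subset_refl z g(1)] .
    then show "c j = 0" using s[OF g(1)] g(2) by simp
  qed
qed

end

text \<open>A relative interior point of the cone of \<open>J\<close> lies in a cone of full dimension, because the
  other cones are negligible and the full-dimensional ones form a closed set; that cone then has the
  first one as a face.\<close>
lemma simplex_in_top_simplex:
  fixes \<Delta> :: "(real ^ 'n) set set"
  assumes complete: "complete_simplicial_fan \<Delta>" and J: "J \<in> simplices \<Delta>"
  shows "\<exists>I\<in>simplices_of_card \<Delta> CARD('n). J \<subseteq> I"
proof -
  have fan: "simplicial_fan \<Delta>" and univ: "\<Union>\<Delta> = UNIV" using complete by (auto simp: complete_simplicial_fan_def)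
  have fin: "finite \<Delta>" using fan by (simp add: simplicial_fan_def)
  define U where "U = \<Union>{D \<in> \<Delta>. dim D = CARD('n)}"
  have "closed U"
    unfolding U_def
  proof (rule closed_Union)
    show "finite {D \<in> \<Delta>. dim D = CARD('n)}" using fin by simp
    show "\<forall>D\<in>{D \<in> \<Delta>. dim D = CARD('n)}. closed D"
    proof
      fix D assume "D \<in> {D \<in> \<Delta>. dim D = CARD('n)}"
      then have "D \<in> \<Delta>" by simp
      obtain G where "independent G" "D = convex_cone hull G" by (rule fan_cone[OF fan \<open>D \<in> \<Delta>\<close>])
      then show "closed D" using independent_imp_finite by (auto intro: closed_convex_cone_hull)
    qed
  qed
  have "negligible (- U)"
  proof (rule negligible_subset)
    show "negligible (\<Union>{D \<in> \<Delta>. dim D < CARD('n)})"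
      using fin by (intro negligible_Union) (auto intro: negligible_lowdim)
    show "- U \<subseteq> \<Union>{D \<in> \<Delta>. dim D < CARD('n)}"
    proof
      fix x assume x: "x \<in> - U"
      obtain D where D: "D \<in> \<Delta>" "x \<in> D" using univ by blast
      then have "dim D \<noteq> CARD('n)" using x by (auto simp: U_def)
      then have "dim D < CARD('n)" using dim_subset_UNIV[of D] by simp
      with D show "x \<in> \<Union>{D \<in> \<Delta>. dim D < CARD('n)}" by blast
    qed
  qed
  with \<open>closed U\<close> have U: "U = UNIV" using open_not_negligible[of "- U"] by (auto simp: open_Compl)
  obtain C where C: "C \<in> \<Delta>" "J = edges \<Delta> C" using J by (auto simp: simplices_def)
  obtain G where G: "independent G" "C = convex_cone hull G" by (rule fan_cone[OF fan C(1)])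
  have "C \<noteq> {}" "convex C" unfolding G(2) by (rule convex_cone_hull_nonempty convex_convex_cone_hull)+
  then obtain p where p: "p \<in> rel_interior C" using rel_interior_eq_empty by blast
  obtain D where D: "D \<in> \<Delta>" "dim D = CARD('n)" "p \<in> D" using U by (auto simp: U_def)
  have faces: "(C \<inter> D) face_of C" "(C \<inter> D) face_of D"
    using fan C(1) D(1) by (auto simp: simplicial_fan_def)
  have "p \<in> C" using p rel_interior_subset by blast
  then have "C \<inter> D = C" using face_of_disjoint_rel_interior[OF faces(1)] p D(3) by blast
  then have CD: "C face_of D" using faces(2) by simp
  obtain H where H: "independent H" "D = convex_cone hull H" by (rule fan_cone[OF fan D(1)])
  have "card H = CARD('n)" using dim_simplicial_cone[OF H(1)] H(2) D(2) by simp
  then have "card (edges \<Delta> D) = CARD('n)"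
    unfolding edges_of_cone[OF fan D(1) H(2) H(1)] using card_image[OF rays_inj[OF H(1)]] by simp
  moreover have "edges \<Delta> C \<subseteq> edges \<Delta> D" using face_of_trans[OF _ CD] by (auto simp: edges_def)
  ultimately show ?thesis using C D(1) by (auto simp: simplices_of_card_def simplices_def)
qed

lemma simplex_extends:
  fixes \<Delta> :: "(real ^ 'n) set set"
  assumes "complete_simplicial_fan \<Delta>" "K \<in> simplices \<Delta>" "card K \<le> k" "k \<le> CARD('n)"
  shows "\<exists>J\<in>simplices_of_card \<Delta> k. K \<subseteq> J"
proof -
  have fan: "simplicial_fan \<Delta>" using assms(1) by (simp add: complete_simplicial_fan_def)
  obtain I where I: "I \<in> simplices \<Delta>" "card I = CARD('n)" "K \<subseteq> I"
    using simplex_in_top_simplex[OF assms(1,2)] by (auto simp: simplices_of_card_def)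
  have "finite I" using simplex_indep[OF fan I(1)] by (simp add: indep_family_def)
  then obtain J where "K \<subseteq> J" "J \<subseteq> I" "card J = k"
    using exists_subset_between[of K k I] assms I by auto
  then show ?thesis using simplices_subset[OF fan I(1)] by (auto simp: simplices_of_card_def)
qed

section \<open>The linear forms \<open>f\<^sup>J(x\<^sub>i)\<close> at a point of the Grassmannian\<close>

text \<open>The value of \<open>u \<and> \<omega>\<^sub>J\<close> on \<open>w\<^sub>0 \<and> \<dots> \<and> w\<^sub>r\<close>, written as a Gram determinant. On a plane meeting
  the span of the cone of \<open>J\<close> in a line it is, up to a common factor, the value of \<open>u\<close> on a
  generator of that line.\<close>
definition contraction :: "(real ^ 'n) set set \<Rightarrow> (rat ^ 'n) list \<Rightarrow> rat ^ 'n \<Rightarrow> rat" where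
  "contraction J ws u = det_fun (Suc (length (M_basis J)))
     (\<lambda>i j. if i = 0 then pairing u (ws ! j) else pairing (M_basis_rat J (i - 1)) (ws ! j))"

lemma contraction_sum:
  "contraction J ws (\<Sum>s\<in>S. c s *s u s) = (\<Sum>s\<in>S. c s * contraction J ws (u s))"
  unfolding contraction_def pairing_sum_left pairing_simps(3) by (rule det_fun_row_linear) simp

lemma contraction_zero_on_plane:
  assumes "\<And>j. j \<le> length (M_basis J) \<Longrightarrow> pairing u (ws ! j) = 0"
  shows "contraction J ws u = 0"
  unfolding contraction_def
  by (rule det_fun_dependent_rows[of 0 _ "\<lambda>i. if i = 0 then 1 else 0"])
    (use assms in \<open>auto simp: if_distrib if_distribR sum.delta cong: if_cong\<close>)

lemma contraction_zero_on_annihilator: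
  assumes "\<And>j. j \<in> J \<Longrightarrow> pairing u (ray_vec_rat j) = 0"
  shows "contraction J ws u = 0"
proof -
  obtain c where c: "u = (\<Sum>s<length (M_basis J). c s *s M_basis_rat J s)"
    using M_basis_rat_spans[OF assms] by blast
  show ?thesis
    unfolding contraction_def
  proof (rule det_fun_dependent_rows[of 0 _ "case_nat (-1) c"])
    fix j assume "j < Suc (length (M_basis J))"
    show "(\<Sum>s<Suc (length (M_basis J)). (case s of 0 \<Rightarrow> - 1 | Suc i \<Rightarrow> c i) *
        (if s = 0 then pairing u (ws ! j) else pairing (M_basis_rat J (s - 1)) (ws ! j))) = 0"
      unfolding sum.lessThan_Suc_shift by (simp add: c pairing_sum_left pairing_simps del: sum.lessThan_Suc)
  qed auto
qed

text \<open>A vector \<open>e\<close> of the plane at which \<open>u\<close> and \<open>\<omega>\<^sub>J\<close> all vanish is a dependency between the columns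
  of the Gram matrix.\<close>
lemma contraction_zero_imp:
  assumes nz: "contraction J ws u \<noteq> 0"
    and e: "e = (\<Sum>s\<le>length (M_basis J). c s *s ws ! s)"
    and u: "pairing u e = 0" and \<omega>: "\<And>s. s < length (M_basis J) \<Longrightarrow> pairing (M_basis_rat J s) e = 0"
    and t: "t \<le> length (M_basis J)"
  shows "c t = 0"
proof (rule ccontr)
  assume "c t \<noteq> 0"
  have *: "(\<Sum>s<Suc (length (M_basis J)). c s * pairing w (ws ! s)) = pairing w e" for w
    unfolding e by (simp add: pairing_sum_right pairing_simps lessThan_Suc_atMost)
  have "contraction J ws u = 0"
    unfolding contraction_def
  proof (rule det_fun_dependent_columns[of t _ c])
    fix i assume "i < Suc (length (M_basis J))"
    then show "(\<Sum>s<Suc (length (M_basis J)). c s * (if i = 0 then pairing u (ws ! s)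
        else pairing (M_basis_rat J (i - 1)) (ws ! s))) = 0"
      using *[of u] *[of "M_basis_rat J (i - 1)"] u \<omega>[of "i - 1"] by (cases "i = 0") auto
  qed (use t \<open>c t \<noteq> 0\<close> in auto)
  with nz show False ..
qed

text \<open>At a vector \<open>e\<close> that lies both in the plane and in the span of \<open>K\<close>, the functionals \<open>\<omega>\<^sub>J\<close> and
  \<open>u0\<close> vanish; the nonzero determinant then forces \<open>e = 0\<close>. So the plane and \<open>K\<close> are in general
  position, and a functional may be prescribed on both.\<close>
lemma exists_functional_zero_on_plane:
  fixes J :: "(real ^ 'n) set set"
  assumes indep: "indep_family ray_vec_rat K" and KJ: "K \<subseteq> J"
    and u0: "\<And>j. j \<in> K \<Longrightarrow> pairing u0 (ray_vec_rat j) = 0" and nz: "contraction J ws u0 \<noteq> 0"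
  shows "\<exists>u. (\<forall>j\<in>K. pairing u (ray_vec_rat j) = g j) \<and>
    (\<forall>s\<le>length (M_basis J). pairing u (ws ! s) = 0)"
proof -
  let ?m = "length (M_basis J)"
  have finK: "finite K" using indep by (simp add: indep_family_def)
  let ?f = "case_sum ray_vec_rat ((!) ws)"
  have "indep_family ?f (K <+> {..?m})"
    unfolding indep_family_def
  proof (intro conjI allI impI ballI)
    show "finite (K <+> {..?m})" using finK by simp
    fix c x assume c: "(\<Sum>x\<in>K <+> {..?m}. c x *s ?f x) = 0" and x: "x \<in> K <+> {..?m}"
    define e where "e = (\<Sum>s\<le>?m. c (Inr s) *s ws ! s)"
    have split: "(\<Sum>j\<in>K. c (Inl j) *s ray_vec_rat j) + e = 0"
      using c finK by (simp add: sum.Plus e_def)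
    then have e: "e = - (\<Sum>j\<in>K. c (Inl j) *s ray_vec_rat j)" by (simp add: eq_neg_iff_add_eq_0 add.commute)
    have zero: "pairing w e = 0" if "\<And>j. j \<in> K \<Longrightarrow> pairing w (ray_vec_rat j) = 0" for w
    proof -
      have "pairing w (\<Sum>j\<in>K. c (Inl j) *s ray_vec_rat j) = 0"
        using that by (simp add: pairing_sum_right pairing_simps)
      then show ?thesis using pairing_simps(8)[of w "-1"] unfolding e by simp
    qed
    have "c (Inr t) = 0" if "t \<le> ?m" for t
    proof (rule contraction_zero_imp[OF nz, where c = "\<lambda>s. c (Inr s)"])
      show "e = (\<Sum>s\<le>?m. c (Inr s) *s ws ! s)" by (rule e_def)
      show "pairing u0 e = 0" using u0 by (rule zero)
      show "pairing (M_basis_rat J s) e = 0" if "s < ?m" for s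
        by (rule zero) (use that KJ M_basis_rat_annihilates in blast)
    qed (rule that)
    moreover from this have "e = 0" unfolding e_def by simp
    with split have "(\<Sum>j\<in>K. c (Inl j) *s ray_vec_rat j) = 0" by simp
    then have "c (Inl j) = 0" if "j \<in> K" for j
      using indep_familyD[OF indep, of "\<lambda>j. c (Inl j)"] that by simp
    ultimately show "c x = 0" using x by auto
  qed
  from exists_dual_functional[OF this, of "case_sum g (\<lambda>_. 0)"]
  obtain u where u: "\<forall>x\<in>K <+> {..?m}. pairing u (?f x) = case_sum g (\<lambda>_. 0) x" ..
  have "pairing u (ray_vec_rat j) = g j" if "j \<in> K" for j using u[rule_format, of "Inl j"] that by auto
  moreover have "pairing u (ws ! s) = 0" if "s \<le> ?m" for s using u[rule_format, of "Inr s"] that by auto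
  ultimately show ?thesis by blast
qed

lemma plane_basis_indep:
  assumes "contraction J ws u \<noteq> 0" "length ws = Suc (length (M_basis J))"
  shows "distinct ws" "vec.independent (set ws)"
proof -
  have "indep_family ((!) ws) {..<length ws}"
    unfolding indep_family_def
  proof (intro conjI allI impI ballI)
    fix c t assume "(\<Sum>s<length ws. c s *s ws ! s) = 0" "t \<in> {..<length ws}"
    then show "c t = 0"
      using contraction_zero_imp[OF assms(1), of 0 c t] assms(2)
      by (simp add: pairing_simps lessThan_Suc_atMost)
  qed simp
  then have "inj_on ((!) ws) {..<length ws}" "vec.independent ((!) ws ` {..<length ws})"
    by (auto simp: indep_family_iff)
  moreover have "(!) ws ` {..<length ws} = set ws" by (auto simp: set_conv_nth)
  ultimately show "distinct ws" "vec.independent (set ws)" by (auto simp: distinct_conv_nth inj_on_def)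
qed

text \<open>The plane spanned by \<open>\<Sum>j\<in>J. v\<^sub>j\<close> and vectors dual to the basis of \<open>M\<^sub>J\<close>, for which the Gram
  matrix is upper triangular.\<close>
lemma exists_generic_plane:
  assumes "finite J"
  shows "\<exists>ws. length ws = Suc (length (M_basis J)) \<and>
    (\<forall>u. contraction J ws u = (\<Sum>j\<in>J. pairing u (ray_vec_rat j)))"
proof -
  let ?m = "length (M_basis J)"
  have "\<exists>w. \<forall>s\<in>{..<?m}. pairing w (M_basis_rat J s) = (if s = t then 1 else 0)" for t
    by (rule exists_dual_functional[OF M_basis_rat_indep])
  then obtain w where w: "\<And>s t. s < ?m \<Longrightarrow> pairing (w t) (M_basis_rat J s) = (if s = t then 1 else 0)"
    by (metis lessThan_iff)
  let ?ws = "(\<Sum>j\<in>J. ray_vec_rat j) # map w [0..<?m]"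
  have "contraction J ?ws u = (\<Sum>j\<in>J. pairing u (ray_vec_rat j))" for u
  proof -
    let ?G = "\<lambda>i j. if i = 0 then pairing u (?ws ! j) else pairing (M_basis_rat J (i - 1)) (?ws ! j)"
    have col0: "?G i 0 = 0" if "0 < i" "i < Suc ?m" for i
      using that by (auto simp: pairing_sum_right M_basis_rat_annihilates)
    have rest: "?G i j = (if i = j then 1 else 0)" if "0 < i" "i < Suc ?m" "0 < j" "j < Suc ?m" for i j
      using that w[of "i - 1" "j - 1"] by (cases i; cases j) (auto simp: pairing_commute[of _ "w _"])
    have "?G i j = 0" if "j < i" "i < Suc ?m" for i j
    proof (cases "j = 0")
      case True
      then show ?thesis using col0[of i] that by simp
    next
      case False
      then show ?thesis using rest[of i j] that by simp
    qed
    then have "det_fun (Suc ?m) ?G = (\<Prod>i<Suc ?m. ?G i i)"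
      by (rule det_fun_upper_triangular)
    moreover have diag: "?G (Suc i) (Suc i) = 1" if "i < ?m" for i
      using rest[of "Suc i" "Suc i"] that by simp
    moreover have "(\<Prod>i<Suc ?m. ?G i i) = ?G 0 0 * (\<Prod>i<?m. ?G (Suc i) (Suc i))"
      by (rule prod.lessThan_Suc_shift)
    moreover have "(\<Prod>i<?m. ?G (Suc i) (Suc i)) = 1" using diag by (intro prod.neutral) blast
    ultimately show ?thesis unfolding contraction_def by (simp add: pairing_sum_right)
  qed
  then show ?thesis by (intro exI[of _ ?ws]) auto
qed

text \<open>The value of the linear form \<open>f\<^sup>J(x\<^sub>\<rho>)\<close> at the plane with basis \<open>ws\<close>.\<close>
definition weight ::
    "(real ^ 'n) set set \<Rightarrow> (real ^ 'n) set set \<Rightarrow> (rat ^ 'n) list \<Rightarrow> (real ^ 'n) set \<Rightarrow> rat" where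
  "weight \<Delta> J ws \<rho> = contraction J ws (iota (top_simplex \<Delta> J) \<rho>)"

context
  fixes \<Delta> :: "(real ^ 'n::{finite,linorder}) set set" and J :: "(real ^ 'n::{finite,linorder}) set set" and k :: nat
  assumes fan: "complete_simplicial_fan \<Delta>" and J: "J \<in> simplices_of_card \<Delta> k"
begin

lemma top_simplex: "top_simplex \<Delta> J \<in> simplices_of_card \<Delta> CARD('n)" "J \<subseteq> top_simplex \<Delta> J"
proof -
  have "\<exists>I. I \<in> simplices_of_card \<Delta> CARD('n) \<and> J \<subseteq> I"
    using simplex_in_top_simplex[OF fan, of J] J by (auto simp: simplices_of_card_def)
  from someI_ex[OF this]
  show "top_simplex \<Delta> J \<in> simplices_of_card \<Delta> CARD('n)" "J \<subseteq> top_simplex \<Delta> J"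
    unfolding top_simplex_def by blast+
qed

lemma simplicial: "simplicial_fan \<Delta>"
  using fan by (simp add: complete_simplicial_fan_def)

lemma top_simplex_indep:
  "indep_family ray_vec_rat (top_simplex \<Delta> J)" "card (top_simplex \<Delta> J) = CARD('n)"
  using simplex_indep[OF simplicial] top_simplex(1) by (auto simp: simplices_of_card_def)

lemma length_M_basis_simplex: "length (M_basis J) = CARD('n) - k"
  using length_M_basis[OF top_simplex_indep top_simplex(2)] J by (simp add: simplices_of_card_def)

lemma aeval_f_gen:
  assumes "length ws = CARD('n) - k + 1"
  shows "aeval id (wedge ws) (f_gen \<Delta> J \<rho>) = weight \<Delta> J ws \<rho>"
proof -
  have card: "card J = k" using J by (simp add: simplices_of_card_def)
  let ?us = "iota (top_simplex \<Delta> J) \<rho> # map rat_vec (M_basis J)"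
  have "aeval id (wedge ws) (f_gen \<Delta> J \<rho>) = (\<Sum>K | card K = CARD('n) - k + 1. wedge ?us K * wedge ws K)"
    unfolding f_gen_def linear_form_def card idq.aeval_sum idq.aeval_mult idq.aeval_cst idq.aeval_var by simp
  also have "\<dots> = det_fun (CARD('n) - k + 1) (\<lambda>i j. pairing (?us ! i) (ws ! j))"
    using assms by (intro cauchy_binet) (auto simp: length_M_basis_simplex)
  also have "\<dots> = weight \<Delta> J ws \<rho>"
    unfolding weight_def contraction_def length_M_basis_simplex
    by (simp, intro det_fun_cong) (auto simp: nth_Cons' length_M_basis_simplex)
  finally show ?thesis .
qed

lemma weight_outside: "\<rho> \<notin> J \<Longrightarrow> weight \<Delta> J ws \<rho> = 0"
  unfolding weight_def
  using top_simplex(2) dual_vec_pairing[OF top_simplex_indep, of \<rho>]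
  by (intro contraction_zero_on_annihilator) (auto simp: iota_def pairing_simps)

text \<open>\<open>f\<^sup>J\<close> sends the image of \<open>u\<close> in \<open>H\<^sub>T\<^sup>*(\<Delta>)\<close> to \<open>u \<and> \<omega>\<^sub>J\<close>, because \<open>u\<close> is the sum of the
  \<open>\<langle>u, v\<^sub>i\<rangle> u\<^sub>i\<^sup>I\<close>.\<close>
lemma sum_weight: "(\<Sum>\<rho>\<in>rays \<Delta>. pairing u (ray_vec_rat \<rho>) * weight \<Delta> J ws \<rho>) = contraction J ws u"
proof -
  let ?I = "top_simplex \<Delta> J"
  have "?I \<subseteq> rays \<Delta>"
    using top_simplex(1) simplex_rays[OF simplicial, of ?I] by (auto simp: simplices_of_card_def)
  have "(\<Sum>\<rho>\<in>rays \<Delta>. pairing u (ray_vec_rat \<rho>) * weight \<Delta> J ws \<rho>) =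
      (\<Sum>\<rho>\<in>?I. pairing u (ray_vec_rat \<rho>) * contraction J ws (dual_vec ?I \<rho>))"
  proof (rule sum.mono_neutral_cong_right[OF finite_rays[OF simplicial] \<open>?I \<subseteq> rays \<Delta>\<close>])
    show "\<forall>\<rho>\<in>rays \<Delta> - ?I. pairing u (ray_vec_rat \<rho>) * weight \<Delta> J ws \<rho> = 0"
      using weight_outside top_simplex(2) by auto
  qed (simp add: weight_def iota_def)
  also have "\<dots> = contraction J ws (\<Sum>\<rho>\<in>?I. pairing u (ray_vec_rat \<rho>) *s dual_vec ?I \<rho>)"
    by (rule contraction_sum[symmetric])
  also have "(\<Sum>\<rho>\<in>?I. pairing u (ray_vec_rat \<rho>) *s dual_vec ?I \<rho>) = u"
    by (rule dual_vec_expansion[OF top_simplex_indep, symmetric])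
  finally show ?thesis .
qed

text \<open>The functional dual to a vertex \<open>l\<close> of \<open>J\<close> outside \<open>K\<close> shows that the plane and \<open>K\<close> are in
  general position.\<close>
lemma exists_linear_relation:
  assumes K: "K \<subseteq> J" "K \<noteq> J" and nz: "\<And>j. j \<in> J \<Longrightarrow> weight \<Delta> J ws j \<noteq> 0"
    and len: "length ws = CARD('n) - k + 1"
  shows "\<exists>u. (\<forall>j\<in>K. pairing u (ray_vec_rat j) = g j) \<and> (\<forall>w\<in>set ws. pairing u w = 0)"
proof -
  obtain l where l: "l \<in> J" "l \<notin> K" using K by blast
  have "K \<subseteq> top_simplex \<Delta> J" using K(1) top_simplex(2) by blast
  then have indep: "indep_family ray_vec_rat K" by (rule indep_family_subset[OF top_simplex_indep(1)])
  have "pairing (dual_vec (top_simplex \<Delta> J) l) (ray_vec_rat j) = 0" if "j \<in> K" for j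

  proof -
    have "l \<in> top_simplex \<Delta> J" "j \<in> top_simplex \<Delta> J" "j \<noteq> l" using that l K(1) top_simplex(2) by auto
    then show ?thesis using dual_vec_pairing[OF top_simplex_indep, of l j] by simp
  qed
  moreover have "contraction J ws (dual_vec (top_simplex \<Delta> J) l) \<noteq> 0"
    using nz[OF l(1)] l(1) top_simplex(2) by (auto simp: weight_def iota_def)
  ultimately obtain u where u: "\<forall>j\<in>K. pairing u (ray_vec_rat j) = g j"
    "\<forall>s\<le>length (M_basis J). pairing u (ws ! s) = 0"
    using exists_functional_zero_on_plane[OF indep K(1)] by blast
  have "\<forall>w\<in>set ws. pairing u w = 0"
    using u(2) len by (auto simp: in_set_conv_nth length_M_basis_simplex)
  with u(1) show ?thesis by blast
qed

lemma exists_nonzero_weights: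
  assumes "1 \<le> k"
  shows "\<exists>ws. length ws = CARD('n) - k + 1 \<and> distinct ws \<and> vec.independent (set ws) \<and>
    (\<forall>j\<in>J. weight \<Delta> J ws j \<noteq> 0)"
proof -
  have fin: "finite J" using top_simplex_indep(1) top_simplex(2) finite_subset by (auto simp: indep_family_def)
  obtain ws where ws: "length ws = Suc (length (M_basis J))"
    and c: "\<And>u. contraction J ws u = (\<Sum>j\<in>J. pairing u (ray_vec_rat j))"
    using exists_generic_plane[OF fin] by blast
  have one: "contraction J ws (iota (top_simplex \<Delta> J) j) = 1" if "j \<in> J" for j
  proof -
    have "(\<Sum>i\<in>J. pairing (dual_vec (top_simplex \<Delta> J) j) (ray_vec_rat i)) = (\<Sum>i\<in>J. if i = j then 1 else 0)"
      using that top_simplex(2) by (intro sum.cong refl dual_vec_pairing[OF top_simplex_indep]) auto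
    then show ?thesis using that fin top_simplex(2) by (auto simp: c iota_def)
  qed
  have "J \<noteq> {}" using J assms by (auto simp: simplices_of_card_def)
  then obtain j where "j \<in> J" by blast
  then have "contraction J ws (iota (top_simplex \<Delta> J) j) \<noteq> 0" using one by simp
  from plane_basis_indep[OF this ws] one ws show ?thesis
    unfolding weight_def by (intro exI[of _ ws]) (simp add: length_M_basis_simplex)
qed

end

section \<open>The cohomology rings\<close>

text \<open>The coordinates of \<open>u \<and> \<omega>\<^sub>J\<close> are its values on the coordinate planes, so that the vanishing
  results for planes apply to the form itself.\<close>
lemma wedge_eq_contraction:
  fixes u :: "rat ^ 'n::{finite,linorder}"
  assumes "card K = Suc (length (M_basis J))"
  shows "wedge (u # map rat_vec (M_basis J)) K =
    contraction J (map (\<lambda>a. axis a 1) (sorted_list_of_set K)) u"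
proof -
  have "pairing w (axis a 1) = w $ a" for w :: "rat ^ 'n::{finite,linorder}" and a
    by (simp add: pairing_def axis_def if_distrib cong: if_cong)
  then show ?thesis using assms
    by (subst wedge_eq_det_fun) (auto simp: contraction_def nth_Cons' intro!: det_fun_cong)
qed

lemma cring_poly_ring: "cring (poly_ring V)"
proof (rule cringI)
  show "abelian_group (poly_ring V)"
    by (rule abelian_groupI) (auto simp: poly_ring_def polys_intros algebra_simps intro!: bexI[of _ "- _"])
  show "comm_monoid (poly_ring V)"
    by (rule comm_monoidI) (auto simp: poly_ring_def polys_intros algebra_simps)
qed (simp add: poly_ring_def algebra_simps)

context
  fixes \<Delta> :: "(real ^ 'n) set set"
begin

interpretation P: cring "poly_ring (rays \<Delta>)" by (rule cring_poly_ring)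

lemma mono_of_polys: "K \<subseteq> V \<Longrightarrow> mono_of K \<in> polys V"
  unfolding mono_of_def by (intro polys_prod polys_var) auto

lemma homogeneous_mono_of: "homogeneous (card K) (mono_of K)"
  unfolding mono_of_def using homogeneous_prod[of K "\<lambda>_. 1" var, OF homogeneous_var] by simp

lemma SR_ideal: "ideal (SR_ideal \<Delta>) (poly_ring (rays \<Delta>))"
  unfolding SR_ideal_def by (rule P.genideal_ideal) (auto simp: poly_ring_def mono_of_polys)

lemma cring_HT: "cring (HT \<Delta>)"
  unfolding HT_def by (rule ideal.quotient_is_cring[OF SR_ideal cring_poly_ring])

lemma HT_class_hom: "HT_class \<Delta> \<in> ring_hom (poly_ring (rays \<Delta>)) (HT \<Delta>)"
  using ideal.rcos_ring_hom[OF SR_ideal] unfolding HT_def HT_class_def[abs_def] .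

lemma HT_class_carrier: "p \<in> polys (rays \<Delta>) \<Longrightarrow> HT_class \<Delta> p \<in> carrier (HT \<Delta>)"
  using ring_hom_closed[OF HT_class_hom] by (simp add: poly_ring_def)

lemma structure_map_carrier: "structure_map \<Delta> p \<in> carrier (HT \<Delta>)"
proof -
  have "(\<Sum>\<rho>\<in>rays \<Delta>. cst (of_int (ray_vec \<rho> $ a)) * var \<rho>) \<in> polys (rays \<Delta>)" for a
    by (intro polys_intros)
  then have "aeval cst (\<lambda>a. \<Sum>\<rho>\<in>rays \<Delta>. cst (of_int (ray_vec \<rho> $ a)) * var \<rho>) p \<in> polys (rays \<Delta>)"
    by (rule aeval_polys)
  then show ?thesis unfolding structure_map_def by (rule HT_class_carrier)
qed

lemma H_ideal: "ideal (H_ideal \<Delta>) (HT \<Delta>)"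
proof -
  interpret HT: cring "HT \<Delta>" by (rule cring_HT)
  show ?thesis unfolding H_ideal_def
    by (rule HT.genideal_ideal) (auto simp: structure_map_carrier)
qed

lemma cring_coh: "cring (coh_ring \<Delta>)"
  unfolding coh_ring_def by (rule ideal.quotient_is_cring[OF H_ideal cring_HT])

lemma bar_hom: "bar \<Delta> \<in> ring_hom (HT \<Delta>) (coh_ring \<Delta>)"
  using ideal.rcos_ring_hom[OF H_ideal] unfolding coh_ring_def bar_def[abs_def] .

definition cls :: "(real ^ 'n) set qpoly \<Rightarrow> (real ^ 'n) set qpoly set set" where
  "cls p = bar \<Delta> (HT_class \<Delta> p)"

lemma cls_hom: "cls \<in> ring_hom (poly_ring (rays \<Delta>)) (coh_ring \<Delta>)"
  using ring_hom_trans[OF HT_class_hom bar_hom] by (simp add: cls_def[abs_def] o_def)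

lemma cls_carrier: "p \<in> polys (rays \<Delta>) \<Longrightarrow> cls p \<in> carrier (coh_ring \<Delta>)"
  using ring_hom_closed[OF cls_hom] by (simp add: poly_ring_def)

lemma cls_add:
  "p \<in> polys (rays \<Delta>) \<Longrightarrow> q \<in> polys (rays \<Delta>) \<Longrightarrow> cls (p + q) = cls p \<oplus>\<^bsub>coh_ring \<Delta>\<^esub> cls q"
  using ring_hom_add[OF cls_hom, of p q] by (simp add: poly_ring_def)

lemma cls_mult:
  "p \<in> polys (rays \<Delta>) \<Longrightarrow> q \<in> polys (rays \<Delta>) \<Longrightarrow> cls (p * q) = cls p \<otimes>\<^bsub>coh_ring \<Delta>\<^esub> cls q"
  using ring_hom_mult[OF cls_hom, of p q] by (simp add: poly_ring_def)

lemma cls_0: "cls 0 = \<zero>\<^bsub>coh_ring \<Delta>\<^esub>"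
  using ring_hom_zero[OF cls_hom P.ring_axioms cring.axioms(1)[OF cring_coh]] by (simp add: poly_ring_def)

lemma cls_mult_zero:
  assumes "p \<in> polys (rays \<Delta>)" "q \<in> polys (rays \<Delta>)" "cls p = cls 0"
  shows "cls (p * q) = cls 0"
proof -
  interpret C: cring "coh_ring \<Delta>" by (rule cring_coh)
  show ?thesis using assms by (simp add: cls_mult cls_0 cls_carrier)
qed

lemma cls_diff_zero_iff:
  assumes "p \<in> polys (rays \<Delta>)" "q \<in> polys (rays \<Delta>)"
  shows "cls (p - q) = cls 0 \<longleftrightarrow> cls p = cls q"
proof -
  interpret C: cring "coh_ring \<Delta>" by (rule cring_coh)
  have "cls p = cls (p - q) \<oplus>\<^bsub>coh_ring \<Delta>\<^esub> cls q"
    using cls_add[of "p - q" q] assms by (simp add: polys_diff)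
  then show ?thesis using assms cls_carrier[of "p - q"] cls_carrier[of q]
    by (auto simp: cls_0 polys_diff C.add.l_cancel_one C.add.r_cancel_one)
qed

lemma cls_mono_of_nonface:
  assumes "K \<subseteq> rays \<Delta>" "K \<notin> simplices \<Delta>"
  shows "cls (mono_of K) = cls 0"
proof -
  interpret SR: ideal "SR_ideal \<Delta>" "poly_ring (rays \<Delta>)" by (rule SR_ideal)
  have "mono_of K \<in> SR_ideal \<Delta>"
    unfolding SR_ideal_def using assms
    by (intro subsetD[OF P.genideal_self]) (auto simp: poly_ring_def mono_of_polys)
  moreover have "0 \<in> SR_ideal \<Delta>" using SR.zero_closed by (simp add: poly_ring_def)
  ultimately have "HT_class \<Delta> (mono_of K) = HT_class \<Delta> 0"
    unfolding HT_class_def by (simp add: SR.a_rcos_const)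
  then show ?thesis by (simp add: cls_def)
qed

text \<open>The image in \<open>H\<^sub>T\<^sup>*(\<Delta>)\<close> of the element \<open>u\<close> of \<open>M\<close>, extended to rational \<open>u\<close>.\<close>
definition linear_class :: "rat ^ 'n \<Rightarrow> (real ^ 'n) set qpoly" where
  "linear_class u = (\<Sum>\<rho>\<in>rays \<Delta>. cst (pairing u (ray_vec_rat \<rho>)) * var \<rho>)"

lemma linear_class_polys: "linear_class u \<in> polys (rays \<Delta>)"
  unfolding linear_class_def by (intro polys_intros)

lemma cls_linear_class: "cls (linear_class u) = cls 0"
proof -
  interpret HT: cring "HT \<Delta>" by (rule cring_HT)
  interpret H: ideal "H_ideal \<Delta>" "HT \<Delta>" by (rule H_ideal)
  let ?p = "\<Sum>a\<in>UNIV. cst (u $ a) * var a :: 'n qpoly"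
  have "homogeneous 1 ?p"
    by (intro homogeneous_sum homogeneous_cst_mult homogeneous_var)
  then have "0 \<notin> Poly_Mapping.keys ?p" by (force simp: homogeneous_def)
  then have "?p \<in> HT_pt_positive" by (simp add: HT_pt_positive_def in_keys_iff)
  then have "structure_map \<Delta> ?p \<in> H_ideal \<Delta>"
    unfolding H_ideal_def by (intro subsetD[OF HT.genideal_self]) (auto simp: structure_map_carrier)
  moreover have "structure_map \<Delta> ?p = HT_class \<Delta> (linear_class u)"
  proof -
    have "aeval cst (\<lambda>a. \<Sum>\<rho>\<in>rays \<Delta>. cst (of_int (ray_vec \<rho> $ a)) * var \<rho>) ?p =
        (\<Sum>a\<in>UNIV. \<Sum>\<rho>\<in>rays \<Delta>. cst (u $ a * of_int (ray_vec \<rho> $ a)) * var \<rho>)"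
      by (simp add: cst.aeval_sum cst.aeval_mult cst.aeval_cst cst.aeval_var sum_distrib_left cst_simps mult.assoc)
    also have "\<dots> = linear_class u"
      unfolding linear_class_def pairing_def rat_vec_def
      by (subst sum.swap) (simp add: cst_sum sum_distrib_right)
    finally show ?thesis by (simp add: structure_map_def)
  qed
  moreover have "HT_class \<Delta> 0 \<in> H_ideal \<Delta>"
    using ring_hom_zero[OF HT_class_hom P.ring_axioms HT.ring_axioms] H.zero_closed by (simp add: poly_ring_def)
  ultimately have "bar \<Delta> (HT_class \<Delta> (linear_class u)) = bar \<Delta> (HT_class \<Delta> 0)"
    unfolding bar_def by (simp add: H.a_rcos_const)
  then show ?thesis by (simp add: cls_def)
qed

lemma H_deg_simps:
  "carrier (H_deg \<Delta> k) = cls ` {p \<in> polys (rays \<Delta>). homogeneous k p}"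
  "add (H_deg \<Delta> k) = add (coh_ring \<Delta>)"
  by (auto simp: H_deg_def HT_deg_def cls_def)

lemma H_deg_add:
  "p \<in> polys (rays \<Delta>) \<Longrightarrow> q \<in> polys (rays \<Delta>) \<Longrightarrow> cls p \<oplus>\<^bsub>H_deg \<Delta> k\<^esub> cls q = cls (p + q)"
  by (simp add: H_deg_simps cls_add)

lemma H_deg_smult:
  "p \<in> polys (rays \<Delta>) \<Longrightarrow> c \<odot>\<^bsub>H_deg \<Delta> k\<^esub> cls p = cls (cst c * p)"
  by (simp add: H_deg_def cls_mult polys_cst flip: cls_def)

end

context
  fixes \<Delta> :: "(real ^ 'n::{finite,linorder}) set set"
    and J :: "(real ^ 'n::{finite,linorder}) set set" and k :: nat
  assumes fan: "complete_simplicial_fan \<Delta>" and J: "J \<in> simplices_of_card \<Delta> k"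
begin

lemma f_gen_homogeneous: "homogeneous 1 (f_gen \<Delta> J \<rho>)"
  unfolding f_gen_def linear_form_def
  by (intro homogeneous_sum homogeneous_cst_mult homogeneous_var)

lemma f_gen_plucker_polys: "f_gen \<Delta> J \<rho> \<in> plucker_polys (CARD('n) - k + 1)"
proof -
  have "card J = k" using J by (simp add: simplices_of_card_def)
  then show ?thesis unfolding f_gen_def linear_form_def plucker_polys_def
    by (intro polys_sum polys_mult polys_cst polys_var) auto
qed

text \<open>If \<open>\<rho>\<close> is not in \<open>J\<close>, then \<open>\<iota>\<^sub>I\<^sup>*(x\<^sub>\<rho>)\<close> lies in the span of \<open>M\<^sub>J\<close>, whose elements have zero wedge
  product with \<open>\<omega>\<^sub>J\<close>.\<close>
lemma f_gen_outside:
  assumes "\<rho> \<notin> J"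
  shows "f_gen \<Delta> J \<rho> = 0"
proof -
  have "wedge (iota (top_simplex \<Delta> J) \<rho> # map rat_vec (M_basis J)) K = 0" for K
  proof (cases "card K = Suc (length (M_basis J))")
    case True
    have "contraction J ws (iota (top_simplex \<Delta> J) \<rho>) = 0" for ws
      using weight_outside[OF fan J assms] unfolding weight_def .
    with True show ?thesis by (simp add: wedge_eq_contraction)
  qed (simp add: wedge_def)
  then show ?thesis by (simp add: f_gen_def linear_form_def cst_simps)
qed

text \<open>\<open>f\<^sup>J\<close> factors through the Stanley--Reisner ring, since a set of rays that is not a simplex is not
  contained in \<open>J\<close>.\<close>
lemma aeval_f_gen_SR_ideal:
  assumes "p \<in> SR_ideal \<Delta>"
  shows "aeval cst (f_gen \<Delta> J) p = 0"
proof -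
  interpret P: cring "poly_ring (rays \<Delta>)" by (rule cring_poly_ring)
  let ?Z = "{p \<in> polys (rays \<Delta>). aeval cst (f_gen \<Delta> J) p = 0}"
  have inv: "\<ominus>\<^bsub>poly_ring (rays \<Delta>)\<^esub> q = - q" if "q \<in> polys (rays \<Delta>)" for q
    using that by (intro P.minus_equality) (auto simp: poly_ring_def polys_uminus)
  have "ideal ?Z (poly_ring (rays \<Delta>))"
  proof (rule idealI[OF P.ring_axioms])
    show "subgroup ?Z (add_monoid (poly_ring (rays \<Delta>)))"
      using inv by (intro subgroup.intro)
        (auto simp: poly_ring_def polys_intros cst.aeval_add cst.aeval_uminus a_inv_def)
  qed (auto simp: poly_ring_def polys_intros cst.aeval_mult)
  moreover have "mono_of K \<in> ?Z" if K: "K \<subseteq> rays \<Delta>" "K \<notin> simplices \<Delta>" for K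
  proof -
    have "\<not> K \<subseteq> J" using K simplices_subset[OF simplicial[OF fan J]] J by (auto simp: simplices_of_card_def)
    then obtain \<rho> where "\<rho> \<in> K" "\<rho> \<notin> J" by blast
    moreover have "finite K" using finite_subset[OF K(1) finite_rays[OF simplicial[OF fan J]]] .
    ultimately have "aeval cst (f_gen \<Delta> J) (mono_of K) = 0"
      unfolding mono_of_def cst.aeval_prod using f_gen_outside
      by (intro prod_zero) (auto simp: cst.aeval_var)
    then show ?thesis using K(1) by (simp add: mono_of_polys)
  qed
  ultimately have "SR_ideal \<Delta> \<subseteq> ?Z"
    unfolding SR_ideal_def by (intro P.genideal_minimal) auto
  then show ?thesis using assms by auto
qed

lemma f_hom_class:
  assumes "p \<in> polys (rays \<Delta>)"
  shows "f_hom \<Delta> J (HT_class \<Delta> p) = aeval cst (f_gen \<Delta> J) p"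
proof -
  interpret SR: ideal "SR_ideal \<Delta>" "poly_ring (rays \<Delta>)" by (rule SR_ideal)
  have x: "HT_class \<Delta> p = (\<lambda>s. s + p) ` SR_ideal \<Delta>"
    unfolding HT_class_def a_r_coset_def r_coset_def by (auto simp: poly_ring_def)
  have "0 \<in> SR_ideal \<Delta>" using additive_subgroup.zero_closed[OF ideal.axioms(1)[OF SR_ideal]] by (simp add: poly_ring_def)
  then have "aeval cst (f_gen \<Delta> J) ` HT_class \<Delta> p = {aeval cst (f_gen \<Delta> J) p}"
    unfolding x by (auto simp: cst.aeval_add aeval_f_gen_SR_ideal image_image intro!: rev_image_eqI[of 0])
  then show ?thesis by (simp add: f_hom_def)
qed

end

section \<open>The expansion at a generic point\<close>

lemma mono_of_single:
  "finite K \<Longrightarrow> mono_of K = Poly_Mapping.single (\<Sum>i\<in>K. Poly_Mapping.single i 1) 1"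
  unfolding mono_of_def
  by (induction K rule: finite_induct) (simp_all add: var_def mult_single)

text \<open>A monomial is the squarefree monomial of its support times a monomial \<open>m'\<close> that records the
  repetitions.\<close>
lemma monomial_support:
  fixes m :: "'v \<Rightarrow>\<^sub>0 nat"
  defines "mK \<equiv> \<Sum>i\<in>Poly_Mapping.keys m. Poly_Mapping.single i 1"
  obtains m' where "m = mK + m'" "Poly_Mapping.keys mK = Poly_Mapping.keys m"
    "Poly_Mapping.keys m' \<subseteq> Poly_Mapping.keys m" "mdeg m = card (Poly_Mapping.keys m) + mdeg m'"
proof -
  have lk: "Poly_Mapping.lookup mK i = (if i \<in> Poly_Mapping.keys m then 1 else 0)" for i
  proof -
    have "Poly_Mapping.lookup mK i = (\<Sum>j\<in>Poly_Mapping.keys m. if j = i then 1 else 0)"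
      by (simp add: mK_def lookup_sum lookup_single when_def)
    also have "\<dots> = (if i \<in> Poly_Mapping.keys m then 1 else 0)" by simp
    finally show ?thesis .
  qed
  have keys: "Poly_Mapping.keys mK = Poly_Mapping.keys m" by (auto simp: in_keys_iff[of _ mK] lk split: if_splits)
  have m: "m = mK + (m - mK)"
    by (rule poly_mapping_eqI) (auto simp: lookup_add lookup_minus lk in_keys_iff)
  have "Poly_Mapping.keys (m - mK) \<subseteq> Poly_Mapping.keys m"
    by (auto simp: in_keys_iff lookup_minus)
  moreover have "mdeg mK = card (Poly_Mapping.keys m)" unfolding keys by (simp add: lk)
  then have "mdeg m = card (Poly_Mapping.keys m) + mdeg (m - mK)"
    using mdeg_add[of mK "m - mK"] m by simp
  ultimately show ?thesis using that m keys by blast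
qed

context
  fixes \<Delta> :: "(real ^ 'n::{finite,linorder}) set set" and k :: nat and ws :: "(rat ^ 'n::{finite,linorder}) list"
begin

text \<open>The value of \<open>\<mu>(p, J)\<close> at the plane with basis \<open>ws\<close>.\<close>
definition local_mu :: "(real ^ 'n::{finite,linorder}) set qpoly \<Rightarrow> (real ^ 'n::{finite,linorder}) set set \<Rightarrow> rat" where
  "local_mu p J = aeval id (weight \<Delta> J ws) p / aeval id (weight \<Delta> J ws) (mono_of J)"

definition expansion :: "(real ^ 'n::{finite,linorder}) set qpoly \<Rightarrow> (real ^ 'n::{finite,linorder}) set qpoly" where
  "expansion p = (\<Sum>J\<in>simplices_of_card \<Delta> k. cst (local_mu p J) * mono_of J)"

definition expands :: "(real ^ 'n::{finite,linorder}) set qpoly \<Rightarrow> bool" where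
  "expands p \<longleftrightarrow> p \<in> polys (rays \<Delta>) \<and> cls \<Delta> (p - expansion p) = cls \<Delta> 0"

context
  assumes fan: "complete_simplicial_fan \<Delta>" and len: "length ws = CARD('n) - k + 1"
    and nz: "\<And>J j. J \<in> simplices_of_card \<Delta> k \<Longrightarrow> j \<in> J \<Longrightarrow> weight \<Delta> J ws j \<noteq> 0"
begin

lemma fan': "simplicial_fan \<Delta>"
  using fan by (simp add: complete_simplicial_fan_def)

lemma finite_simplices_of_card: "finite (simplices_of_card \<Delta> k)"
  using finite_rays[OF fan'] simplex_rays[OF fan']
  by (intro finite_subset[of "simplices_of_card \<Delta> k" "Pow (rays \<Delta>)"]) (auto simp: simplices_of_card_def)

lemma simplices_of_card_rays: "J \<in> simplices_of_card \<Delta> k \<Longrightarrow> J \<subseteq> rays \<Delta>"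
  using simplex_rays[OF fan'] by (auto simp: simplices_of_card_def)

lemma expansion_polys: "expansion p \<in> polys (rays \<Delta>)"
  unfolding expansion_def using simplices_of_card_rays by (intro polys_intros mono_of_polys) auto

lemma expands_add:
  assumes "expands p" "expands q"
  shows "expands (p + q)"
proof -
  interpret C: cring "coh_ring \<Delta>" by (rule cring_coh)
  have "expansion (p + q) = expansion p + expansion q"
    by (simp add: expansion_def local_mu_def idq.aeval_add add_divide_distrib cst_simps distrib_right sum.distrib)
  then have eq: "p + q - expansion (p + q) = (p - expansion p) + (q - expansion q)" by simp
  have "cls \<Delta> ((p - expansion p) + (q - expansion q)) =
      cls \<Delta> (p - expansion p) \<oplus>\<^bsub>coh_ring \<Delta>\<^esub> cls \<Delta> (q - expansion q)"
    using assms by (intro cls_add polys_diff expansion_polys) (auto simp: expands_def)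
  also have "\<dots> = cls \<Delta> 0" using assms by (simp add: expands_def cls_0)
  finally show ?thesis using assms unfolding expands_def eq by (simp add: polys_add)
qed

lemma expands_cst_mult:
  assumes "expands p"
  shows "expands (cst c * p)"
proof -
  have "expansion (cst c * p) = cst c * expansion p"
    unfolding expansion_def local_mu_def idq.aeval_mult idq.aeval_cst sum_distrib_left
    by (simp add: cst_simps mult.assoc flip: times_divide_eq_right)
  then have "cst c * p - expansion (cst c * p) = (p - expansion p) * cst c" by (simp add: algebra_simps)
  moreover have "cls \<Delta> ((p - expansion p) * cst c) = cls \<Delta> 0"
    using assms by (intro cls_mult_zero) (auto simp: expands_def polys_diff expansion_polys polys_cst)
  ultimately show ?thesis using assms by (auto simp: expands_def polys_mult polys_cst)
qed

lemma expands_zero: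
  assumes "p \<in> polys (rays \<Delta>)" "cls \<Delta> p = cls \<Delta> 0"
    and "\<And>J. J \<in> simplices_of_card \<Delta> k \<Longrightarrow> aeval id (weight \<Delta> J ws) p = 0"
  shows "expands p"
proof -
  have "expansion p = 0" using assms(3) by (simp add: expansion_def local_mu_def cst_simps)
  with assms(1,2) show ?thesis by (simp add: expands_def)
qed

lemma expands_sum: "(\<And>a. a \<in> A \<Longrightarrow> expands (f a)) \<Longrightarrow> expands (sum f A)"
  by (induction A rule: infinite_finite_induct) (auto intro: expands_add expands_zero polys_0)

lemma expands_diff: "expands p \<Longrightarrow> expands q \<Longrightarrow> expands (p - q)"
  using expands_add[OF _ expands_cst_mult[of q "-1"], of p] by (simp add: cst_simps)

lemma aeval_weight_mono_of:
  assumes "J \<in> simplices_of_card \<Delta> k" "finite K" "\<not> K \<subseteq> J"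
  shows "aeval id (weight \<Delta> J ws) (mono_of K) = 0"
proof -
  obtain \<rho> where "\<rho> \<in> K" "\<rho> \<notin> J" using assms(3) by blast
  then show ?thesis using weight_outside[OF fan assms(1)] assms(2)
    unfolding mono_of_def idq.aeval_prod idq.aeval_var by (intro prod_zero) auto
qed

lemma expands_mono_of:
  assumes K: "K \<in> simplices_of_card \<Delta> k"
  shows "expands (mono_of K)"
proof -
  have fin: "finite J" if "J \<in> simplices_of_card \<Delta> k" for J
    using finite_subset[OF simplices_of_card_rays[OF that] finite_rays[OF fan']] .
  have ratio: "local_mu (mono_of K) J = (if J = K then 1 else 0)" if J: "J \<in> simplices_of_card \<Delta> k" for J
  proof (cases "J = K")
    case True
    have "aeval id (weight \<Delta> J ws) (mono_of J) \<noteq> 0"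
      unfolding mono_of_def idq.aeval_prod idq.aeval_var using nz[OF J] fin[OF J] by simp
    with True show ?thesis by (simp add: local_mu_def)
  next
    case False
    then have "\<not> K \<subseteq> J"
      using card_subset_eq[OF fin[OF J], of K] J K by (auto simp: simplices_of_card_def)
    then show ?thesis using aeval_weight_mono_of[OF J fin[OF K]] False by (simp add: local_mu_def)
  qed
  have "expansion (mono_of K) = (\<Sum>J\<in>simplices_of_card \<Delta> k. if J = K then mono_of K else 0)"
    unfolding expansion_def by (intro sum.cong refl) (simp add: ratio cst_simps)
  also have "\<dots> = mono_of K" using K finite_simplices_of_card by simp
  finally show ?thesis using mono_of_polys[OF simplices_of_card_rays[OF K]] by (simp add: expands_def)
qed

text \<open>A repeated variable \<open>x\<^sub>i\<close> of a monomial with support \<open>K\<close> is replaced, modulo the image of a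
  functional \<open>u\<close> with \<open>\<langle>u, v\<^sub>i\<rangle> = 1\<close> that vanishes on the other vertices of \<open>K\<close>, by variables outside
  \<open>K\<close>. When \<open>u\<close> also vanishes on the chosen plane, all \<open>f\<^sup>J\<close> annihilate that image at the plane, so
  both sides of the expansion change in the same way. This enlarges the support.\<close>
lemma expands_monomial:
  assumes "Poly_Mapping.keys m \<subseteq> rays \<Delta>" "mdeg m = k" and kn: "k \<le> CARD('n)"
  shows "expands (Poly_Mapping.single m 1)"
  using assms(1,2)
proof (induction "k - card (Poly_Mapping.keys m)" arbitrary: m rule: less_induct)
  case less
  let ?K = "Poly_Mapping.keys m"
  let ?mK = "\<Sum>i\<in>?K. Poly_Mapping.single i 1 :: (real ^ 'n::{finite,linorder}) set \<Rightarrow>\<^sub>0 nat"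
  obtain m' where m': "m = ?mK + m'" "Poly_Mapping.keys ?mK = ?K" "Poly_Mapping.keys m' \<subseteq> ?K"
    "mdeg m = card ?K + mdeg m'"
    by (rule monomial_support)
  have split: "Poly_Mapping.single m 1 = mono_of ?K * Poly_Mapping.single m' (1 :: rat)"
    using arg_cong[OF m'(1), of "\<lambda>m. Poly_Mapping.single m (1 :: rat)"]
    by (simp add: mono_of_single mult_single)
  have polys': "Poly_Mapping.single m' 1 \<in> polys (rays \<Delta>)"
    using m'(3) less.prems(1) by (intro polys_single) auto
  show ?case
  proof (cases "?K \<in> simplices \<Delta>")
    case False
    show ?thesis
    proof (rule expands_zero)
      show "Poly_Mapping.single m 1 \<in> polys (rays \<Delta>)" using less.prems(1) by (rule polys_single)
      show "cls \<Delta> (Poly_Mapping.single m 1) = cls \<Delta> 0"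
        unfolding split using less.prems(1) False polys'
        by (intro cls_mult_zero cls_mono_of_nonface mono_of_polys) auto
      fix J assume J: "J \<in> simplices_of_card \<Delta> k"
      then have "\<not> ?K \<subseteq> J" using False simplices_subset[OF fan', of J ?K] by (auto simp: simplices_of_card_def)
      then show "aeval id (weight \<Delta> J ws) (Poly_Mapping.single m 1) = 0"
        unfolding split idq.aeval_mult using aeval_weight_mono_of[OF J] by simp
    qed
  next
    case K: True
    show ?thesis
    proof (cases "mdeg m' = 0")
      case True
      then have "m' = 0" by (auto simp: in_keys_iff simp flip: keys_eq_empty)
      then have "Poly_Mapping.single m 1 = mono_of ?K" unfolding split by simp
      moreover have "?K \<in> simplices_of_card \<Delta> k"
        using K m'(4) True less.prems(2) by (simp add: simplices_of_card_def)
      ultimately show ?thesis using expands_mono_of by simp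
    next
      case False
      then obtain i where i: "i \<in> Poly_Mapping.keys m'" by (cases "m' = 0") (auto simp flip: keys_eq_empty)
      then have iK: "i \<in> ?K" using m'(3) by blast
      have m'': "m' = Poly_Mapping.single i 1 + (m' - Poly_Mapping.single i 1)"
        using i by (intro poly_mapping_eqI) (auto simp: lookup_add lookup_minus lookup_single when_def in_keys_iff)
      \<comment> \<open>\<open>l\<close> is the monomial \<open>m\<close> divided by \<open>x\<^sub>i\<close>; its support is still \<open>K\<close>.\<close>
      define l where "l = ?mK + (m' - Poly_Mapping.single i 1)"
      have l: "m = Poly_Mapping.single i 1 + l"
        unfolding l_def using m'(1) m'' by (metis add.left_commute)
      have keys_l: "Poly_Mapping.keys l = ?K"
      proof -
        have "Poly_Mapping.keys (m' - Poly_Mapping.single i 1) \<subseteq> Poly_Mapping.keys m'"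
          by (auto simp: in_keys_iff lookup_minus)
        then show ?thesis unfolding l_def keys_add_nat m'(2) using m'(3) by blast
      qed
      let ?y = "Poly_Mapping.single l (1 :: rat)"
      have var_y: "var \<rho> * ?y = Poly_Mapping.single (Poly_Mapping.single \<rho> 1 + l) 1" for \<rho>
        by (simp add: var_def mult_single)
      have y: "?y \<in> polys (rays \<Delta>)" using keys_l less.prems(1) by (intro polys_single) simp
      have "mdeg m' > 0" using False by (rule neq0_conv[THEN iffD1])
      then have "card ?K < k" using m'(4) less.prems(2) by linarith
      obtain J0 where J0: "J0 \<in> simplices_of_card \<Delta> k" "?K \<subseteq> J0"
        using simplex_extends[OF fan K less_imp_le[OF \<open>card ?K < k\<close>] kn] by blast
      have ne: "?K \<noteq> J0" using J0 \<open>card ?K < k\<close> by (auto simp: simplices_of_card_def)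
      obtain u where u: "\<forall>j\<in>?K. pairing u (ray_vec_rat j) = (if j = i then 1 else 0)"
        and uw: "\<forall>w\<in>set ws. pairing u w = 0"
        using exists_linear_relation[OF fan J0(1) J0(2) ne nz[OF J0(1)] len,
            where g = "\<lambda>j. if j = i then 1 else 0"] by blast
      have "expands (linear_class \<Delta> u * ?y)"
      proof (rule expands_zero)
        show "linear_class \<Delta> u * ?y \<in> polys (rays \<Delta>)" by (intro polys_mult linear_class_polys y)
        show "cls \<Delta> (linear_class \<Delta> u * ?y) = cls \<Delta> 0"
          by (intro cls_mult_zero linear_class_polys y cls_linear_class)
        fix J assume J: "J \<in> simplices_of_card \<Delta> k"
        have "aeval id (weight \<Delta> J ws) (linear_class \<Delta> u) =
            (\<Sum>\<rho>\<in>rays \<Delta>. pairing u (ray_vec_rat \<rho>) * weight \<Delta> J ws \<rho>)"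
          unfolding linear_class_def idq.aeval_sum idq.aeval_mult idq.aeval_cst idq.aeval_var by simp
        also have "\<dots> = contraction J ws u" by (rule sum_weight[OF fan J])
        also have "\<dots> = 0"
          using uw len length_M_basis_simplex[OF fan J] by (intro contraction_zero_on_plane) auto
        finally show "aeval id (weight \<Delta> J ws) (linear_class \<Delta> u * ?y) = 0" by (simp add: idq.aeval_mult)
      qed
      moreover have "expands (\<Sum>\<rho>\<in>rays \<Delta> - ?K. cst (pairing u (ray_vec_rat \<rho>)) * (var \<rho> * ?y))"
      proof (intro expands_sum expands_cst_mult)
        fix \<rho> assume \<rho>: "\<rho> \<in> rays \<Delta> - ?K"
        let ?n = "Poly_Mapping.single \<rho> 1 + l"
        have keys: "Poly_Mapping.keys ?n = insert \<rho> ?K" by (simp add: keys_add_nat keys_l)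
        have "card (Poly_Mapping.keys ?n) = Suc (card ?K)" unfolding keys using \<rho> by simp
        moreover have "mdeg ?n = mdeg m" unfolding mdeg_add l by simp
        ultimately have "expands (Poly_Mapping.single ?n 1)"
          using \<rho> less.prems \<open>card ?K < k\<close> keys by (intro less.hyps) auto
        then show "expands (var \<rho> * ?y)" unfolding var_y .
      qed
      moreover have "var i * ?y = linear_class \<Delta> u * ?y -
          (\<Sum>\<rho>\<in>rays \<Delta> - ?K. cst (pairing u (ray_vec_rat \<rho>)) * (var \<rho> * ?y))"
      proof -
        have "linear_class \<Delta> u * ?y = (\<Sum>\<rho>\<in>rays \<Delta>. cst (pairing u (ray_vec_rat \<rho>)) * (var \<rho> * ?y))"
          by (simp add: linear_class_def sum_distrib_right mult.assoc)
        also have "\<dots> = (\<Sum>\<rho>\<in>rays \<Delta> - ?K. cst (pairing u (ray_vec_rat \<rho>)) * (var \<rho> * ?y)) +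
            (\<Sum>\<rho>\<in>?K. cst (pairing u (ray_vec_rat \<rho>)) * (var \<rho> * ?y))"
          using less.prems(1) finite_rays[OF fan'] by (rule sum.subset_diff)
        also have "(\<Sum>\<rho>\<in>?K. cst (pairing u (ray_vec_rat \<rho>)) * (var \<rho> * ?y)) =
            (\<Sum>\<rho>\<in>?K. if \<rho> = i then var i * ?y else 0)"
          using u by (intro sum.cong) (auto simp: cst_simps)
        also have "\<dots> = var i * ?y" using iK by simp
        finally show ?thesis by simp
      qed
      ultimately have "expands (var i * ?y)" using expands_diff by simp
      then show ?thesis unfolding var_y l[symmetric] .
    qed
  qed
qed

lemma expands_homogeneous:
  assumes "p \<in> polys (rays \<Delta>)" "homogeneous k p" "k \<le> CARD('n)"
  shows "expands p"
proof -
  have "expands (Poly_Mapping.single m (Poly_Mapping.lookup p m))" if "m \<in> Poly_Mapping.keys p" for m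
  proof -
    have "expands (Poly_Mapping.single m 1)"
      using assms that by (intro expands_monomial) (auto simp: polys_def homogeneous_def)
    from expands_cst_mult[OF this, of "Poly_Mapping.lookup p m"] show ?thesis by (simp add: cst_mult_single)
  qed
  then show ?thesis by (subst qpoly_sum_monomials) (rule expands_sum)
qed

end

end

section \<open>The function field of the Grassmannian\<close>

text \<open>The vectors \<open>wedge ws\<close> of frames \<open>ws\<close> are the Pluecker coordinates of the points of the
  Grassmannian.\<close>
definition frame :: "nat \<Rightarrow> (rat ^ 'n) list \<Rightarrow> bool" where
  "frame m ws \<longleftrightarrow> length ws = m \<and> distinct ws \<and> vec.independent (set ws)"

lemma frame_indep_family: "frame m ws \<Longrightarrow> indep_family ((!) ws) {..<m}"
proof -
  assume ws: "frame m ws"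
  have "(!) ws ` {..<m} = set ws" using ws by (auto simp: frame_def set_conv_nth)
  then show ?thesis using ws by (auto simp: indep_family_iff frame_def inj_on_def distinct_conv_nth)
qed

text \<open>By the Cauchy--Binet formula, since a frame has a dual family of functionals.\<close>
lemma frame_iff_minor:
  fixes ws :: "(rat ^ 'n::{finite,linorder}) list"
  shows "frame m ws \<longleftrightarrow> length ws = m \<and> (\<exists>K. wedge ws K \<noteq> 0)"
proof (intro iffI conjI)
  assume ws: "frame m ws"
  show len: "length ws = m" using ws by (simp add: frame_def)
  have "\<exists>u. \<forall>j\<in>{..<m}. pairing u (ws ! j) = (if i = j then 1 else 0)" for i
    by (rule exists_dual_functional[OF frame_indep_family[OF ws]])
  then obtain u where u: "\<And>i j. j < m \<Longrightarrow> pairing (u i) (ws ! j) = (if i = j then 1 else 0)"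
    by (metis lessThan_iff)
  have "(\<Sum>K | card K = m. wedge (map u [0..<m]) K * wedge ws K) =
      det_fun m (\<lambda>i j. pairing (map u [0..<m] ! i) (ws ! j))"
    using len by (intro cauchy_binet) auto
  also have "\<dots> = det_fun m (\<lambda>i j. if i = j then 1 else 0)"
    by (intro det_fun_cong) (simp add: u)
  also have "\<dots> = 1" by (subst det_fun_upper_triangular) auto
  finally have "(\<Sum>K | card K = m. wedge (map u [0..<m]) K * wedge ws K) \<noteq> 0" by simp
  then show "\<exists>K. wedge ws K \<noteq> 0" by (metis (mono_tags, lifting) mult_zero_right sum.neutral)
next
  assume "length ws = m \<and> (\<exists>K. wedge ws K \<noteq> 0)"
  then obtain K where len: "length ws = m" and K: "wedge ws K \<noteq> 0" by blast
  have cK: "card K = length ws" using K by (auto simp: wedge_def split: if_splits)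
  have "indep_family ((!) ws) {..<m}"
    unfolding indep_family_def
  proof (intro conjI allI impI ballI)
    fix c t assume c: "(\<Sum>s<m. c s *s ws ! s) = 0" and t: "t \<in> {..<m}"
    show "c t = 0"
    proof (rule ccontr)
      assume "c t \<noteq> 0"
      have "(\<Sum>s<m. c s * ws ! s $ a) = 0" for a using arg_cong[OF c, of "\<lambda>w. w $ a"] by simp
      then have "wedge ws K = 0"
        unfolding wedge_eq_det_fun[OF cK] len using t \<open>c t \<noteq> 0\<close>
        by (intro det_fun_dependent_rows[of t m c]) auto
      with K show False ..
    qed
  qed simp
  then have "inj_on ((!) ws) {..<m}" "vec.independent ((!) ws ` {..<m})" by (auto simp: indep_family_iff)
  moreover have "(!) ws ` {..<m} = set ws" using len by (auto simp: set_conv_nth)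
  ultimately show "frame m ws" using len by (auto simp: frame_def distinct_conv_nth inj_on_def)
qed

lemma vanishes_on_G_iff:
  fixes P :: "'n::{finite,linorder} set qpoly"
  shows "vanishes_on_G m P \<longleftrightarrow> (\<forall>ws. frame m ws \<longrightarrow> aeval id (wedge ws) P = 0)"
proof
  assume v: "vanishes_on_G m P"
  show "\<forall>ws. frame m ws \<longrightarrow> aeval id (wedge ws) P = 0"
  proof (intro allI impI)
    fix ws :: "(rat ^ 'n::{finite,linorder}) list" assume ws: "frame m ws"
    have "vec.dim (vec.span (set ws)) = m"
      using ws vec.dim_eq_card_independent[of "set ws"] distinct_card[of ws] by (simp add: frame_def)
    then have "vec.span (set ws) \<in> grassmannian m" by (simp add: grassmannian_def)
    moreover have "wedge ws \<in> plucker (vec.span (set ws))" using ws by (auto simp: plucker_def frame_def)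
    ultimately show "aeval id (wedge ws) P = 0" using v by (auto simp: vanishes_on_G_def)
  qed
next
  assume *: "\<forall>ws. frame m ws \<longrightarrow> aeval id (wedge ws) P = 0"
  show "vanishes_on_G m P"
    unfolding vanishes_on_G_def
  proof (intro ballI)
    fix E :: "(rat ^ 'n::{finite,linorder}) set" and \<xi> assume E: "E \<in> grassmannian m" and "\<xi> \<in> plucker E"
    then obtain ws where ws: "\<xi> = wedge ws" "distinct ws" "vec.independent (set ws)" "vec.span (set ws) = E"
      by (auto simp: plucker_def)
    have "length ws = m"
      using E ws vec.dim_eq_card_independent[of "set ws"] distinct_card[of ws]
      by (auto simp: grassmannian_def)
    with ws * show "aeval id \<xi> P = 0" by (simp add: frame_def)
  qed
qed

definition polynomial_fun :: "(rat \<Rightarrow> rat) \<Rightarrow> bool" where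
  "polynomial_fun f \<longleftrightarrow> (\<exists>p. \<forall>t. f t = poly p t)"

lemma polynomial_fun_const: "polynomial_fun (\<lambda>t. c)"
  unfolding polynomial_fun_def by (intro exI[of _ "[:c:]"]) simp

lemma polynomial_fun_line: "polynomial_fun (\<lambda>t. a + t * b)"
  unfolding polynomial_fun_def by (intro exI[of _ "[:a, b:]"]) simp

lemma polynomial_fun_add:
  "polynomial_fun f \<Longrightarrow> polynomial_fun g \<Longrightarrow> polynomial_fun (\<lambda>t. f t + g t)"
  unfolding polynomial_fun_def by (metis poly_add)

lemma polynomial_fun_mult:
  "polynomial_fun f \<Longrightarrow> polynomial_fun g \<Longrightarrow> polynomial_fun (\<lambda>t. f t * g t)"
  unfolding polynomial_fun_def by (metis poly_mult)

lemma polynomial_fun_sum: "(\<And>a. a \<in> A \<Longrightarrow> polynomial_fun (f a)) \<Longrightarrow> polynomial_fun (\<lambda>t. \<Sum>a\<in>A. f a t)"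
  by (induction A rule: infinite_finite_induct) (auto intro: polynomial_fun_const polynomial_fun_add)

lemma polynomial_fun_prod: "(\<And>a. a \<in> A \<Longrightarrow> polynomial_fun (f a)) \<Longrightarrow> polynomial_fun (\<lambda>t. \<Prod>a\<in>A. f a t)"
  by (induction A rule: infinite_finite_induct) (auto intro: polynomial_fun_const polynomial_fun_mult)

lemma polynomial_fun_power: "polynomial_fun f \<Longrightarrow> polynomial_fun (\<lambda>t. f t ^ d)"
  by (induction d) (auto intro: polynomial_fun_const polynomial_fun_mult)

lemma polynomial_fun_nonzero_mult:
  assumes "polynomial_fun f" "polynomial_fun g" "f a \<noteq> 0" "g b \<noteq> 0"
  shows "\<exists>t. f t * g t \<noteq> 0"
proof -
  obtain p q where p: "\<And>t. f t = poly p t" and q: "\<And>t. g t = poly q t"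
    using assms(1,2) by (auto simp: polynomial_fun_def)
  have "p \<noteq> 0" "q \<noteq> 0" using assms(3,4) p q by auto
  then have "\<exists>t. poly (p * q) t \<noteq> 0" using poly_all_0_iff_0[of "p * q"] by auto
  then show ?thesis by (simp add: p q)
qed

text \<open>The rational points of the Grassmannian form an irreducible set: two frames are joined by a line
  in the space of matrices, along which minors and polynomials in them are polynomials in one
  variable.\<close>
lemma common_nonzero_frame:
  fixes P Q :: "'n::{finite,linorder} set qpoly"
  assumes a: "frame m xs" "aeval id (wedge xs) P \<noteq> 0" and b: "frame m ys" "aeval id (wedge ys) Q \<noteq> 0"
  shows "\<exists>ws. frame m ws \<and> aeval id (wedge ws) P \<noteq> 0 \<and> aeval id (wedge ws) Q \<noteq> 0"
proof -
  define ws where "ws t = map (\<lambda>i. xs ! i + t *s (ys ! i - xs ! i)) [0..<m]" for t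
  have len: "length xs = m" "length ys = m" using a b by (auto simp: frame_def)
  have ws0: "ws 0 = xs" and ws1: "ws 1 = ys" by (auto simp: ws_def list_eq_iff_nth_eq len)
  have wedge: "polynomial_fun (\<lambda>t. wedge (ws t) K)" for K
  proof (cases "card K = m")
    case True
    have "wedge (ws t) K = (\<Sum>\<pi> | \<pi> permutes {..<m}. of_int (sign \<pi>) *
        (\<Prod>i<m. xs ! i $ (sorted_list_of_set K ! \<pi> i) +
          t * (ys ! i - xs ! i) $ (sorted_list_of_set K ! \<pi> i)))" for t
      using True by (simp add: wedge_def ws_def right_diff_distrib)
    then show ?thesis
      by (simp only:) (intro polynomial_fun_sum polynomial_fun_mult polynomial_fun_const
        polynomial_fun_prod polynomial_fun_line)
  next
    case False
    then show ?thesis by (simp add: wedge_def ws_def polynomial_fun_const)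
  qed
  have evl: "polynomial_fun (\<lambda>t. aeval id (wedge (ws t)) R)" for R
    unfolding aeval_def
    by (intro polynomial_fun_sum polynomial_fun_mult polynomial_fun_const polynomial_fun_prod
        polynomial_fun_power wedge)
  \<comment> \<open>A minor of \<open>xs\<close> is a third factor, so that the vectors at the chosen point are a frame again.\<close>
  obtain K where K: "wedge xs K \<noteq> 0" using a(1) by (auto simp: frame_iff_minor)
  obtain s where s: "aeval id (wedge (ws s)) P * aeval id (wedge (ws s)) Q \<noteq> 0"
    using polynomial_fun_nonzero_mult[OF evl[of P] evl[of Q], of 0 1] a(2) b(2) ws0 ws1 by auto
  obtain t where "aeval id (wedge (ws t)) P * aeval id (wedge (ws t)) Q * wedge (ws t) K \<noteq> 0"
    using polynomial_fun_nonzero_mult[OF polynomial_fun_mult[OF evl[of P] evl[of Q]] wedge[of K], of s 0] s K ws0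
    by auto
  then show ?thesis by (intro exI[of _ "ws t"]) (auto simp: frame_iff_minor ws_def)
qed

lemma vanishes_on_G_mult:
  "vanishes_on_G m (P * Q) \<Longrightarrow> vanishes_on_G m P \<or> vanishes_on_G m Q"
  using common_nonzero_frame[of m _ P _ Q] by (fastforce simp: vanishes_on_G_iff idq.aeval_mult)

lemma not_vanishes_on_G_prod:
  assumes "finite A" "\<And>a. a \<in> A \<Longrightarrow> \<not> vanishes_on_G m (f a)" "\<not> vanishes_on_G m (1 :: 'n::{finite,linorder} set qpoly)"
  shows "\<not> vanishes_on_G m (prod f A :: 'n::{finite,linorder} set qpoly)"
  using assms by (induction rule: finite_induct) (auto dest: vanishes_on_G_mult)

lemma fractions_iff:
  "(P, Q) \<in> fractions m \<longleftrightarrow> P \<in> plucker_polys m \<and> Q \<in> plucker_polys m \<and>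
     (\<exists>d. homogeneous d P \<and> homogeneous d Q) \<and> \<not> vanishes_on_G m Q"
  by (simp add: fractions_def)

lemma fraction_rel_iff:
  "((P, Q), (P', Q')) \<in> fraction_rel m \<longleftrightarrow> (P, Q) \<in> fractions m \<and> (P', Q') \<in> fractions m \<and>
     (\<forall>ws. frame m ws \<longrightarrow> aeval id (wedge ws) P * aeval id (wedge ws) Q' =
        aeval id (wedge ws) P' * aeval id (wedge ws) Q)"
  by (auto simp: fraction_rel_def vanishes_on_G_iff idq.aeval_diff idq.aeval_mult)

text \<open>Transitivity cancels the middle denominator, which uses the irreducibility of the
  Grassmannian.\<close>
lemma equiv_fraction_rel: "equiv (fractions m) (fraction_rel m :: (('n::{finite,linorder} set qpoly \<times> _) \<times> _) set)"
proof (rule equivI)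
  show "fraction_rel m \<subseteq> fractions m \<times> (fractions m :: ('n::{finite,linorder} set qpoly \<times> _) set)" by (auto simp: fraction_rel_def)
  show "refl_on (fractions m) (fraction_rel m :: (('n::{finite,linorder} set qpoly \<times> _) \<times> _) set)"
    by (auto simp: refl_on_def fraction_rel_iff)
  show "sym (fraction_rel m :: (('n::{finite,linorder} set qpoly \<times> _) \<times> _) set)"
    by (auto simp: sym_def fraction_rel_iff)
  show "trans (fraction_rel m :: (('n::{finite,linorder} set qpoly \<times> _) \<times> _) set)"
  proof (rule transI, clarsimp simp only: split_paired_all)
    fix P Q P' Q' P'' Q'' :: "'n::{finite,linorder} set qpoly"
    assume 1: "((P, Q), P', Q') \<in> fraction_rel m" and 2: "((P', Q'), P'', Q'') \<in> fraction_rel m"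
    have "vanishes_on_G m ((P * Q'' - P'' * Q) * Q')"
      unfolding vanishes_on_G_iff
    proof (intro allI impI)
      fix ws :: "(rat ^ 'n::{finite,linorder}) list" assume ws: "frame m ws"
      let ?e = "aeval id (wedge ws)"
      have e1: "?e P * ?e Q' = ?e P' * ?e Q" and e2: "?e P' * ?e Q'' = ?e P'' * ?e Q'"
        using 1 2 ws unfolding fraction_rel_iff by blast+
      have "?e ((P * Q'' - P'' * Q) * Q') = (?e P * ?e Q') * ?e Q'' - (?e P'' * ?e Q') * ?e Q"
        unfolding idq.aeval_diff idq.aeval_mult by (simp add: algebra_simps)
      also have "\<dots> = 0" unfolding e1 e2[symmetric] by simp
      finally show "?e ((P * Q'' - P'' * Q) * Q') = 0" .
    qed
    moreover have "\<not> vanishes_on_G m Q'" using 1 by (simp add: fraction_rel_iff fractions_iff)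
    ultimately have "vanishes_on_G m (P * Q'' - P'' * Q)" using vanishes_on_G_mult by blast
    then show "((P, Q), P'', Q'') \<in> fraction_rel m" using 1 2 by (simp add: fraction_rel_def)
  qed
qed

lemma pullback_eq:
  assumes "((P, Q), (P', Q')) \<in> fraction_rel m"
  shows "pullback m P Q = pullback m P' Q'"
  unfolding pullback_def using equiv_fraction_rel assms by (rule equiv_class_eq)

lemma pullback_self: "(P, Q) \<in> fractions m \<Longrightarrow> (P, Q) \<in> pullback m P Q"
  unfolding pullback_def using equiv_fraction_rel by (rule equiv_class_self)

lemma Rat_G_carrierI: "(P, Q) \<in> fractions m \<Longrightarrow> pullback m P Q \<in> carrier (Rat_G m)"
  by (auto simp: Rat_G_def pullback_def intro: quotientI)

lemma Rat_G_carrierE: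
  assumes "X \<in> carrier (Rat_G m)"
  obtains P Q where "X = pullback m P Q" "(P, Q) \<in> fractions m"
  using assms by (auto simp: Rat_G_def pullback_def elim!: quotientE)

lemma fractions_add:
  fixes P Q P' Q' :: "'n::{finite,linorder} set qpoly"
  assumes "(P, Q) \<in> fractions m" "(P', Q') \<in> fractions m"
  shows "(P * Q' + P' * Q, Q * Q') \<in> fractions m"
proof -
  obtain d e where "homogeneous d P" "homogeneous d Q" "homogeneous e P'" "homogeneous e Q'"
    using assms by (auto simp: fractions_iff)
  then have "homogeneous (d + e) (P * Q' + P' * Q)" "homogeneous (d + e) (Q * Q')"
    using homogeneous_mult[of d Q e P'] by (auto intro!: homogeneous_add homogeneous_mult simp: mult.commute)
  then show ?thesis
    using assms vanishes_on_G_mult[of m Q Q']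
    by (auto simp: fractions_iff plucker_polys_def intro!: polys_intros)
qed

lemma fractions_smult: "(P, Q) \<in> fractions m \<Longrightarrow> (cst c * P, Q) \<in> fractions m"
  by (auto simp: fractions_iff plucker_polys_def intro!: polys_intros homogeneous_cst_mult)

lemma Rat_G_add:
  fixes P Q P' Q' :: "'n::{finite,linorder} set qpoly"
  assumes "(P, Q) \<in> fractions m" "(P', Q') \<in> fractions m"
  shows "pullback m P Q \<oplus>\<^bsub>Rat_G m\<^esub> pullback m P' Q' = pullback m (P * Q' + P' * Q) (Q * Q')"
proof -
  have *: "pullback m (R * S' + R' * S) (S * S') = pullback m (P * Q' + P' * Q) (Q * Q')"
    if "(R, S) \<in> pullback m P Q" "(R', S') \<in> pullback m P' Q'" for R S R' S'
  proof (rule pullback_eq)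
    have 1: "((P, Q), (R, S)) \<in> fraction_rel m" and 2: "((P', Q'), (R', S')) \<in> fraction_rel m"
      using that by (auto simp: pullback_def)
    then have "(R, S) \<in> fractions m" "(R', S') \<in> fractions m" by (auto simp: fraction_rel_def)
    then have "(R * S' + R' * S, S * S') \<in> fractions m" by (rule fractions_add)
    moreover have "aeval id (wedge ws) (R * S' + R' * S) * aeval id (wedge ws) (Q * Q') =
        aeval id (wedge ws) (P * Q' + P' * Q) * aeval id (wedge ws) (S * S')" if ws: "frame m ws" for ws
    proof -
      let ?e = "aeval id (wedge ws)"
      have e1: "?e P * ?e S = ?e R * ?e Q" and e2: "?e P' * ?e S' = ?e R' * ?e Q'"
        using 1 2 ws unfolding fraction_rel_iff by blast+
      have "?e (R * S' + R' * S) * ?e (Q * Q') = (?e R * ?e Q) * (?e S' * ?e Q') + (?e R' * ?e Q') * (?e S * ?e Q)"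
        unfolding idq.aeval_add idq.aeval_mult by (simp add: algebra_simps)
      also have "\<dots> = ?e (P * Q' + P' * Q) * ?e (S * S')"
        unfolding e1[symmetric] e2[symmetric] idq.aeval_add idq.aeval_mult by (simp add: algebra_simps)
      finally show ?thesis .
    qed
    ultimately show "((R * S' + R' * S, S * S'), (P * Q' + P' * Q, Q * Q')) \<in> fraction_rel m"
      using fractions_add[OF assms] unfolding fraction_rel_iff by blast
  qed
  have "(\<Union>(R, S)\<in>pullback m P Q. \<Union>(R', S')\<in>pullback m P' Q'. pullback m (R * S' + R' * S) (S * S')) =
      (\<Union>x\<in>pullback m P Q. \<Union>y\<in>pullback m P' Q'. pullback m (P * Q' + P' * Q) (Q * Q'))"
    by (intro SUP_cong refl) (auto simp only: split_paired_all split_conv *)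
  also have "\<dots> = pullback m (P * Q' + P' * Q) (Q * Q')"
    using pullback_self[OF assms(1)] pullback_self[OF assms(2)] by auto
  finally show ?thesis by (simp add: Rat_G_def)
qed

lemma Rat_G_smult:
  fixes P Q :: "'n::{finite,linorder} set qpoly"
  assumes "(P, Q) \<in> fractions m"
  shows "c \<odot>\<^bsub>Rat_G m\<^esub> pullback m P Q = pullback m (cst c * P) Q"
proof -
  have *: "pullback m (cst c * R) S = pullback m (cst c * P) Q" if "(R, S) \<in> pullback m P Q" for R S
  proof (rule pullback_eq)
    have 1: "((P, Q), (R, S)) \<in> fraction_rel m" using that by (auto simp: pullback_def)
    then have "(cst c * R, S) \<in> fractions m" by (auto simp: fraction_rel_def intro: fractions_smult)
    then show "((cst c * R, S), (cst c * P, Q)) \<in> fraction_rel m"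
      using 1 fractions_smult[OF assms, of c]
      by (simp add: fraction_rel_iff idq.aeval_mult)
  qed
  have "(\<Union>(R, S)\<in>pullback m P Q. pullback m (cst c * R) S) =
      (\<Union>x\<in>pullback m P Q. pullback m (cst c * P) Q)"
    by (intro SUP_cong refl) (auto simp only: split_paired_all split_conv *)
  also have "\<dots> = pullback m (cst c * P) Q" using pullback_self[OF assms] by auto
  finally show ?thesis by (simp add: Rat_G_def)
qed

lemma Rat_G_add_same_denominator:
  fixes P P' D :: "'n::{finite,linorder} set qpoly"
  assumes "(P, D) \<in> fractions m" "(P', D) \<in> fractions m" "(P + P', D) \<in> fractions m"
  shows "pullback m P D \<oplus>\<^bsub>Rat_G m\<^esub> pullback m P' D = pullback m (P + P') D"
  unfolding Rat_G_add[OF assms(1,2)]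
  using fractions_add[OF assms(1,2)] assms(3)
  by (intro pullback_eq) (simp add: fraction_rel_iff idq.aeval_mult idq.aeval_add algebra_simps)

section \<open>Tensor products\<close>

text \<open>Closedness of the carriers is all that the bilinearity relations require to live in the free
  abelian group.\<close>
locale tensor_setting =
  fixes A :: "('r, 'a) module" and B :: "('r, 'b) module"
  assumes A_add: "\<And>a a'. a \<in> carrier A \<Longrightarrow> a' \<in> carrier A \<Longrightarrow> a \<oplus>\<^bsub>A\<^esub> a' \<in> carrier A"
    and A_smult: "\<And>c a. a \<in> carrier A \<Longrightarrow> c \<odot>\<^bsub>A\<^esub> a \<in> carrier A"
    and B_add: "\<And>b b'. b \<in> carrier B \<Longrightarrow> b' \<in> carrier B \<Longrightarrow> b \<oplus>\<^bsub>B\<^esub> b' \<in> carrier B"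
    and B_smult: "\<And>c b. b \<in> carrier B \<Longrightarrow> c \<odot>\<^bsub>B\<^esub> b \<in> carrier B"
begin

abbreviation "F \<equiv> free_Abelian_group (carrier A \<times> carrier B)"

lemma tensor_kernel_normal: "tensor_kernel A B \<lhd> F"
proof -
  interpret F: comm_group F by (rule abelian_free_Abelian_group)
  have "tensor_relations A B \<subseteq> carrier F"
    unfolding tensor_relations_def
    using A_add A_smult B_add B_smult
    by (auto simp: keys_frag_of dest!: subsetD[OF keys_diff])
  then show ?thesis unfolding tensor_kernel_def
    by (intro F.subgroup_imp_normal F.generate_is_subgroup)
qed

sublocale normal "tensor_kernel A B" F by (rule tensor_kernel_normal)

lemma comm_group_tensor_product: "comm_group (tensor_product A B)"
  unfolding tensor_product_def
  by (rule comm_group.abelian_FactGroup[OF abelian_free_Abelian_group subgroup_axioms])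

sublocale T: comm_group "tensor_product A B" by (rule comm_group_tensor_product)

definition coset :: "(('a \<times> 'b) \<Rightarrow>\<^sub>0 int) \<Rightarrow> (('a \<times> 'b) \<Rightarrow>\<^sub>0 int) set" where
  "coset z = tensor_kernel A B #>\<^bsub>F\<^esub> z"

lemma coset_add:
  "y \<in> carrier F \<Longrightarrow> z \<in> carrier F \<Longrightarrow> coset (y + z) = coset y \<otimes>\<^bsub>tensor_product A B\<^esub> coset z"
  using rcos_sum[of y z] by (simp add: coset_def tensor_product_def)

lemma coset_closed: "z \<in> carrier F \<Longrightarrow> coset z \<in> carrier (tensor_product A B)"
  by (auto simp: coset_def tensor_product_def FactGroup_def RCOSETS_def)

lemma coset_relation:
  assumes "y \<in> carrier F" "z \<in> carrier F" "y - z \<in> tensor_relations A B"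
  shows "coset y = coset z"
proof -
  have r: "y - z \<in> tensor_kernel A B"
    unfolding tensor_kernel_def by (rule generate.incl[OF assms(3)])
  then have rF: "y - z \<in> carrier F" by (rule mem_carrier)
  have "coset (y - z) = tensor_kernel A B" unfolding coset_def using rcos_const r by blast
  then have "coset (y - z) = \<one>\<^bsub>tensor_product A B\<^esub>" by (simp add: tensor_product_def FactGroup_def)
  moreover have "coset y = coset (y - z) \<otimes>\<^bsub>tensor_product A B\<^esub> coset z"
    using coset_add[OF rF assms(2)] by simp
  ultimately show ?thesis using coset_closed[OF assms(2)] by simp
qed

lemma tensor_coset: "tensor A B a b = coset (frag_of (a, b))"
  by (simp add: tensor_def coset_def)

lemma frag_of_carrier: "a \<in> carrier A \<Longrightarrow> b \<in> carrier B \<Longrightarrow> frag_of (a, b) \<in> carrier F"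
  by simp

lemma tensor_closed:
  "a \<in> carrier A \<Longrightarrow> b \<in> carrier B \<Longrightarrow> tensor A B a b \<in> carrier (tensor_product A B)"
  unfolding tensor_coset by (intro coset_closed frag_of_carrier)

lemma carrier_F_add: "y \<in> carrier F \<Longrightarrow> z \<in> carrier F \<Longrightarrow> y + z \<in> carrier F"
  using m_closed[of y z] by simp

lemma tensor_add_left:
  assumes "a \<in> carrier A" "a' \<in> carrier A" "b \<in> carrier B"
  shows "tensor A B (a \<oplus>\<^bsub>A\<^esub> a') b = tensor A B a b \<otimes>\<^bsub>tensor_product A B\<^esub> tensor A B a' b"
proof -
  have "coset (frag_of (a \<oplus>\<^bsub>A\<^esub> a', b)) = coset (frag_of (a, b) + frag_of (a', b))"
  proof (rule coset_relation)
    show "frag_of (a \<oplus>\<^bsub>A\<^esub> a', b) - (frag_of (a, b) + frag_of (a', b)) \<in> tensor_relations A B"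
      unfolding tensor_relations_def diff_diff_add[symmetric] using assms by blast
  qed (use assms A_add in \<open>auto intro!: carrier_F_add frag_of_carrier simp del: carrier_free_Abelian_group_iff\<close>)
  then show ?thesis unfolding tensor_coset using assms by (simp only: coset_add frag_of_carrier)
qed

lemma tensor_add_right:
  assumes "a \<in> carrier A" "b \<in> carrier B" "b' \<in> carrier B"
  shows "tensor A B a (b \<oplus>\<^bsub>B\<^esub> b') = tensor A B a b \<otimes>\<^bsub>tensor_product A B\<^esub> tensor A B a b'"
proof -
  have "coset (frag_of (a, b \<oplus>\<^bsub>B\<^esub> b')) = coset (frag_of (a, b) + frag_of (a, b'))"
  proof (rule coset_relation)
    show "frag_of (a, b \<oplus>\<^bsub>B\<^esub> b') - (frag_of (a, b) + frag_of (a, b')) \<in> tensor_relations A B"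
      unfolding tensor_relations_def diff_diff_add[symmetric] using assms by blast
  qed (use assms B_add in \<open>auto intro!: carrier_F_add frag_of_carrier simp del: carrier_free_Abelian_group_iff\<close>)
  then show ?thesis unfolding tensor_coset using assms by (simp only: coset_add frag_of_carrier)
qed

lemma tensor_smult:
  assumes "a \<in> carrier A" "b \<in> carrier B"
  shows "tensor A B (c \<odot>\<^bsub>A\<^esub> a) b = tensor A B a (c \<odot>\<^bsub>B\<^esub> b)"
  unfolding tensor_coset
proof (rule coset_relation)
  show "frag_of (c \<odot>\<^bsub>A\<^esub> a, b) - frag_of (a, c \<odot>\<^bsub>B\<^esub> b) \<in> tensor_relations A B"
    unfolding tensor_relations_def using assms by blast
qed (use assms A_smult B_smult in \<open>auto intro!: frag_of_carrier simp del: carrier_free_Abelian_group_iff\<close>)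

text \<open>In this form \<open>0 \<otimes> b = 0\<close> and \<open>a \<otimes> 0 = 0\<close> refer only to the addition of the modules.\<close>
lemma tensor_idempotent_left:
  assumes "a \<in> carrier A" "b \<in> carrier B" "a \<oplus>\<^bsub>A\<^esub> a = a"
  shows "tensor A B a b = \<one>\<^bsub>tensor_product A B\<^esub>"
  using tensor_add_left[OF assms(1,1,2)] tensor_closed[OF assms(1,2)] assms(3) T.l_cancel_one by metis

lemma tensor_idempotent_right:
  assumes "a \<in> carrier A" "b \<in> carrier B" "b \<oplus>\<^bsub>B\<^esub> b = b"
  shows "tensor A B a b = \<one>\<^bsub>tensor_product A B\<^esub>"
  using tensor_add_right[OF assms(1,2,2)] tensor_closed[OF assms(1,2)] assms(3) T.l_cancel_one by metis

end

section \<open>Relations in the tensor product from relations at generic points\<close>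

lemma tensor_setting_Rat_G_H_deg:
  "tensor_setting (Rat_G m :: (rat, ('n::{finite,linorder} set qpoly \<times> _) set) module) (H_deg \<Delta> k)"
proof
  fix X Y :: "('n set qpoly \<times> 'n set qpoly) set"
  assume X: "X \<in> carrier (Rat_G m)" and Y: "Y \<in> carrier (Rat_G m)"
  obtain P Q where P: "X = pullback m P Q" "(P, Q) \<in> fractions m" by (rule Rat_G_carrierE[OF X])
  obtain P' Q' where P': "Y = pullback m P' Q'" "(P', Q') \<in> fractions m" by (rule Rat_G_carrierE[OF Y])
  show "X \<oplus>\<^bsub>Rat_G m\<^esub> Y \<in> carrier (Rat_G m)"
    using P P' by (simp add: Rat_G_add Rat_G_carrierI fractions_add)
next
  fix c and X :: "('n set qpoly \<times> 'n set qpoly) set"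
  assume X: "X \<in> carrier (Rat_G m)"
  obtain P Q where P: "X = pullback m P Q" "(P, Q) \<in> fractions m" by (rule Rat_G_carrierE[OF X])
  show "c \<odot>\<^bsub>Rat_G m\<^esub> X \<in> carrier (Rat_G m)"
    using P by (simp add: Rat_G_smult Rat_G_carrierI fractions_smult)
next
  fix y z assume "y \<in> carrier (H_deg \<Delta> k)" "z \<in> carrier (H_deg \<Delta> k)"
  then show "y \<oplus>\<^bsub>H_deg \<Delta> k\<^esub> z \<in> carrier (H_deg \<Delta> k)"
    by (auto simp: H_deg_simps(1) H_deg_add intro!: imageI polys_add homogeneous_add)
next
  fix c z assume "z \<in> carrier (H_deg \<Delta> k)"
  then show "c \<odot>\<^bsub>H_deg \<Delta> k\<^esub> z \<in> carrier (H_deg \<Delta> k)"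
    by (auto simp: H_deg_simps(1) H_deg_smult intro!: imageI polys_mult polys_cst homogeneous_cst_mult)
qed

context
  fixes \<Delta> :: "(real ^ 'n::{finite,linorder}) set set" and k m :: nat
begin

interpretation tensor_setting
  "Rat_G m :: (rat, ('n::{finite,linorder} set qpoly \<times> 'n::{finite,linorder} set qpoly) set) module" "H_deg \<Delta> k"
  by (rule tensor_setting_Rat_G_H_deg)

abbreviation (input) "function_field \<equiv> Rat_G m :: (rat, ('n::{finite,linorder} set qpoly \<times> 'n::{finite,linorder} set qpoly) set) module"
abbreviation (input) "degree_part \<equiv> H_deg \<Delta> k"
abbreviation (input) "forms \<equiv> {q \<in> polys (rays \<Delta>). homogeneous k q}"

lemma forms_mult_cst: "q \<in> forms \<Longrightarrow> cst c * q \<in> forms"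
  by (auto intro: polys_mult polys_cst homogeneous_cst_mult)

lemma forms_sum: "(\<And>i. i \<in> A \<Longrightarrow> f i \<in> forms) \<Longrightarrow> sum f A \<in> forms"
  by (auto intro: polys_sum homogeneous_sum)

lemma cls_forms: "q \<in> forms \<Longrightarrow> cls \<Delta> q \<in> carrier degree_part"
  by (simp add: H_deg_simps)

lemma tensor_cls_sum:
  assumes X: "X \<in> carrier function_field" and "finite A" "\<And>i. i \<in> A \<Longrightarrow> f i \<in> forms"
  shows "tensor function_field degree_part X (cls \<Delta> (sum f A)) = finprod (tensor_product function_field degree_part) (\<lambda>i. tensor function_field degree_part X (cls \<Delta> (f i))) A"
  using assms(2,3)
proof (induction A rule: finite_induct)
  case empty
  have z: "0 \<in> forms" by (simp add: polys_0 homogeneous_0)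
  then have "cls \<Delta> 0 \<oplus>\<^bsub>degree_part\<^esub> cls \<Delta> 0 = cls \<Delta> 0" by (simp add: H_deg_add)
  then show ?case using tensor_idempotent_right[OF X cls_forms[OF z]] by simp
next
  case (insert i A)
  have fi: "f i \<in> forms" using insert.prems by simp
  have fA: "sum f A \<in> forms" by (rule forms_sum) (rule insert.prems, simp)
  have "cls \<Delta> (sum f (insert i A)) = cls \<Delta> (f i) \<oplus>\<^bsub>degree_part\<^esub> cls \<Delta> (sum f A)"
    using insert.hyps fi fA by (simp add: H_deg_add)
  then have "tensor function_field degree_part X (cls \<Delta> (sum f (insert i A))) =
      tensor function_field degree_part X (cls \<Delta> (f i)) \<otimes>\<^bsub>tensor_product function_field degree_part\<^esub> tensor function_field degree_part X (cls \<Delta> (sum f A))"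
    using tensor_add_right[OF X cls_forms[OF fi] cls_forms[OF fA]] by simp
  also have "\<dots> = finprod (tensor_product function_field degree_part) (\<lambda>i. tensor function_field degree_part X (cls \<Delta> (f i))) (insert i A)"
    using insert X by (subst T.finprod_insert) (auto intro!: tensor_closed cls_forms)
  finally show ?case .
qed

text \<open>If the \<open>q\<^sub>i\<close> satisfy a linear relation over \<open>\<rat>\<close>, it expresses one of them by the others, and
  moving the rational coefficients across the tensor sign leaves a sum with fewer terms. If there is
  none, the given relations force each \<open>P\<^sub>i\<close> to vanish at every point where \<open>D\<close> does not, so
  \<open>P\<^sub>i / D = 0\<close>.\<close>
lemma tensor_relation_from_points:
  fixes P :: "'i \<Rightarrow> 'n::{finite,linorder} set qpoly" and D :: "'n::{finite,linorder} set qpoly"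
  assumes "finite A"
    and D: "D \<in> plucker_polys m" "homogeneous d D" "\<not> vanishes_on_G m D"
    and "\<And>i. i \<in> A \<Longrightarrow> P i \<in> plucker_polys m \<and> homogeneous d (P i)"
    and "\<And>i. i \<in> A \<Longrightarrow> q i \<in> forms"
    and "\<And>ws. frame m ws \<Longrightarrow> aeval id (wedge ws) D \<noteq> 0 \<Longrightarrow>
      cls \<Delta> (\<Sum>i\<in>A. cst (aeval id (wedge ws) (P i)) * q i) = cls \<Delta> 0"
  shows "finprod (tensor_product function_field degree_part) (\<lambda>i. tensor function_field degree_part (pullback m (P i) D) (cls \<Delta> (q i))) A =
    \<one>\<^bsub>tensor_product function_field degree_part\<^esub>"
  using assms(1,5-7)
proof (induction "card A" arbitrary: A P rule: less_induct)
  case less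
  have frac: "(S, D) \<in> fractions m" if "S \<in> plucker_polys m \<and> homogeneous d S" for S
    using that D by (auto simp: fractions_iff)
  have PD: "(P i, D) \<in> fractions m" if "i \<in> A" for i using less.prems(2)[OF that] by (rule frac)
  have qpoly: "q i \<in> polys (rays \<Delta>)" if "i \<in> A" for i using less.prems(3)[OF that] by simp
  let ?t = "\<lambda>S i. tensor function_field degree_part (pullback m S D) (cls \<Delta> (q i))"
  have closed: "?t S i \<in> carrier (tensor_product function_field degree_part)" if "(S, D) \<in> fractions m" "i \<in> A" for S i
    using that less.prems(3) by (intro tensor_closed Rat_G_carrierI cls_forms)
  show ?case
  proof (cases "\<exists>c. cls \<Delta> (\<Sum>i\<in>A. cst (c i) * q i) = cls \<Delta> 0 \<and> (\<exists>j\<in>A. c j \<noteq> 0)")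
    case False
    have "?t (P i) i = \<one>\<^bsub>tensor_product function_field degree_part\<^esub>" if i: "i \<in> A" for i
    proof -
      have zero: "aeval id (wedge ws) (P i) = 0" if "frame m ws" "aeval id (wedge ws) D \<noteq> 0" for ws
        using spec[OF False[unfolded not_ex], of "\<lambda>i. aeval id (wedge ws) (P i)"] less.prems(4)[OF that] i
        by simp
      have f0: "(0, D) \<in> fractions m" by (rule frac) (simp add: plucker_polys_def polys_0 homogeneous_0)
      have "pullback m (P i) D = pullback m 0 D"
        using PD[OF i] f0 zero by (intro pullback_eq) (auto simp: fraction_rel_iff)
      moreover have "pullback m 0 D \<oplus>\<^bsub>function_field\<^esub> pullback m 0 D = pullback m 0 D"
        using Rat_G_add_same_denominator[OF f0 f0] f0 by simp
      ultimately show ?thesis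
        using tensor_idempotent_left[OF Rat_G_carrierI[OF f0] cls_forms[OF less.prems(3)[OF i]]] by simp
    qed
    then show ?thesis by (intro T.finprod_one_eqI) auto
  next
    case True
    then obtain c j where c: "cls \<Delta> (\<Sum>i\<in>A. cst (c i) * q i) = cls \<Delta> 0" and j: "j \<in> A" "c j \<noteq> 0"
      by blast
    let ?B = "A - {j}"
    define b where "b i = - c i / c j" for i
    define r where "r = (\<Sum>i\<in>?B. cst (b i) * q i)"
    have r: "r \<in> polys (rays \<Delta>)" unfolding r_def using qpoly by (intro polys_intros) auto
    have finB: "finite ?B" using less.prems(1) by simp
    have split: "sum f A = f j + sum f ?B" for f :: "'i \<Rightarrow> (real ^ 'n::{finite,linorder}) set qpoly"
      using less.prems(1) j(1) by (rule sum.remove)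
    have "q j - r = (\<Sum>i\<in>A. cst (c i) * q i) * cst (1 / c j)"
    proof -
      have b: "cst (b i) = - (cst (c i) * cst (1 / c j))" for i :: 'i
        by (simp add: b_def flip: cst_simps(4,6))
      have r': "r = - (\<Sum>i\<in>?B. cst (c i) * cst (1 / c j) * q i)"
        unfolding r_def b by (simp add: sum_negf)
      have "(\<Sum>i\<in>A. cst (c i) * q i) * cst (1 / c j) =
          cst (c j) * cst (1 / c j) * q j + (\<Sum>i\<in>?B. cst (c i) * cst (1 / c j) * q i)"
        unfolding split by (simp only: distrib_right sum_distrib_right) (simp only: mult_ac)
      moreover have "cst (c j) * cst (1 / c j) = (1 :: (real ^ 'n::{finite,linorder}) set qpoly)"
        using j(2) by (simp add: cst_simps(2) flip: cst_simps(4))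
      ultimately show ?thesis unfolding r' by (simp only: mult_1_left diff_minus_eq_add)
    qed
    then have "cls \<Delta> (q j - r) = cls \<Delta> 0"
      using c qpoly by (simp only:) (intro cls_mult_zero polys_intros, auto)
    then have qj: "cls \<Delta> (q j) = cls \<Delta> r" using cls_diff_zero_iff[OF qpoly[OF j(1)] r] by simp
    \<comment> \<open>Eliminating \<open>q\<^sub>j = \<Sum>\<^sub>i b\<^sub>i q\<^sub>i\<close> adds \<open>b\<^sub>i\<close> times the coefficient of \<open>q\<^sub>j\<close> to that of \<open>q\<^sub>i\<close>.\<close>
    define P' where "P' i = P i + cst (b i) * P j" for i
    have P': "P' i \<in> plucker_polys m \<and> homogeneous d (P' i)" if "i \<in> ?B" for i
      unfolding P'_def using less.prems(2)[of i] less.prems(2)[OF j(1)] that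
      by (auto simp: plucker_polys_def intro!: polys_intros homogeneous_add homogeneous_cst_mult)
    have bP: "(cst (b i) * P j, D) \<in> fractions m" for i using PD[OF j(1)] by (rule fractions_smult)
    have "?t (P j) j = finprod (tensor_product function_field degree_part) (\<lambda>i. tensor function_field degree_part (pullback m (P j) D) (cls \<Delta> (cst (b i) * q i))) ?B"
      unfolding qj r_def using finB less.prems(3)
      by (intro tensor_cls_sum Rat_G_carrierI PD j(1) forms_mult_cst) auto
    also have "\<dots> = finprod (tensor_product function_field degree_part) (\<lambda>i. ?t (cst (b i) * P j) i) ?B"
    proof (rule T.finprod_cong'[OF refl])
      show "(\<lambda>i. ?t (cst (b i) * P j) i) \<in> ?B \<rightarrow> carrier (tensor_product function_field degree_part)" using closed[OF bP] by auto
      fix i assume i: "i \<in> ?B"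
      then have "tensor function_field degree_part (b i \<odot>\<^bsub>function_field\<^esub> pullback m (P j) D) (cls \<Delta> (q i)) =
          tensor function_field degree_part (pullback m (P j) D) (b i \<odot>\<^bsub>degree_part\<^esub> cls \<Delta> (q i))"
        using less.prems(3) by (intro tensor_smult Rat_G_carrierI PD j(1) cls_forms) auto
      then show "tensor function_field degree_part (pullback m (P j) D) (cls \<Delta> (cst (b i) * q i)) = ?t (cst (b i) * P j) i"
        using i qpoly PD[OF j(1)] by (simp add: Rat_G_smult H_deg_smult)
    qed
    finally have tj: "?t (P j) j = finprod (tensor_product function_field degree_part) (\<lambda>i. ?t (cst (b i) * P j) i) ?B" .
    have "finprod (tensor_product function_field degree_part) (\<lambda>i. ?t (P i) i) A =
        ?t (P j) j \<otimes>\<^bsub>tensor_product function_field degree_part\<^esub> finprod (tensor_product function_field degree_part) (\<lambda>i. ?t (P i) i) ?B"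
      using T.finprod_insert[OF finB, of j "\<lambda>i. ?t (P i) i"] closed[OF PD] j(1)
      by (simp add: insert_absorb Pi_def)
    also have "\<dots> = finprod (tensor_product function_field degree_part)
        (\<lambda>i. ?t (cst (b i) * P j) i \<otimes>\<^bsub>tensor_product function_field degree_part\<^esub> ?t (P i) i) ?B"
      unfolding tj using closed[OF bP] closed[OF PD] by (intro T.finprod_multf[symmetric]) auto
    also have "\<dots> = finprod (tensor_product function_field degree_part) (\<lambda>i. ?t (P' i) i) ?B"
    proof (rule T.finprod_cong'[OF refl])
      show "(\<lambda>i. ?t (P' i) i) \<in> ?B \<rightarrow> carrier (tensor_product function_field degree_part)"
        using closed[OF frac[OF P']] by auto
      fix i assume i: "i \<in> ?B"
      then have iA: "i \<in> A" by simp
      have eq: "cst (b i) * P j + P i = P' i" by (simp add: P'_def add.commute)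
      have "pullback m (P' i) D = pullback m (cst (b i) * P j) D \<oplus>\<^bsub>function_field\<^esub> pullback m (P i) D"
        using Rat_G_add_same_denominator[OF bP[of i] PD[OF iA]] frac[OF P'[OF i]] unfolding eq by simp
      then show "?t (cst (b i) * P j) i \<otimes>\<^bsub>tensor_product function_field degree_part\<^esub> ?t (P i) i = ?t (P' i) i"
        using tensor_add_left[OF Rat_G_carrierI[OF bP[of i]] Rat_G_carrierI[OF PD[OF iA]]
            cls_forms[OF less.prems(3)[OF iA]]] by simp
    qed
    also have "\<dots> = \<one>\<^bsub>tensor_product function_field degree_part\<^esub>"
    proof (rule less.hyps)
      show "card ?B < card A" using less.prems(1) j(1) by (rule card_Diff1_less)
      fix ws :: "(rat ^ 'n::{finite,linorder}) list"
      assume ws: "frame m ws" "aeval id (wedge ws) D \<noteq> 0"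
      let ?e = "aeval id (wedge ws)"
      let ?s = "\<Sum>i\<in>?B. cst (?e (P' i)) * q i" and ?u = "\<Sum>i\<in>A. cst (?e (P i)) * q i"
      have "?s = (\<Sum>i\<in>?B. cst (?e (P i)) * q i) + r * cst (?e (P j))"
        unfolding P'_def r_def idq.aeval_add idq.aeval_mult idq.aeval_cst
        by (simp only: cst_simps distrib_right sum.distrib sum_distrib_right)
          (simp only: mult_ac id_apply)
      then have "?u - ?s = (q j - r) * cst (?e (P j))"
        unfolding split by (simp add: algebra_simps)
      moreover have "cls \<Delta> ((q j - r) * cst (?e (P j))) = cls \<Delta> 0"
        using \<open>cls \<Delta> (q j - r) = cls \<Delta> 0\<close> qpoly[OF j(1)] r by (intro cls_mult_zero polys_intros)
      moreover have "?s \<in> polys (rays \<Delta>)" "?u \<in> polys (rays \<Delta>)" using qpoly by (auto intro!: polys_intros)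
      ultimately have "cls \<Delta> ?u = cls \<Delta> ?s" using cls_diff_zero_iff[of ?u \<Delta> ?s] by simp
      then show "cls \<Delta> ?s = cls \<Delta> 0" using less.prems(4)[OF ws] by simp
    qed (use finB P' less.prems(3) in auto)
    finally show ?thesis .
  qed
qed

end

section \<open>The expansion in the tensor product\<close>

lemma aeval_f_gen_eq_weight:
  fixes \<Delta> :: "(real ^ 'n::{finite,linorder}) set set"
  assumes "complete_simplicial_fan \<Delta>" "J \<in> simplices_of_card \<Delta> k" "length ws = CARD('n) - k + 1"
  shows "aeval id (wedge ws) (aeval cst (f_gen \<Delta> J) p) = aeval id (weight \<Delta> J ws) p"
  unfolding aeval_compose using aeval_f_gen[OF assms] by simp

text \<open>This makes \<open>\<mu>(x, J)\<close> a rational function on the Grassmannian.\<close>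
lemma f_gen_mono_of_not_vanishing:
  fixes \<Delta> :: "(real ^ 'n::{finite,linorder}) set set"
  assumes fan: "complete_simplicial_fan \<Delta>" and J: "J \<in> simplices_of_card \<Delta> k" and k: "1 \<le> k"
  shows "\<not> vanishes_on_G (CARD('n) - k + 1) (aeval cst (f_gen \<Delta> J) (mono_of J))"
proof -
  obtain ws :: "(rat ^ 'n::{finite,linorder}) list" where ws: "length ws = CARD('n) - k + 1" "distinct ws" "vec.independent (set ws)"
    and nz: "\<forall>j\<in>J. weight \<Delta> J ws j \<noteq> 0"
    using exists_nonzero_weights[OF fan J k] by blast
  have "aeval id (weight \<Delta> J ws) (mono_of J) \<noteq> 0"
    unfolding mono_of_def idq.aeval_prod idq.aeval_var using nz
    by (cases "finite J") auto
  then have "aeval id (wedge ws) (aeval cst (f_gen \<Delta> J) (mono_of J)) \<noteq> 0"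
    using aeval_f_gen_eq_weight[OF fan J ws(1)] by simp
  then show ?thesis using ws by (auto simp: vanishes_on_G_iff frame_def)
qed

theorem corollary2p3:
  fixes \<Delta> :: "(real ^ 'n::{finite,linorder}) set set"
    and k :: nat
    and x :: "(real ^ 'n::{finite,linorder}) set qpoly set"
  assumes "complete_simplicial_fan \<Delta>"
    and "1 \<le> k" and "k \<le> CARD('n)"
    and "x \<in> HT_deg \<Delta> k"
  shows "let R = Rat_G (CARD('n) - k + 1); V = H_deg \<Delta> k in
    tensor R V \<one>\<^bsub>R\<^esub> (bar \<Delta> x) =
    finprod (tensor_product R V) (\<lambda>J. tensor R V (mu \<Delta> x J) (bar \<Delta> (x_of \<Delta> J)))
      (simplices_of_card \<Delta> k)"
proof -
  define m where "m = CARD('n) - k + 1"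
  interpret tensor_setting
    "Rat_G m :: (rat, ('n::{finite,linorder} set qpoly \<times> 'n::{finite,linorder} set qpoly) set) module" "H_deg \<Delta> k"
    by (rule tensor_setting_Rat_G_H_deg)
  let ?R = "Rat_G m :: (rat, ('n::{finite,linorder} set qpoly \<times> 'n::{finite,linorder} set qpoly) set) module"
  let ?V = "H_deg \<Delta> k" and ?S = "simplices_of_card \<Delta> k"
  let ?T = "tensor_product ?R ?V"
  note fan = assms(1)
  have fan': "simplicial_fan \<Delta>" using fan by (simp add: complete_simplicial_fan_def)
  have S_rays: "J \<subseteq> rays \<Delta>" if "J \<in> ?S" for J
    using that simplex_rays[OF fan'] by (auto simp: simplices_of_card_def)
  have finS: "finite ?S"
    using finite_rays[OF fan'] S_rays by (intro finite_subset[of ?S "Pow (rays \<Delta>)"]) auto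
  obtain p where p: "p \<in> polys (rays \<Delta>)" "homogeneous k p" and x: "x = HT_class \<Delta> p"
    using assms(4) by (auto simp: HT_deg_def)
  have monoJ: "mono_of J \<in> polys (rays \<Delta>)" "homogeneous k (mono_of J)" if "J \<in> ?S" for J
    using mono_of_polys[OF S_rays[OF that]] homogeneous_mono_of[of J] that by (auto simp: simplices_of_card_def)
  define f where "f J q = aeval cst (f_gen \<Delta> J) q" for J q
  have f_polys: "f J q \<in> plucker_polys m" if "J \<in> ?S" for J q
    unfolding f_def m_def plucker_polys_def
    using f_gen_plucker_polys[OF fan that] by (intro aeval_polys) (simp add: plucker_polys_def)
  have f_hom: "homogeneous k (f J q)" if "J \<in> ?S" "homogeneous k q" for J q
    unfolding f_def using f_gen_homogeneous[OF fan that(1)] that(2) by (rule homogeneous_aeval)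
  have f_eval: "aeval id (wedge ws) (f J q) = aeval id (weight \<Delta> J ws) q" if "J \<in> ?S" "length ws = m" for J q ws
    unfolding f_def using aeval_f_gen_eq_weight[OF fan that(1)] that(2) by (simp add: m_def)
  have fJ: "\<not> vanishes_on_G m (f J (mono_of J))" if "J \<in> ?S" for J
    unfolding f_def m_def by (rule f_gen_mono_of_not_vanishing[OF fan that assms(2)])
  \<comment> \<open>\<open>N J / D\<close> is \<open>\<mu>(x, J)\<close>, with the same denominator for all \<open>J\<close>.\<close>
  define D where "D = (\<Prod>J\<in>?S. f J (mono_of J))"
  define N where "N J = f J p * (\<Prod>J'\<in>?S - {J}. f J' (mono_of J'))" for J
  define d where "d = card ?S * k"
  have D_split: "D = f J (mono_of J) * (\<Prod>J'\<in>?S - {J}. f J' (mono_of J'))" if "J \<in> ?S" for J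
    unfolding D_def using finS that by (rule prod.remove)
  have one: "\<not> vanishes_on_G m (1 :: 'n::{finite,linorder} set qpoly)"
  proof -
    obtain C where "C \<in> \<Delta>" using fan' by (auto simp: simplicial_fan_def)
    then have "edges \<Delta> C \<in> simplices \<Delta>" by (simp add: simplices_def)
    then have "{} \<in> simplices \<Delta>" using simplices_subset[OF fan', of "edges \<Delta> C" "{}"] by simp
    then obtain J where "J \<in> ?S" using simplex_extends[OF fan, of "{}" k] assms(3) by auto
    then have "\<not> vanishes_on_G m (f J (mono_of J))" by (rule fJ)
    then show ?thesis by (auto simp: vanishes_on_G_iff)
  qed
  have D: "D \<in> plucker_polys m" "homogeneous d D" "\<not> vanishes_on_G m D"
  proof -
    show "D \<in> plucker_polys m"
      unfolding D_def using f_polys unfolding plucker_polys_def by (intro polys_prod)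
    show "homogeneous d D"
      unfolding D_def d_def using homogeneous_prod[of ?S "\<lambda>_. k" "\<lambda>J. f J (mono_of J)"] f_hom monoJ
      by simp
    show "\<not> vanishes_on_G m D"
      unfolding D_def using finS fJ one by (rule not_vanishes_on_G_prod)
  qed
  have N: "N J \<in> plucker_polys m \<and> homogeneous d (N J)" if J: "J \<in> ?S" for J
  proof
    show "N J \<in> plucker_polys m"
      unfolding N_def using f_polys J unfolding plucker_polys_def by (intro polys_mult polys_prod) auto
    have "homogeneous (k + (\<Sum>J'\<in>?S - {J}. k)) (N J)"
      unfolding N_def using p(2) monoJ J by (intro homogeneous_mult homogeneous_prod f_hom) auto
    moreover have "k + (\<Sum>J'\<in>?S - {J}. k) = d"
      unfolding d_def using sum.remove[OF finS J, of "\<lambda>_. k"] by simp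
    ultimately show "homogeneous d (N J)" by simp
  qed
  have frac: "(Q, D) \<in> fractions m" if "Q \<in> plucker_polys m \<and> homogeneous d Q" for Q
    using that D by (auto simp: fractions_iff)
  have mu: "mu \<Delta> x J = pullback m (N J) D" if J: "J \<in> ?S" for J
  proof -
    have "card J = k" using J by (simp add: simplices_of_card_def)
    then have "mu \<Delta> x J = pullback m (f J p) (f J (mono_of J))"
      unfolding mu_def x x_of_def f_def m_def
      using f_hom_class[OF fan J] p(1) monoJ(1)[OF J] by simp
    also have "\<dots> = pullback m (N J) D"
    proof (rule pullback_eq)
      have "(f J p, f J (mono_of J)) \<in> fractions m"
        using f_polys[OF J] f_hom[OF J] p(2) monoJ(2)[OF J] fJ[OF J] by (auto simp: fractions_iff)
      then show "((f J p, f J (mono_of J)), (N J, D)) \<in> fraction_rel m"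
        using frac[OF N[OF J]] by (simp add: fraction_rel_iff D_split[OF J] N_def idq.aeval_mult mult_ac)
    qed
    finally show ?thesis .
  qed
  have one_R: "\<one>\<^bsub>?R\<^esub> = pullback m D D"
  proof -
    have "((1, 1), (D, D)) \<in> fraction_rel m"
      using frac[of D] D one
      by (auto simp: fraction_rel_iff fractions_iff plucker_polys_def intro: polys_1 homogeneous_1)
    then have "pullback m 1 1 = pullback m D D" by (rule pullback_eq)
    then show ?thesis by (simp add: Rat_G_def)
  qed
  let ?t = "\<lambda>Q q. tensor ?R ?V (pullback m Q D) (cls \<Delta> q)"
  have tc: "?t Q q \<in> carrier ?T"
    if "Q \<in> plucker_polys m \<and> homogeneous d Q" "q \<in> polys (rays \<Delta>)" "homogeneous k q" for Q q
    using that by (intro tensor_closed Rat_G_carrierI frac cls_forms) auto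
  have negN: "- N J \<in> plucker_polys m \<and> homogeneous d (- N J)" if "J \<in> ?S" for J
    using N[OF that] by (auto simp: plucker_polys_def polys_uminus homogeneous_uminus)
  \<comment> \<open>The index \<open>None\<close> carries \<open>1 \<otimes> x\<close>, the index \<open>Some J\<close> the term of \<open>J\<close> with the opposite sign.\<close>
  define P where "P = (\<lambda>i. case i of None \<Rightarrow> D | Some J \<Rightarrow> - N J)"
  define q where "q = (\<lambda>i. case i of None \<Rightarrow> p | Some J \<Rightarrow> mono_of J)"
  let ?A = "insert None (Some ` ?S)"
  have "finprod ?T (\<lambda>i. ?t (P i) (q i)) ?A = \<one>\<^bsub>?T\<^esub>"
  proof (rule tensor_relation_from_points[OF _ D])
    show "finite ?A" using finS by simp
    show "P i \<in> plucker_polys m \<and> homogeneous d (P i)" if "i \<in> ?A" for i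
      using that D negN by (auto simp: P_def)
    show "q i \<in> {q \<in> polys (rays \<Delta>). homogeneous k q}" if "i \<in> ?A" for i
      using that p monoJ by (auto simp: q_def)
    fix ws :: "(rat ^ 'n::{finite,linorder}) list"
    assume ws: "frame m ws" and nzD: "aeval id (wedge ws) D \<noteq> 0"
    let ?e = "aeval id (wedge ws)"
    have len: "length ws = m" using ws by (simp add: frame_def)
    have nzJ: "?e (f J (mono_of J)) \<noteq> 0" if "J \<in> ?S" for J
      using nzD finS that unfolding D_def idq.aeval_prod by auto
    have nz: "weight \<Delta> J ws j \<noteq> 0" if J: "J \<in> ?S" and j: "j \<in> J" for J j
    proof -
      have "finite J" using finite_subset[OF S_rays[OF J] finite_rays[OF fan']] .
      with nzJ[OF J] j show ?thesis
        unfolding f_eval[OF J len] mono_of_def idq.aeval_prod idq.aeval_var by auto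
    qed
    have len': "length ws = CARD('n) - k + 1" using len by (simp add: m_def)
    have "expands \<Delta> k ws p" by (rule expands_homogeneous[OF fan len' nz p assms(3)])
    then have exp: "cls \<Delta> (p - expansion \<Delta> k ws p) = cls \<Delta> 0" unfolding expands_def by simp
    have ex_polys: "expansion \<Delta> k ws p \<in> polys (rays \<Delta>)" by (rule expansion_polys[OF fan len' nz])
    have "(\<Sum>i\<in>?A. cst (?e (P i)) * q i) = cst (?e D) * p + (\<Sum>J\<in>?S. cst (?e (- N J)) * mono_of J)"
      using finS by (simp add: sum.reindex P_def q_def)
    also have "(\<Sum>J\<in>?S. cst (?e (- N J)) * mono_of J) = - (cst (?e D) * expansion \<Delta> k ws p)"
    proof -
      have "?e (N J) = ?e D * local_mu \<Delta> ws p J" if J: "J \<in> ?S" for J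
        using nzJ[OF J] unfolding N_def D_split[OF J] idq.aeval_mult local_mu_def f_eval[OF J len] by simp
      then show ?thesis
        unfolding expansion_def
        by (simp add: sum_distrib_left idq.aeval_uminus cst_simps sum_negf mult.assoc)
    qed
    also have "cst (?e D) * p + - (cst (?e D) * expansion \<Delta> k ws p) = (p - expansion \<Delta> k ws p) * cst (?e D)"
      by (simp add: algebra_simps)
    also have "cls \<Delta> \<dots> = cls \<Delta> 0"
      using exp p(1) ex_polys by (intro cls_mult_zero polys_intros)
    finally show "cls \<Delta> (\<Sum>i\<in>?A. cst (?e (P i)) * q i) = cls \<Delta> 0" .
  qed
  moreover have "finprod ?T (\<lambda>i. ?t (P i) (q i)) ?A =
      ?t D p \<otimes>\<^bsub>?T\<^esub> finprod ?T (\<lambda>J. ?t (- N J) (mono_of J)) ?S"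
  proof -
    have "finprod ?T (\<lambda>i. ?t (P i) (q i)) (Some ` ?S) = finprod ?T (\<lambda>J. ?t (- N J) (mono_of J)) ?S"
      using tc negN monoJ by (subst T.finprod_reindex) (auto simp: P_def q_def)
    then show ?thesis
      using finS tc negN monoJ D p by (subst T.finprod_insert) (auto simp: P_def q_def)
  qed
  ultimately have XY: "?t D p \<otimes>\<^bsub>?T\<^esub> finprod ?T (\<lambda>J. ?t (- N J) (mono_of J)) ?S = \<one>\<^bsub>?T\<^esub>" by simp
  \<comment> \<open>Changing the sign of all numerators gives the inverse in the tensor product.\<close>
  have YZ: "finprod ?T (\<lambda>J. ?t (- N J) (mono_of J)) ?S \<otimes>\<^bsub>?T\<^esub> finprod ?T (\<lambda>J. ?t (N J) (mono_of J)) ?S = \<one>\<^bsub>?T\<^esub>"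
  proof -
    have "?t (- N J) (mono_of J) \<otimes>\<^bsub>?T\<^esub> ?t (N J) (mono_of J) = \<one>\<^bsub>?T\<^esub>" if J: "J \<in> ?S" for J
    proof -
      have f0: "(0, D) \<in> fractions m" by (rule frac) (simp add: plucker_polys_def polys_0 homogeneous_0)
      have c: "cls \<Delta> (mono_of J) \<in> carrier ?V" using monoJ[OF J] by (intro cls_forms) simp
      have "pullback m (- N J) D \<oplus>\<^bsub>?R\<^esub> pullback m (N J) D = pullback m 0 D"
        using Rat_G_add_same_denominator[OF frac[OF negN[OF J]] frac[OF N[OF J]]] f0 by simp
      then have "?t (- N J) (mono_of J) \<otimes>\<^bsub>?T\<^esub> ?t (N J) (mono_of J) = ?t 0 (mono_of J)"
        using tensor_add_left[OF Rat_G_carrierI[OF frac[OF negN[OF J]]] Rat_G_carrierI[OF frac[OF N[OF J]]] c]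
        by simp
      also have "\<dots> = \<one>\<^bsub>?T\<^esub>"
        using Rat_G_add_same_denominator[OF f0 f0] f0
        by (intro tensor_idempotent_left Rat_G_carrierI c) auto
      finally show ?thesis .
    qed
    then have "finprod ?T (\<lambda>J. ?t (- N J) (mono_of J) \<otimes>\<^bsub>?T\<^esub> ?t (N J) (mono_of J)) ?S = \<one>\<^bsub>?T\<^esub>"
      by (intro T.finprod_one_eqI) auto
    then show ?thesis using tc N negN monoJ by (subst T.finprod_multf[symmetric]) auto
  qed
  have "?t D p = finprod ?T (\<lambda>J. ?t (N J) (mono_of J)) ?S"
  proof (rule T.inv_unique[OF XY YZ])
    show "?t D p \<in> carrier ?T" using tc D p by blast
    show "finprod ?T (\<lambda>J. ?t (- N J) (mono_of J)) ?S \<in> carrier ?T"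
      using tc negN monoJ by (intro T.finprod_closed) auto
    show "finprod ?T (\<lambda>J. ?t (N J) (mono_of J)) ?S \<in> carrier ?T"
      using tc N monoJ by (intro T.finprod_closed) auto
  qed
  also have "\<dots> = finprod ?T (\<lambda>J. tensor ?R ?V (mu \<Delta> x J) (bar \<Delta> (x_of \<Delta> J))) ?S"
  proof (rule T.finprod_cong'[OF refl])
    have eq: "?t (N J) (mono_of J) = tensor ?R ?V (mu \<Delta> x J) (bar \<Delta> (x_of \<Delta> J))" if "J \<in> ?S" for J
      using mu[OF that] by (simp add: cls_def x_of_def)
    then show "?t (N J) (mono_of J) = tensor ?R ?V (mu \<Delta> x J) (bar \<Delta> (x_of \<Delta> J))" if "J \<in> ?S" for J
      using that .
    show "(\<lambda>J. tensor ?R ?V (mu \<Delta> x J) (bar \<Delta> (x_of \<Delta> J))) \<in> ?S \<rightarrow> carrier ?T"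
      using eq[symmetric] tc N monoJ by (simp add: Pi_def)
  qed
  finally show ?thesis
    unfolding one_R[symmetric] by (simp add: Let_def cls_def x m_def)
qed

end
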